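(* Let $d \ge 1$. A complex Borel measure on $\partial\mathbb{B}_d$ is $\operatorname{Mult}(H^2_d)$-Henkin if and only if it is absolutely continuous with respect to a Borel probability measure on $\partial\mathbb{B}_d$ of finite $H^2_d$-energy.
   Context: $\mathbb{B}_d$ is the open Euclidean unit ball of $\mathbb{C}^d$, with boundary sphere $\partial\mathbb{B}_d$. The Drury--Arveson space $H^2_d$ is the reproducing kernel Hilbert space of holomorphic functions on $\mathbb{B}_d$ with kernel $K(z,w) = \frac{1}{1 - \langle z,w\rangle}$. $\operatorname{Mult}(H^2_d)$ is its multiplier algebra, $\{\varphi : \mathbb{B}_d \to \mathbb{C} : \varphi f \in H^2_d \text{ for all } f \in H^2_d\}$, with the norm $\|\varphi\|_{\operatorname{Mult}(H^2_d)}$ equal to the operator norm of $f \mapsto \varphi f$ on $H^2_d$; it contains the polynomials. A complex Borel measure $\mu$ on $\partial\mathbb{B}_d$ is $\operatorname{Mult}(H^2_d)$-Henkin if for every sequence $(p_n)$ of polynomials with $\sup_n \|p_n\|_{\operatorname{Mult}(H^2_d)} < \infty$ and $\lim_{n} p_n(z) = 0$ for all $z \in \mathbb{B}_d$, one has $\lim_n \int_{\partial\mathbb{B}_d} p_n\, d\mu = 0$. The $H^2_d$-energy of a Borel probability measure $\mu$ on $\partial\mathbb{B}_d$ is $$\mathcal{E}(\mu) = \sup_{0 \le r < 1} \int_{\partial\mathbb{B}_d}\int_{\partial\mathbb{B}_d} \operatorname{Re} K(rz,rw)\, d\mu(w)\, d\mu(z) \in [0,\infty].$$ *)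

theory Defs
  imports "HOL-Probability.Probability"
begin

section \<open>Reproducing kernel Hilbert spaces and multipliers\<close>

text \<open>
  A Hilbert space of functions on a set X is given by its set H of elements and its inner
  product ip, which is linear in the first argument.  A function on X is represented by its
  extension by 0 to the whole type, so that equality in H is equality of functions on X.
  The values of ip outside H are irrelevant.
\<close>

definition ip_norm :: "('b \<Rightarrow> 'b \<Rightarrow> complex) \<Rightarrow> 'b \<Rightarrow> real"
  where "ip_norm ip f = sqrt (Re (ip f f))"

locale rkhs =
  fixes X :: "'a set"
    and K :: "'a \<Rightarrow> 'a \<Rightarrow> complex"
    and H :: "('a \<Rightarrow> complex) set"
    and ip :: "('a \<Rightarrow> complex) \<Rightarrow> ('a \<Rightarrow> complex) \<Rightarrow> complex"
  assumes support: "f \<in> H \<Longrightarrow> z \<notin> X \<Longrightarrow> f z = 0"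
    and zero_mem: "(\<lambda>z. 0) \<in> H"
    and add_mem: "f \<in> H \<Longrightarrow> g \<in> H \<Longrightarrow> (\<lambda>z. f z + g z) \<in> H"
    and scale_mem: "f \<in> H \<Longrightarrow> (\<lambda>z. c * f z) \<in> H"
    and ip_add: "f \<in> H \<Longrightarrow> g \<in> H \<Longrightarrow> h \<in> H \<Longrightarrow> ip (\<lambda>z. f z + g z) h = ip f h + ip g h"
    and ip_scale: "f \<in> H \<Longrightarrow> h \<in> H \<Longrightarrow> ip (\<lambda>z. c * f z) h = c * ip f h"
    and ip_cnj: "f \<in> H \<Longrightarrow> g \<in> H \<Longrightarrow> ip g f = cnj (ip f g)"
    and ip_pos: "f \<in> H \<Longrightarrow> f \<noteq> (\<lambda>z. 0) \<Longrightarrow> Re (ip f f) > 0"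
    and complete:
      "(\<And>n. F n \<in> H) \<Longrightarrow>
       (\<And>e. e > 0 \<Longrightarrow> \<exists>N. \<forall>m\<ge>N. \<forall>n\<ge>N. ip_norm ip (\<lambda>z. F m z - F n z) < e) \<Longrightarrow>
       \<exists>f\<in>H. (\<lambda>n::nat. ip_norm ip (\<lambda>z. F n z - f z)) \<longlonglongrightarrow> 0"
    and kernel_mem: "w \<in> X \<Longrightarrow> (\<lambda>z. if z \<in> X then K z w else 0) \<in> H"
    and reproducing: "f \<in> H \<Longrightarrow> w \<in> X \<Longrightarrow> ip f (\<lambda>z. if z \<in> X then K z w else 0) = f w"

definition multipliers :: "('a \<Rightarrow> complex) set \<Rightarrow> ('a \<Rightarrow> complex) set"
  where "multipliers H = {\<phi>. \<forall>f\<in>H. (\<lambda>z. \<phi> z * f z) \<in> H}"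

text \<open>
  The operator norm of multiplication by \<open>\<phi>\<close>, with the value \<open>\<infinity>\<close> for functions that are not
  multipliers.  As elements of H vanish outside X, only the values of \<open>\<phi>\<close> on X matter.
\<close>

definition mult_norm ::
  "('a \<Rightarrow> complex) set \<Rightarrow> (('a \<Rightarrow> complex) \<Rightarrow> ('a \<Rightarrow> complex) \<Rightarrow> complex) \<Rightarrow> ('a \<Rightarrow> complex) \<Rightarrow> ennreal"
  where "mult_norm H ip \<phi> =
    (if \<phi> \<in> multipliers H
     then (SUP f\<in>{f \<in> H. ip_norm ip f \<le> 1}. ennreal (ip_norm ip (\<lambda>z. \<phi> z * f z)))
     else \<infinity>)"

text \<open>
  The kernel of the Drury-Arveson space.  It determines the space: the latter is the H with
  \<open>rkhs (ball 0 1) da_kernel H ip\<close>, and its elements are holomorphic on the ball because the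
  kernel is holomorphic in its first argument and locally bounded on the diagonal.
\<close>

definition da_kernel :: "complex ^ 'd \<Rightarrow> complex ^ 'd \<Rightarrow> complex"
  where "da_kernel z w = 1 / (1 - (\<Sum>i\<in>UNIV. z $ i * cnj (w $ i)))"

text \<open>Complex (holomorphic) polynomials, as functions.\<close>

definition complex_polynomial :: "(complex ^ 'd \<Rightarrow> complex) \<Rightarrow> bool"
  where "complex_polynomial p \<longleftrightarrow>
    (\<exists>(A :: ('d \<Rightarrow> nat) set) c. finite A \<and>
       p = (\<lambda>z. \<Sum>\<alpha>\<in>A. c \<alpha> * (\<Prod>i\<in>UNIV. (z $ i) ^ \<alpha> i)))"

section \<open>Complex measures\<close>

text \<open>
  A complex measure is a set function.  The positive measure M in the following definitions
  serves only to provide the underlying measurable space.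
\<close>

definition complex_measure :: "'a measure \<Rightarrow> ('a set \<Rightarrow> complex) \<Rightarrow> bool"
  where "complex_measure M m \<longleftrightarrow>
    (\<forall>A :: nat \<Rightarrow> 'a set. range A \<subseteq> sets M \<longrightarrow> disjoint_family A \<longrightarrow>
       (\<lambda>n. m (A n)) sums m (\<Union>n. A n))"

text \<open>
  The positive part of the Jordan decomposition of a real measure s; the negative part is the
  positive part of \<open>-s\<close>.  Sets B with \<open>s B < 0\<close> contribute \<open>ennreal (s B) = 0\<close>.
\<close>

definition positive_variation :: "'a measure \<Rightarrow> ('a set \<Rightarrow> real) \<Rightarrow> 'a measure"
  where "positive_variation M s =
    measure_of (space M) (sets M) (\<lambda>A. SUP B\<in>{B \<in> sets M. B \<subseteq> A}. ennreal (s B))"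

definition real_measure_integral :: "'a measure \<Rightarrow> ('a set \<Rightarrow> real) \<Rightarrow> ('a \<Rightarrow> complex) \<Rightarrow> complex"
  where "real_measure_integral M s f =
    (\<integral>x. f x \<partial>positive_variation M s) - (\<integral>x. f x \<partial>positive_variation M (\<lambda>A. - s A))"

definition complex_measure_integral ::
  "'a measure \<Rightarrow> ('a set \<Rightarrow> complex) \<Rightarrow> ('a \<Rightarrow> complex) \<Rightarrow> complex"
  where "complex_measure_integral M m f =
    real_measure_integral M (\<lambda>A. Re (m A)) f + \<i> * real_measure_integral M (\<lambda>A. Im (m A)) f"

definition complex_absolutely_continuous :: "'a measure \<Rightarrow> ('a set \<Rightarrow> complex) \<Rightarrow> bool"
  where "complex_absolutely_continuous \<mu> m \<longleftrightarrow> (\<forall>A\<in>null_sets \<mu>. m A = 0)"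

section \<open>Henkin measures and energy\<close>

definition sphere_borel :: "(complex ^ 'd) measure"
  where "sphere_borel = restrict_space borel (sphere 0 1)"

definition henkin ::
  "(complex ^ 'd \<Rightarrow> complex) set \<Rightarrow>
   ((complex ^ 'd \<Rightarrow> complex) \<Rightarrow> (complex ^ 'd \<Rightarrow> complex) \<Rightarrow> complex) \<Rightarrow>
   ((complex ^ 'd) set \<Rightarrow> complex) \<Rightarrow> bool"
  where "henkin H ip m \<longleftrightarrow>
    (\<forall>p :: nat \<Rightarrow> complex ^ 'd \<Rightarrow> complex.
       (\<forall>n. complex_polynomial (p n)) \<longrightarrow>
       (SUP n. mult_norm H ip (p n)) < \<infinity> \<longrightarrow>
       (\<forall>z\<in>ball 0 1. (\<lambda>n. p n z) \<longlonglongrightarrow> 0) \<longrightarrow>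
       (\<lambda>n. complex_measure_integral sphere_borel m (p n)) \<longlonglongrightarrow> 0)"

definition energy :: "(complex ^ 'd) measure \<Rightarrow> ereal"
  where "energy \<mu> =
    (SUP r\<in>{0..<1}. ereal (\<integral>z. (\<integral>w. Re (da_kernel (r *\<^sub>R z) (r *\<^sub>R w)) \<partial>\<mu>) \<partial>\<mu>))"

end

theory Submission
  imports Defs
begin

text \<open>
  If \<open>\<mu>\<close> has finite energy, then so has \<open>g \<mu>\<close> for every bounded real \<open>g\<close>, because the real part of the
  kernel is positive.  Hence \<open>p \<mapsto> \<integral> p g d\<mu>\<close> is bounded in the norm of the space, and it converges to 0
  along multiplier-bounded sequences converging to 0 pointwise on the ball; as such sequences are uniformly
  bounded on the sphere, the same holds for every \<open>g\<close> in \<open>L\<^sup>1(\<mu>)\<close>.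

  Conversely, let \<open>\<nu>\<close> be a positive measure equivalent to the total variation of a Henkin measure \<open>m\<close>.
  By exhaustion there is a density \<open>h\<close> with \<open>h \<nu>\<close> of finite energy which is positive wherever any such
  density is, up to null sets.  Let K be a compact subset of \<open>{h = 0}\<close>.  No nonzero \<open>g \<nu>\<close> with bounded
  \<open>g \<ge> 0\<close> supported on K has finite energy, so a minimax argument provides convex combinations
  of kernel functions \<open>K(\<cdot>, w\<^sub>j)\<close>, the \<open>w\<^sub>j\<close> being in the ball on rays through K, whose real part is
  arbitrarily large on K off a set of arbitrarily small measure.  Multiplication by
  \<open>V = \<Sum> c\<^sub>j (2 K(\<cdot>, w\<^sub>j) - 1)\<close> is an accretive operator, being a mean of Cayley transforms
  \<open>(1 + T) / (1 - T)\<close> of contractions, so the \<open>1 - exp (- \<epsilon> V)\<close> are bounded multipliers.  For suitable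
  \<open>\<epsilon>\<close> and V they converge to 0 on the ball and to the indicator function of K on the sphere, whence
  \<open>m(K) = 0\<close>.  Thus \<open>m\<close> vanishes on \<open>{h = 0}\<close>, that is, \<open>m\<close> is absolutely continuous with respect to
  \<open>h \<nu>\<close>.
\<close>

section \<open>Reproducing kernel Hilbert spaces\<close>

text \<open>The obstacle in the converse is that the test functions must be polynomials bounded as
  multipliers, whereas kernel combinations that are large on K have large multiplier norm.
  Accretivity resolves this: it survives convex combinations, and \<open>exp (- V)\<close> is a
  contraction for every accretive V, however large. The special form of the kernel enters through
  one fact, that multiplication by \<open>hip z w\<close> has norm at most |w|. Polynomials are
  reached by truncating the geometric series of the kernel and by replacing \<open>exp (- p)\<close>
  with \<open>(1 - p / M) ^ M\<close>; both changes cost only fixed constants, whence the uniform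
  bound \<open>1 + exp 2\<close>. A limit object is needed three times: an element of the space with
  given values, a strongly convergent sequence of averages, and one density obeying infinitely many
  potential bounds. Each is found by minimizing a squared norm over convex sets, where the
  parallelogram law makes minimizing sequences Cauchy. Compactness of K gives points of the sphere
  off K a positive distance from K, so that kernel functions with parameter on the rays through K
  stay bounded at such points.\<close>

lemma tendsto_recip_Suc: "(\<lambda>n. 1 / (real n + 1)) \<longlonglongrightarrow> 0"
  using LIMSEQ_inverse_real_of_nat by (simp add: inverse_eq_divide add.commute)

text \<open>Stands in for weak compactness. The infima \<open>a k\<close> increase to a limit L, and
  for m, n >= N the midpoint lies in \<open>C N\<close>, so that \<open>q\<close> there is at least
  \<open>a N\<close>; the expression in the last conclusion is therefore at most
  \<open>4 * (L - a N) + 4 / (N + 1)\<close>. In each application \<open>q\<close> is a squared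
  norm, possibly minus a real-linear term, and that expression is the squared distance of
  \<open>x m\<close> and \<open>x n\<close>.\<close>

lemma minimizing_sequence:
  fixes C :: "nat \<Rightarrow> 'v set" and q :: "'v \<Rightarrow> real" and mid :: "'v \<Rightarrow> 'v \<Rightarrow> 'v"
  assumes dec: "\<And>k. C (Suc k) \<subseteq> C k"
    and nonempty: "\<And>k. C k \<noteq> {}"
    and mid: "\<And>k x y. x \<in> C k \<Longrightarrow> y \<in> C k \<Longrightarrow> mid x y \<in> C k"
    and lower: "\<And>x. x \<in> C 0 \<Longrightarrow> l \<le> q x"
    and upper: "\<And>k. \<exists>x\<in>C k. q x \<le> u"
  obtains x where "\<And>k. x k \<in> C k"
    and "\<And>k y. y \<in> C k \<Longrightarrow> q (x k) \<le> q y + 1 / (real k + 1)"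
    and "\<And>e. e > 0 \<Longrightarrow> \<exists>N. \<forall>m\<ge>N. \<forall>n\<ge>N. 2 * q (x m) + 2 * q (x n) - 4 * q (mid (x m) (x n)) < e"
proof -
  have anti: "C n \<subseteq> C k" if "k \<le> n" for k n
    using lift_Suc_antimono_le[of C k n] dec that by blast
  define a where "a k = Inf (q ` C k)" for k
  have bdd: "bdd_below (q ` C k)" for k
    using lower anti[of 0 k] by (intro bdd_belowI2[where m = l]) auto
  have a_le: "a k \<le> q y" if "y \<in> C k" for k y
    unfolding a_def by (intro cInf_lower bdd) (use that in auto)
  have a_le_u: "a k \<le> u" for k
    using upper[of k] a_le by force
  have a_mono: "incseq a"
    unfolding a_def
    by (intro incseq_SucI cInf_superset_mono bdd) (use nonempty dec in \<open>auto intro!: image_mono\<close>)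
  obtain L where L: "a \<longlonglongrightarrow> L" "\<And>k. a k \<le> L"
    using incseq_convergent[OF a_mono, of u] a_le_u by auto
  have "\<exists>y\<in>C k. q y \<le> a k + 1 / (real k + 1)" for k
  proof -
    have "Inf (q ` C k) < a k + 1 / (real k + 1)"
      unfolding a_def by simp
    then show ?thesis
      using cInf_lessD[of "q ` C k"] nonempty by (force intro: less_imp_le)
  qed
  then obtain x where x: "\<And>k. x k \<in> C k" "\<And>k. q (x k) \<le> a k + 1 / (real k + 1)"
    by metis
  have "\<exists>N. \<forall>m\<ge>N. \<forall>n\<ge>N. 2 * q (x m) + 2 * q (x n) - 4 * q (mid (x m) (x n)) < e" if "e > 0" for e
  proof -
    have "(\<lambda>N. 4 * (L - a N) + 4 * (1 / (real N + 1))) \<longlonglongrightarrow> 4 * (L - L) + 4 * 0"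
      by (intro tendsto_intros L tendsto_recip_Suc)
    then have "\<forall>\<^sub>F N in sequentially. 4 * (L - a N) + 4 * (1 / (real N + 1)) < e"
      using that by (intro order_tendstoD) auto
    then obtain N where N: "4 * (L - a N) + 4 * (1 / (real N + 1)) < e"
      by (meson eventually_sequentially order_refl)
    show ?thesis
    proof (intro exI[of _ N] allI impI)
      fix m n assume mn: "m \<ge> N" "n \<ge> N"
      have *: "q (x k) \<le> L + 1 / (real N + 1)" if "k \<ge> N" for k
      proof -
        have "1 / (real k + 1) \<le> 1 / (real N + 1)"
          using that by (simp add: frac_le)
        then show ?thesis using x(2)[of k] L(2)[of k] by linarith
      qed
      have "a N \<le> q (mid (x m) (x n))"
        using mn x(1) anti by (intro a_le mid) blast+
      then show "2 * q (x m) + 2 * q (x n) - 4 * q (mid (x m) (x n)) < e"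
        using *[OF mn(1)] *[OF mn(2)] N by (simp add: algebra_simps)
    qed
  qed
  moreover have "q (x k) \<le> q y + 1 / (real k + 1)" if "y \<in> C k" for k y
    using x(2)[of k] a_le[OF that] by linarith
  ultimately show ?thesis using x(1) that by blast
qed

section \<open>Inner product calculus, kernel combinations and a membership criterion\<close>

context rkhs
begin

abbreviation kf :: "'a \<Rightarrow> 'a \<Rightarrow> complex"
  where "kf w \<equiv> (\<lambda>z. if z \<in> X then K z w else 0)"

abbreviation nrm :: "('a \<Rightarrow> complex) \<Rightarrow> real"
  where "nrm \<equiv> ip_norm ip"

lemma diff_mem: "f \<in> H \<Longrightarrow> g \<in> H \<Longrightarrow> (\<lambda>z. f z - g z) \<in> H"
  using add_mem[of f "\<lambda>z. (-1) * g z"] scale_mem[of g "-1"] by simp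

lemma ip_diff: "f \<in> H \<Longrightarrow> g \<in> H \<Longrightarrow> h \<in> H \<Longrightarrow> ip (\<lambda>z. f z - g z) h = ip f h - ip g h"
  using ip_add[of f "\<lambda>z. (-1) * g z" h] ip_scale[of g h "-1"] scale_mem[of g "-1"] by simp

lemma ip_add_right:
  assumes "f \<in> H" "g \<in> H" "h \<in> H"
  shows "ip h (\<lambda>z. f z + g z) = ip h f + ip h g"
proof -
  have "ip h (\<lambda>z. f z + g z) = cnj (ip (\<lambda>z. f z + g z) h)"
    using assms by (intro ip_cnj add_mem)
  also have "\<dots> = ip h f + ip h g"
    using assms ip_cnj[of f h] ip_cnj[of g h] by (simp add: ip_add)
  finally show ?thesis .
qed

lemma ip_scale_right:
  assumes "f \<in> H" "h \<in> H"
  shows "ip h (\<lambda>z. c * f z) = cnj c * ip h f"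
proof -
  have "ip h (\<lambda>z. c * f z) = cnj (ip (\<lambda>z. c * f z) h)"
    using assms by (intro ip_cnj scale_mem)
  also have "\<dots> = cnj c * ip h f"
    using assms ip_cnj[of f h] by (simp add: ip_scale)
  finally show ?thesis .
qed

lemma ip_diff_right:
  "f \<in> H \<Longrightarrow> g \<in> H \<Longrightarrow> h \<in> H \<Longrightarrow> ip h (\<lambda>z. f z - g z) = ip h f - ip h g"
  using ip_add_right[of f "\<lambda>z. (-1) * g z" h] ip_scale_right[of g h "-1"] scale_mem[of g "-1"]
  by simp

lemma sum_mem:
  "finite I \<Longrightarrow> (\<And>i. i \<in> I \<Longrightarrow> f i \<in> H) \<Longrightarrow> (\<lambda>z. \<Sum>i\<in>I. f i z) \<in> H"
  by (induction I rule: finite_induct) (auto intro: zero_mem add_mem)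

lemma ip_zero_left: "h \<in> H \<Longrightarrow> ip (\<lambda>z. 0) h = 0"
  using ip_scale[OF zero_mem, of h 0] by simp

lemma ip_sum:
  "finite I \<Longrightarrow> (\<And>i. i \<in> I \<Longrightarrow> f i \<in> H) \<Longrightarrow> h \<in> H \<Longrightarrow> ip (\<lambda>z. \<Sum>i\<in>I. f i z) h = (\<Sum>i\<in>I. ip (f i) h)"
proof (induction I rule: finite_induct)
  case empty
  then show ?case by (simp add: ip_zero_left)
next
  case (insert i I)
  then show ?case using ip_add[of "f i" "\<lambda>z. \<Sum>i\<in>I. f i z" h] sum_mem[of I f] by simp
qed

lemma Im_ip_self: "f \<in> H \<Longrightarrow> Im (ip f f) = 0"
  using ip_cnj[of f f] by (metis cnj.simps(2) equation_minus_iff neg_equal_zero)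

lemma Re_ip_self_nonneg: "f \<in> H \<Longrightarrow> 0 \<le> Re (ip f f)"
  by (cases "f = (\<lambda>z. 0)") (auto simp: ip_zero_left intro: less_imp_le ip_pos)

lemma nrm_nonneg: "f \<in> H \<Longrightarrow> 0 \<le> nrm f"
  by (simp add: ip_norm_def Re_ip_self_nonneg)

lemma nrm_sq: "f \<in> H \<Longrightarrow> (nrm f)\<^sup>2 = Re (ip f f)"
  by (simp add: ip_norm_def Re_ip_self_nonneg)

lemma ip_self: "f \<in> H \<Longrightarrow> ip f f = complex_of_real ((nrm f)\<^sup>2)"
  by (simp add: complex_eq_iff nrm_sq Im_ip_self)

lemma nrm_zero_iff: "f \<in> H \<Longrightarrow> nrm f = 0 \<longleftrightarrow> f = (\<lambda>z. 0)"
  by (metis ip_norm_def ip_pos ip_zero_left less_irrefl real_sqrt_eq_0_iff zero_complex.sel(1))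

lemma nrm_add_sq:
  assumes "f \<in> H" "g \<in> H"
  shows "(nrm (\<lambda>z. f z + g z))\<^sup>2 = (nrm f)\<^sup>2 + 2 * Re (ip f g) + (nrm g)\<^sup>2"
  using assms ip_cnj[of f g] by (simp add: nrm_sq add_mem ip_add ip_add_right)

lemma nrm_diff_sq:
  assumes "f \<in> H" "g \<in> H"
  shows "(nrm (\<lambda>z. f z - g z))\<^sup>2 = (nrm f)\<^sup>2 - 2 * Re (ip f g) + (nrm g)\<^sup>2"
  using assms ip_cnj[of f g] by (simp add: nrm_sq diff_mem ip_diff ip_diff_right)

lemma nrm_scale: "f \<in> H \<Longrightarrow> nrm (\<lambda>z. c * f z) = cmod c * nrm f"
proof -
  assume f: "f \<in> H"
  have "ip (\<lambda>z. c * f z) (\<lambda>z. c * f z) = (c * cnj c) * ip f f"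
    using f by (simp add: ip_scale ip_scale_right scale_mem)
  also have "\<dots> = complex_of_real ((cmod c * nrm f)\<^sup>2)"
    by (subst complex_norm_square[symmetric], subst ip_self[OF f]) (simp add: power_mult_distrib)
  finally show ?thesis using f by (simp add: ip_norm_def[of ip "\<lambda>z. c * f z"] nrm_nonneg)
qed

lemma nrm_minus: "nrm (\<lambda>z. f z - g z) = nrm (\<lambda>z. g z - f z)" if "f \<in> H" "g \<in> H"
  using nrm_scale[OF diff_mem[OF that], of "-1"] by simp

lemma Cauchy_Schwarz:
  assumes f: "f \<in> H" and g: "g \<in> H"
  shows "cmod (ip f g) \<le> nrm f * nrm g"
proof (cases "g = (\<lambda>z. 0)")
  case True
  then have "ip f g = 0" using ip_scale_right[OF zero_mem f, of 0] by simp
  then show ?thesis using f g by (simp add: nrm_nonneg)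
next
  case False
  then have n0: "nrm g > 0" using nrm_zero_iff[OF g] nrm_nonneg[OF g] by auto
  define t where "t = ip f g / complex_of_real ((nrm g)\<^sup>2)"
  have "0 \<le> (nrm (\<lambda>z. f z - t * g z))\<^sup>2" by simp
  also have "\<dots> = (nrm f)\<^sup>2 - 2 * Re (cnj t * ip f g) + (cmod t * nrm g)\<^sup>2"
    using nrm_diff_sq[OF f scale_mem[OF g, of t]] by (simp add: ip_scale_right[OF g f] nrm_scale[OF g])
  also have "cnj t * ip f g = complex_of_real ((cmod (ip f g))\<^sup>2 / (nrm g)\<^sup>2)"
    unfolding t_def of_real_divide complex_norm_square by (simp add: mult.commute)
  also have "(cmod t * nrm g)\<^sup>2 = (cmod (ip f g))\<^sup>2 / (nrm g)\<^sup>2"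
    unfolding t_def using n0 by (simp add: norm_divide norm_power power_mult_distrib power_divide)
        (simp add: field_simps flip: power_add)
  finally have "(cmod (ip f g))\<^sup>2 / (nrm g)\<^sup>2 \<le> (nrm f)\<^sup>2" by simp
  then have "(cmod (ip f g))\<^sup>2 \<le> (nrm f * nrm g)\<^sup>2"
    using n0 by (simp add: pos_divide_le_eq power_mult_distrib)
  then show ?thesis
    by (rule power2_le_imp_le) (simp add: f g nrm_nonneg)
qed

lemma nrm_triangle:
  assumes f: "f \<in> H" and g: "g \<in> H"
  shows "nrm (\<lambda>z. f z + g z) \<le> nrm f + nrm g"
proof (rule power2_le_imp_le)
  have "Re (ip f g) \<le> nrm f * nrm g"
    using Cauchy_Schwarz[OF f g] complex_Re_le_cmod[of "ip f g"] by linarith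
  then show "(nrm (\<lambda>z. f z + g z))\<^sup>2 \<le> (nrm f + nrm g)\<^sup>2"
    unfolding nrm_add_sq[OF f g] by (simp add: power2_sum)
qed (use f g in \<open>simp add: nrm_nonneg\<close>)

lemma nrm_kf: "w \<in> X \<Longrightarrow> (nrm (kf w))\<^sup>2 = Re (K w w)"
  using reproducing[OF kernel_mem, of w w] by (simp add: nrm_sq kernel_mem)

lemma eval_bound: "f \<in> H \<Longrightarrow> w \<in> X \<Longrightarrow> cmod (f w) \<le> nrm f * nrm (kf w)"
  using Cauchy_Schwarz[OF _ kernel_mem, of f w] by (simp add: reproducing)

lemma nrm_limit_eval:
  assumes F: "\<And>n. F n \<in> H" and f: "f \<in> H"
    and lim: "(\<lambda>n. nrm (\<lambda>z. F n z - f z)) \<longlonglongrightarrow> 0" and w: "w \<in> X"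
  shows "(\<lambda>n. F n w) \<longlonglongrightarrow> f w"
proof -
  have "(\<lambda>n. nrm (\<lambda>z. F n z - f z) * nrm (kf w)) \<longlonglongrightarrow> 0"
    using tendsto_mult_left_zero[OF lim] .
  then have "(\<lambda>n. F n w - f w) \<longlonglongrightarrow> 0"
    by (rule Lim_null_comparison[rotated])
      (use eval_bound[OF diff_mem[OF F f] w] in auto)
  then show ?thesis by (simp add: LIM_zero_iff)
qed

lemma comb_mem:
  "finite I \<Longrightarrow> (\<And>i. i \<in> I \<Longrightarrow> w i \<in> X) \<Longrightarrow> (\<lambda>z. \<Sum>i\<in>I. c i * kf (w i) z) \<in> H"
  by (intro sum_mem scale_mem kernel_mem)

lemma ip_comb:
  assumes "finite I" "\<And>i. i \<in> I \<Longrightarrow> w i \<in> X" "f \<in> H"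
  shows "ip f (\<lambda>z. \<Sum>i\<in>I. c i * kf (w i) z) = (\<Sum>i\<in>I. cnj (c i) * f (w i))"
proof -
  have "ip f (\<lambda>z. \<Sum>i\<in>I. c i * kf (w i) z) = cnj (ip (\<lambda>z. \<Sum>i\<in>I. c i * kf (w i) z) f)"
    using assms by (intro ip_cnj comb_mem)
  also have "ip (\<lambda>z. \<Sum>i\<in>I. c i * kf (w i) z) f = (\<Sum>i\<in>I. c i * cnj (f (w i)))"
    using assms
  proof (subst ip_sum)
    show "(\<Sum>i\<in>I. ip (\<lambda>z. c i * kf (w i) z) f) = (\<Sum>i\<in>I. c i * cnj (f (w i)))"
      by (intro sum.cong refl)
        (use assms in \<open>simp add: ip_scale kernel_mem ip_cnj[of f] reproducing\<close>)
  qed (auto intro!: scale_mem[OF kernel_mem])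
  finally show ?thesis by simp
qed

lemma nrm_comb:
  assumes I: "finite I" "\<And>i. i \<in> I \<Longrightarrow> w i \<in> X"
  shows "complex_of_real ((nrm (\<lambda>z. \<Sum>i\<in>I. c i * kf (w i) z))\<^sup>2)
    = (\<Sum>j\<in>I. \<Sum>i\<in>I. cnj (c j) * c i * K (w j) (w i))"
proof -
  have "complex_of_real ((nrm (\<lambda>z. \<Sum>i\<in>I. c i * kf (w i) z))\<^sup>2)
      = (\<Sum>j\<in>I. cnj (c j) * (\<Sum>i\<in>I. c i * kf (w i) (w j)))"
    using comb_mem[OF I] by (subst ip_self[symmetric]) (auto simp: ip_comb[OF I])
  also have "\<dots> = (\<Sum>j\<in>I. \<Sum>i\<in>I. cnj (c j) * c i * K (w j) (w i))"
    unfolding sum_distrib_left using I(2) by (intro sum.cong refl) auto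
  finally show ?thesis .
qed

text \<open>The limit is produced by minimizing \<open>\<parallel>k\<parallel>\<^sup>2 - 2 Re \<langle>g, k\<rangle>\<close> over the span of the kernel functions \<open>k\<close>.\<close>

lemma mem_if_kernel_bound:
  assumes C: "0 \<le> C"
    and supp: "\<And>z. z \<notin> X \<Longrightarrow> g z = 0"
    and bound: "\<And>F b. finite F \<Longrightarrow> F \<subseteq> X \<Longrightarrow>
      cmod (\<Sum>w\<in>F. cnj (b w) * g w) \<le> C * nrm (\<lambda>z. \<Sum>w\<in>F. b w * kf w z)"
  shows "g \<in> H \<and> nrm g \<le> C"
proof -
  \<comment> \<open>Pairs of a kernel combination k and the value l that the pairing of g with k
    must have. Carrying l as a separate component avoids any choice of representation of k.\<close>
  define S where "S = {(k, l) | k l F b. finite F \<and> F \<subseteq> X \<and>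
    k = (\<lambda>z. \<Sum>w\<in>F. b w * kf w z) \<and> l = (\<Sum>w\<in>F. cnj (b w) * g w)}"
  define q where "q x = (nrm (fst x))\<^sup>2 - 2 * Re (snd x)" for x :: "('a \<Rightarrow> complex) \<times> complex"
  define mid where "mid x y = ((\<lambda>z. 1/2 * fst x z + 1/2 * fst y z), 1/2 * snd x + 1/2 * snd y)"
    for x y :: "('a \<Rightarrow> complex) \<times> complex"
  have SI: "((\<lambda>z. \<Sum>w\<in>F. b w * kf w z), \<Sum>w\<in>F. cnj (b w) * g w) \<in> S"
    if "finite F" "F \<subseteq> X" for F b
    unfolding S_def using that by blast
  have S_H: "fst x \<in> H" if "x \<in> S" for x
    using that unfolding S_def by (auto intro!: comb_mem)
  have S_bound: "cmod (snd x) \<le> C * nrm (fst x)" if "x \<in> S" for x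
    using that bound unfolding S_def by auto
  have S_lin: "((\<lambda>z. s * fst x z + t * fst y z), cnj s * snd x + cnj t * snd y) \<in> S"
    if xy: "x \<in> S" "y \<in> S" for x y s t
  proof -
    obtain F b where F: "finite F" "F \<subseteq> X" "fst x = (\<lambda>z. \<Sum>w\<in>F. b w * kf w z)"
      "snd x = (\<Sum>w\<in>F. cnj (b w) * g w)"
      using xy unfolding S_def by force
    obtain G c where G: "finite G" "G \<subseteq> X" "fst y = (\<lambda>z. \<Sum>w\<in>G. c w * kf w z)"
      "snd y = (\<Sum>w\<in>G. cnj (c w) * g w)"
      using xy unfolding S_def by force
    define d where "d w = s * (if w \<in> F then b w else 0) + t * (if w \<in> G then c w else 0)" for w
    have "((\<lambda>z. \<Sum>w\<in>F \<union> G. d w * kf w z), \<Sum>w\<in>F \<union> G. cnj (d w) * g w) \<in> S"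
      using F G by (intro SI) auto
    moreover have sumd: "(\<Sum>w\<in>F \<union> G. d w * v w)
        = s * (\<Sum>w\<in>F. b w * v w) + t * (\<Sum>w\<in>G. c w * v w)" for v
    proof -
      have "(\<Sum>w\<in>F \<union> G. d w * v w) = s * (\<Sum>w\<in>F \<union> G. (if w \<in> F then b w else 0) * v w)
        + t * (\<Sum>w\<in>F \<union> G. (if w \<in> G then c w else 0) * v w)"
        unfolding d_def by (simp add: algebra_simps sum.distrib sum_distrib_left)
      also have "(\<Sum>w\<in>F \<union> G. (if w \<in> F then b w else 0) * v w) = (\<Sum>w\<in>F. b w * v w)"
        using F G by (intro sum.mono_neutral_cong_right) auto
      also have "(\<Sum>w\<in>F \<union> G. (if w \<in> G then c w else 0) * v w) = (\<Sum>w\<in>G. c w * v w)"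
        using F G by (intro sum.mono_neutral_cong_right) auto
      finally show ?thesis .
    qed
    moreover have "(\<Sum>w\<in>F \<union> G. cnj (d w) * g w)
        = cnj s * (\<Sum>w\<in>F. cnj (b w) * g w) + cnj t * (\<Sum>w\<in>G. cnj (c w) * g w)"
    proof -
      have "(\<Sum>w\<in>F \<union> G. cnj (d w) * g w) = cnj (\<Sum>w\<in>F \<union> G. d w * cnj (g w))"
        by simp
      also have "\<dots> = cnj s * (\<Sum>w\<in>F. cnj (b w) * g w) + cnj t * (\<Sum>w\<in>G. cnj (c w) * g w)"
        unfolding sumd by simp
      finally show ?thesis .
    qed
    ultimately show ?thesis unfolding F(3,4) G(3,4) by simp
  qed
  have zero: "((\<lambda>z. 0), 0) \<in> S" using SI[of "{}"] by simp
  have mid_S: "mid x y \<in> S" if "x \<in> S" "y \<in> S" for x y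
    using S_lin[OF that, of "1/2" "1/2"] unfolding mid_def by simp
  have lower: "- C\<^sup>2 \<le> q x" if "x \<in> S" for x
  proof -
    have "Re (snd x) \<le> C * nrm (fst x)"
      using S_bound[OF that] complex_Re_le_cmod[of "snd x"] by linarith
    moreover have "0 \<le> (nrm (fst x) - C)\<^sup>2" by simp
    ultimately show ?thesis unfolding q_def by (simp add: power2_diff mult.commute)
  qed
  obtain x where x: "\<And>k. x k \<in> S" "\<And>k y. y \<in> S \<Longrightarrow> q (x k) \<le> q y + 1 / (real k + 1)"
    and cauchy: "\<And>e. e > 0 \<Longrightarrow> \<exists>N. \<forall>m\<ge>N. \<forall>n\<ge>N. 2 * q (x m) + 2 * q (x n) - 4 * q (mid (x m) (x n)) < e"
    by (rule minimizing_sequence[of "\<lambda>_. S" mid "- C\<^sup>2" q "q ((\<lambda>z. 0), 0)"])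
      (use zero mid_S lower in auto)
  have q_mid: "2 * q u + 2 * q v - 4 * q (mid u v) = (nrm (\<lambda>z. fst u z - fst v z))\<^sup>2"
    if "u \<in> S" "v \<in> S" for u v
  proof -
    note uv = S_H[OF that(1)] S_H[OF that(2)]
    have "nrm (fst (mid u v)) = 1/2 * nrm (\<lambda>z. fst u z + fst v z)"
      using nrm_scale[OF add_mem[OF uv], of "1/2"] unfolding mid_def by (simp add: algebra_simps)
    then have "4 * (nrm (fst (mid u v)))\<^sup>2 = (nrm (\<lambda>z. fst u z + fst v z))\<^sup>2"
      by (simp only: power_mult_distrib) (simp add: power_divide)
    then show ?thesis
      unfolding q_def nrm_add_sq[OF uv] nrm_diff_sq[OF uv]
      by (simp add: mid_def)
  qed
  have "\<exists>f\<in>H. (\<lambda>n. nrm (\<lambda>z. fst (x n) z - f z)) \<longlonglongrightarrow> 0"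
  proof (rule complete)
    fix e :: real assume e: "e > 0"
    obtain N where N: "\<forall>m\<ge>N. \<forall>n\<ge>N. 2 * q (x m) + 2 * q (x n) - 4 * q (mid (x m) (x n)) < e\<^sup>2"
      using cauchy[of "e\<^sup>2"] e by auto
    show "\<exists>N. \<forall>m\<ge>N. \<forall>n\<ge>N. nrm (\<lambda>z. fst (x m) z - fst (x n) z) < e"
      by (rule exI[of _ N]) (use N e q_mid[OF x(1) x(1)] in \<open>auto intro!: power2_less_imp_less[of _ e]\<close>)
  qed (use x S_H in auto)
  then obtain f where f: "f \<in> H" and lim: "(\<lambda>n. nrm (\<lambda>z. fst (x n) z - f z)) \<longlonglongrightarrow> 0" by blast
  have xH: "fst (x n) \<in> H" for n using S_H x(1) by auto
  have eq: "f w = g w" if w: "w \<in> X" for w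
  proof -
    define \<delta> where "\<delta> = f w - g w"
    define A where "A = Re (K w w)"
    have A: "A \<ge> 0" using nrm_kf[OF w] unfolding A_def by (metis zero_le_power2)
    \<comment> \<open>First-order condition at the limit: replacing \<open>x n\<close> by
      \<open>x n + t * kf w\<close> lowers \<open>q\<close> by at most 1/(n+1), and the terms
      belonging to \<open>x n\<close> alone cancel.\<close>
    have ineq: "0 \<le> 2 * Re (cnj t * \<delta>) + (cmod t)\<^sup>2 * A" for t
    proof -
      have step: "- (1 / (real n + 1)) \<le> 2 * Re (cnj t * (fst (x n) w - g w)) + (cmod t)\<^sup>2 * A" for n
      proof -
        have "(kf w, g w) \<in> S" using SI[of "{w}" "\<lambda>_. 1"] w by simp
        from S_lin[OF x(1)[of n] this, of 1 t]
        have "((\<lambda>z. fst (x n) z + t * kf w z), snd (x n) + cnj t * g w) \<in> S" by simp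
        from x(2)[OF this, of n]
        have "(nrm (fst (x n)))\<^sup>2 - 2 * Re (snd (x n)) \<le> (nrm (\<lambda>z. fst (x n) z + t * kf w z))\<^sup>2
            - 2 * Re (snd (x n) + cnj t * g w) + 1 / (real n + 1)"
          unfolding q_def by simp
        also have "(nrm (\<lambda>z. fst (x n) z + t * kf w z))\<^sup>2
          = (nrm (fst (x n)))\<^sup>2 + 2 * Re (cnj t * fst (x n) w) + (cmod t)\<^sup>2 * A"
          using nrm_add_sq[OF xH scale_mem[OF kernel_mem[OF w]], of n t]
          unfolding nrm_scale[OF kernel_mem[OF w]] ip_scale_right[OF kernel_mem[OF w] xH]
            reproducing[OF xH w]
          using nrm_kf[OF w] by (simp add: power_mult_distrib A_def)
        finally show ?thesis by (simp add: algebra_simps)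
      qed
      have "(\<lambda>n. 2 * Re (cnj t * (fst (x n) w - g w)) + (cmod t)\<^sup>2 * A) \<longlonglongrightarrow>
          2 * Re (cnj t * \<delta>) + (cmod t)\<^sup>2 * A"
        unfolding \<delta>_def by (intro tendsto_intros nrm_limit_eval[OF xH f lim w])
      moreover have "(\<lambda>n. - (1 / (real n + 1))) \<longlonglongrightarrow> - 0"
        by (intro tendsto_intros tendsto_recip_Suc)
      ultimately show ?thesis
        using step by (metis (no_types, lifting) LIMSEQ_le minus_zero)
    qed
    \<comment> \<open>For t = -s \<delta> the condition reads 0 \<le> s |\<delta>|^2 (s A - 2),
      which forces \<delta> = 0 since s A < 1. The summand 1 in the denominator covers A =
      0.\<close>
    define s where "s = 1 / (A + 1)"
    have s: "s > 0" "s * A < 1" unfolding s_def using A by auto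
    have "0 \<le> 2 * Re (cnj (- complex_of_real s * \<delta>) * \<delta>) + (cmod (- complex_of_real s * \<delta>))\<^sup>2 * A"
      by (rule ineq)
    also have "\<dots> = s * (cmod \<delta>)\<^sup>2 * (s * A - 2)"
    proof -
      have "cnj \<delta> * \<delta> = complex_of_real ((cmod \<delta>)\<^sup>2)"
        by (subst complex_norm_square) (simp add: mult.commute)
      then have "cnj (- complex_of_real s * \<delta>) * \<delta> = complex_of_real (- s * (cmod \<delta>)\<^sup>2)"
        by (simp add: mult.assoc)
      then show ?thesis unfolding Re_complex_of_real \<open>_ = complex_of_real (- s * _)\<close>
        by (simp add: norm_mult power_mult_distrib power2_eq_square[of s] algebra_simps)
    qed
    finally have "\<delta> = 0" using s
      by (smt (verit) mult_pos_pos mult_pos_neg zero_less_norm_iff zero_less_power)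
    then show ?thesis by (simp add: \<delta>_def)
  qed
  have fg: "f = g" using eq supp support[OF f] by (metis ext)
  have "nrm g \<le> C"
  proof -
    have ipl: "ip f (fst (x n)) = snd (x n)" for n
    proof -
      obtain F b where F: "finite F" "F \<subseteq> X" "fst (x n) = (\<lambda>z. \<Sum>w\<in>F. b w * kf w z)"
        "snd (x n) = (\<Sum>w\<in>F. cnj (b w) * g w)"
        using x(1)[of n] unfolding S_def by force
      show ?thesis unfolding F(3,4) using F ip_comb[OF F(1) _ f, of "\<lambda>w. w" b] fg by auto
    qed
    \<comment> \<open>The bound defining \<open>S_bound\<close> passes to the limit once the real
      part of the pairing with f is written through norms by polarization, since the limits of these
      norms are known.\<close>
    have "(nrm f)\<^sup>2 \<le> C * nrm f"
    proof (rule LIMSEQ_le)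
      have tri: "\<bar>nrm (fst (x n)) - nrm f\<bar> \<le> nrm (\<lambda>z. fst (x n) z - f z)" for n
        using nrm_triangle[OF diff_mem[OF xH f] f, of n] nrm_triangle[OF diff_mem[OF f xH] xH, of n n]
          nrm_minus[OF xH f, of n] by auto
      have nl: "(\<lambda>n. nrm (fst (x n))) \<longlonglongrightarrow> nrm f"
        using Lim_null_comparison[OF always_eventually lim, of "\<lambda>n. nrm (fst (x n)) - nrm f"] tri
        by (simp add: LIM_zero_iff)
      show "(\<lambda>n. C * nrm (fst (x n))) \<longlonglongrightarrow> C * nrm f"
        by (intro tendsto_intros nl)
      have "(\<lambda>n. ((nrm (fst (x n)))\<^sup>2 + (nrm f)\<^sup>2 - (nrm (\<lambda>z. fst (x n) z - f z))\<^sup>2) / 2) \<longlonglongrightarrow>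
          ((nrm f)\<^sup>2 + (nrm f)\<^sup>2 - 0\<^sup>2) / 2"
        by (intro tendsto_intros nl lim) simp
      then show "(\<lambda>n. ((nrm (fst (x n)))\<^sup>2 + (nrm f)\<^sup>2 - (nrm (\<lambda>z. fst (x n) z - f z))\<^sup>2) / 2) \<longlonglongrightarrow> (nrm f)\<^sup>2"
        by simp
      show "\<exists>N. \<forall>n\<ge>N. ((nrm (fst (x n)))\<^sup>2 + (nrm f)\<^sup>2 - (nrm (\<lambda>z. fst (x n) z - f z))\<^sup>2) / 2
          \<le> C * nrm (fst (x n))"
      proof (intro exI allI impI)
        fix n
        have "((nrm (fst (x n)))\<^sup>2 + (nrm f)\<^sup>2 - (nrm (\<lambda>z. fst (x n) z - f z))\<^sup>2) / 2 = Re (ip (fst (x n)) f)"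
          using nrm_diff_sq[OF xH f, of n] by simp
        also have "\<dots> = Re (snd (x n))"
          using ip_cnj[OF f xH, of n] ipl[of n] by simp
        also have "\<dots> \<le> C * nrm (fst (x n))"
          using S_bound[OF x(1)[of n]] complex_Re_le_cmod[of "snd (x n)"] by linarith
        finally show "((nrm (fst (x n)))\<^sup>2 + (nrm f)\<^sup>2 - (nrm (\<lambda>z. fst (x n) z - f z))\<^sup>2) / 2
          \<le> C * nrm (fst (x n))" .
      qed
    qed
    then have "nrm f \<le> C"
      using C nrm_nonneg[OF f] by (cases "nrm f = 0") (auto simp: power2_eq_square)
    then show ?thesis by (simp add: fg)
  qed
  with f fg show ?thesis by simp
qed

end

section \<open>Multipliers\<close>

context rkhs
begin

text \<open>Real-valued form of \<open>mult_norm H ip \<phi> \<le> ennreal C\<close>, equivalent to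
  it for C \<ge> 0; it keeps operator estimates free of suprema in \<open>ennreal\<close>.\<close>

definition bounded_mult :: "real \<Rightarrow> ('a \<Rightarrow> complex) \<Rightarrow> bool"
  where "bounded_mult C \<phi> \<longleftrightarrow>
    (\<forall>f\<in>H. (\<lambda>z. \<phi> z * f z) \<in> H \<and> nrm (\<lambda>z. \<phi> z * f z) \<le> C * nrm f)"

text \<open>Accretivity up to a defect \<eta>: truncating the geometric series destroys exact
  positivity, and \<eta> records the loss.\<close>

definition accretive :: "real \<Rightarrow> ('a \<Rightarrow> complex) \<Rightarrow> bool"
  where "accretive \<eta> \<phi> \<longleftrightarrow> (\<forall>f\<in>H. - \<eta> * (nrm f)\<^sup>2 \<le> Re (ip (\<lambda>z. \<phi> z * f z) f))"

lemma bounded_multD: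
  "bounded_mult C \<phi> \<Longrightarrow> f \<in> H \<Longrightarrow> (\<lambda>z. \<phi> z * f z) \<in> H"
  "bounded_mult C \<phi> \<Longrightarrow> f \<in> H \<Longrightarrow> nrm (\<lambda>z. \<phi> z * f z) \<le> C * nrm f"
  unfolding bounded_mult_def by auto

text \<open>The adjoint of multiplication by \<phi> maps \<open>kf w\<close> to
  \<open>cnj (\<phi> w)\<close> times \<open>kf w\<close>, so the hypothesis bounds the adjoint on
  the span of the kernel functions. Pairing with f and Cauchy-Schwarz give the estimate from which
  \<open>mem_if_kernel_bound\<close> concludes that \<phi> f belongs to the space.\<close>

lemma bounded_mult_if_kernel:
  assumes C: "0 \<le> C"
    and bound: "\<And>F b. finite F \<Longrightarrow> F \<subseteq> X \<Longrightarrow>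
      nrm (\<lambda>z. \<Sum>w\<in>F. b w * cnj (\<phi> w) * kf w z) \<le> C * nrm (\<lambda>z. \<Sum>w\<in>F. b w * kf w z)"
  shows "bounded_mult C \<phi>"
  unfolding bounded_mult_def
proof
  fix f assume f: "f \<in> H"
  have "(\<lambda>z. \<phi> z * f z) \<in> H \<and> nrm (\<lambda>z. \<phi> z * f z) \<le> C * nrm f"
  proof (rule mem_if_kernel_bound)
    fix F :: "'a set" and b :: "'a \<Rightarrow> complex"
    assume F: "finite F" "F \<subseteq> X"
    then have wX: "w \<in> X" if "w \<in> F" for w using that by blast
    have "(\<Sum>w\<in>F. cnj (b w) * (\<phi> w * f w)) = ip f (\<lambda>z. \<Sum>w\<in>F. b w * cnj (\<phi> w) * kf w z)"
      using ip_comb[where w = "\<lambda>w. w" and c = "\<lambda>w. b w * cnj (\<phi> w)", OF F(1) wX f] by (simp add: mult.assoc)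
    also have "cmod \<dots> \<le> nrm f * nrm (\<lambda>z. \<Sum>w\<in>F. b w * cnj (\<phi> w) * kf w z)"
      using comb_mem[where w = "\<lambda>w. w" and c = "\<lambda>w. b w * cnj (\<phi> w)", OF F(1) wX] by (intro Cauchy_Schwarz[OF f]) auto
    also have "\<dots> \<le> nrm f * (C * nrm (\<lambda>z. \<Sum>w\<in>F. b w * kf w z))"
      using bound[OF F] nrm_nonneg[OF f] by (rule mult_left_mono)
    finally show "cmod (\<Sum>w\<in>F. cnj (b w) * (\<phi> w * f w)) \<le> C * nrm f * nrm (\<lambda>z. \<Sum>w\<in>F. b w * kf w z)"
      by (simp add: mult_ac)
  qed (use C f in \<open>auto simp: support nrm_nonneg\<close>)
  then show "(\<lambda>z. \<phi> z * f z) \<in> H \<and> nrm (\<lambda>z. \<phi> z * f z) \<le> C * nrm f" .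
qed

lemma bounded_mult_mono: "bounded_mult C \<phi> \<Longrightarrow> C \<le> D \<Longrightarrow> bounded_mult D \<phi>"
  unfolding bounded_mult_def by (meson mult_right_mono nrm_nonneg order_trans)

lemma bounded_mult_const: "bounded_mult (cmod c) (\<lambda>z. c)"
  unfolding bounded_mult_def by (auto simp: scale_mem nrm_scale)

lemma bounded_mult_add:
  assumes "bounded_mult C \<phi>" "bounded_mult D \<psi>"
  shows "bounded_mult (C + D) (\<lambda>z. \<phi> z + \<psi> z)"
  unfolding bounded_mult_def
proof
  fix f assume f: "f \<in> H"
  note m = bounded_multD[OF assms(1) f] bounded_multD[OF assms(2) f]
  show "(\<lambda>z. (\<phi> z + \<psi> z) * f z) \<in> H \<and> nrm (\<lambda>z. (\<phi> z + \<psi> z) * f z) \<le> (C + D) * nrm f"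
    using add_mem[OF m(1,3)] nrm_triangle[OF m(1,3)] m(2,4) by (auto simp: distrib_right)
qed

lemma bounded_mult_mult:
  assumes "bounded_mult C \<phi>" "bounded_mult D \<psi>" "0 \<le> C"
  shows "bounded_mult (C * D) (\<lambda>z. \<phi> z * \<psi> z)"
  unfolding bounded_mult_def
proof
  fix f assume f: "f \<in> H"
  note m = bounded_multD[OF assms(2) f]
  note n = bounded_multD[OF assms(1) m(1)]
  have "nrm (\<lambda>z. \<phi> z * (\<psi> z * f z)) \<le> C * (D * nrm f)"
    using n(2) mult_left_mono[OF m(2) assms(3)] by linarith
  then show "(\<lambda>z. \<phi> z * \<psi> z * f z) \<in> H \<and> nrm (\<lambda>z. \<phi> z * \<psi> z * f z) \<le> C * D * nrm f"
    using n(1) by (simp add: mult.assoc)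
qed

lemma bounded_mult_scale: "bounded_mult C \<phi> \<Longrightarrow> bounded_mult (cmod c * C) (\<lambda>z. c * \<phi> z)"
  using bounded_mult_mult[OF bounded_mult_const[of c]] by simp

lemma bounded_mult_power:
  "bounded_mult C \<phi> \<Longrightarrow> 0 \<le> C \<Longrightarrow> bounded_mult (C ^ n) (\<lambda>z. \<phi> z ^ n)"
proof (induction n)
  case 0
  then show ?case using bounded_mult_const[of 1] by simp
next
  case (Suc n)
  then show ?case using bounded_mult_mult[of C \<phi> "C ^ n" "\<lambda>z. \<phi> z ^ n"] by simp
qed

lemma bounded_mult_sum:
  "finite I \<Longrightarrow> (\<And>i. i \<in> I \<Longrightarrow> bounded_mult (C i) (\<phi> i)) \<Longrightarrow>
    bounded_mult (\<Sum>i\<in>I. C i) (\<lambda>z. \<Sum>i\<in>I. \<phi> i z)"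
proof (induction I rule: finite_induct)
  case empty
  then show ?case using bounded_mult_const[of 0] by simp
next
  case (insert i I)
  then show ?case using bounded_mult_add[of "C i" "\<phi> i"] by simp
qed

lemma accretive_scale:
  assumes "bounded_mult C \<phi>" "accretive \<eta> \<phi>" "0 \<le> c"
  shows "accretive (c * \<eta>) (\<lambda>z. complex_of_real c * \<phi> z)"
  unfolding accretive_def
proof
  fix f assume f: "f \<in> H"
  have "ip (\<lambda>z. complex_of_real c * (\<phi> z * f z)) f = complex_of_real c * ip (\<lambda>z. \<phi> z * f z) f"
    by (intro ip_scale bounded_multD[OF assms(1)] f)
  moreover have "c * (- \<eta> * (nrm f)\<^sup>2) \<le> c * Re (ip (\<lambda>z. \<phi> z * f z) f)"
    using assms(2,3) f unfolding accretive_def by (intro mult_left_mono) auto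
  ultimately show "- (c * \<eta>) * (nrm f)\<^sup>2 \<le> Re (ip (\<lambda>z. complex_of_real c * \<phi> z * f z) f)"
    by (simp add: mult.assoc)
qed

lemma accretive_sum:
  assumes "finite I" "\<And>i. i \<in> I \<Longrightarrow> bounded_mult (C i) (\<phi> i)" "\<And>i. i \<in> I \<Longrightarrow> accretive (\<eta> i) (\<phi> i)"
  shows "accretive (\<Sum>i\<in>I. \<eta> i) (\<lambda>z. \<Sum>i\<in>I. \<phi> i z)"
  unfolding accretive_def
proof
  fix f assume f: "f \<in> H"
  have "ip (\<lambda>z. \<Sum>i\<in>I. \<phi> i z * f z) f = (\<Sum>i\<in>I. ip (\<lambda>z. \<phi> i z * f z) f)"
    using assms f by (intro ip_sum) (auto intro: bounded_multD)
  moreover have "(\<Sum>i\<in>I. - \<eta> i * (nrm f)\<^sup>2) \<le> (\<Sum>i\<in>I. Re (ip (\<lambda>z. \<phi> i z * f z) f))"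
    using assms(3) f unfolding accretive_def by (intro sum_mono) auto
  ultimately show "- (\<Sum>i\<in>I. \<eta> i) * (nrm f)\<^sup>2 \<le> Re (ip (\<lambda>z. (\<Sum>i\<in>I. \<phi> i z) * f z) f)"
    by (simp add: sum_distrib_right sum_negf)
qed

text \<open>
  A polynomial substitute for the contraction \<open>exp (-\<phi>)\<close>: as
  \<open>\<parallel>(1 - \<phi>/M) f\<parallel>\<^sup>2 \<le> (1 + 2\<eta>/M + C\<^sup>2/M\<^sup>2) \<parallel>f\<parallel>\<^sup>2\<close>, the powers stay bounded once M dominates C squared.
\<close>

lemma bounded_mult_exp_approx:
  assumes \<phi>: "bounded_mult C \<phi>" "accretive \<eta> \<phi>" and pos: "0 \<le> C" "0 \<le> \<eta>"
    and M: "M > 0" "C\<^sup>2 \<le> real M"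
  shows "bounded_mult (exp (\<eta> + 1)) (\<lambda>z. (1 - \<phi> z / of_nat M) ^ M)"
proof -
  define x where "x = 2 * \<eta> + C\<^sup>2 / real M"
  have x: "0 \<le> x" unfolding x_def using pos by simp
  have "bounded_mult (sqrt (1 + x / real M)) (\<lambda>z. 1 - \<phi> z / of_nat M)"
    unfolding bounded_mult_def
  proof
    fix f assume f: "f \<in> H"
    note m = bounded_multD[OF \<phi>(1) f]
    define c where "c = 1 / complex_of_real (real M)"
    have g: "(\<lambda>z. c * (\<phi> z * f z)) \<in> H" by (intro scale_mem m)
    have eq: "(\<lambda>z. (1 - \<phi> z / of_nat M) * f z) = (\<lambda>z. f z - c * (\<phi> z * f z))"
      by (simp add: c_def algebra_simps)
    have "Re (ip f (\<lambda>z. c * (\<phi> z * f z))) = Re (ip (\<lambda>z. \<phi> z * f z) f) / real M"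
      using ip_scale_right[OF m(1) f, of c] ip_cnj[OF m(1) f]
      by (simp add: c_def Re_divide_of_real Re_divide_of_nat)
    moreover have "- \<eta> * (nrm f)\<^sup>2 / real M \<le> Re (ip (\<lambda>z. \<phi> z * f z) f) / real M"
      using \<phi>(2) f unfolding accretive_def by (intro divide_right_mono) auto
    moreover have "(nrm (\<lambda>z. c * (\<phi> z * f z)))\<^sup>2 \<le> (C * nrm f / real M)\<^sup>2"
      unfolding nrm_scale[OF m(1)] c_def using m nrm_nonneg[OF m(1)]
      by (intro power_mono) (auto simp: norm_divide divide_right_mono)
    ultimately have "(nrm (\<lambda>z. f z - c * (\<phi> z * f z)))\<^sup>2
        \<le> (nrm f)\<^sup>2 - 2 * (- \<eta> * (nrm f)\<^sup>2 / real M) + (C * nrm f / real M)\<^sup>2"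
      unfolding nrm_diff_sq[OF f g] by linarith
    also have "\<dots> = (1 + x / real M) * (nrm f)\<^sup>2"
      unfolding x_def using M by (simp add: field_simps power2_eq_square)
    also have "\<dots> = (sqrt (1 + x / real M) * nrm f)\<^sup>2"
      using x by (simp add: power_mult_distrib)
    finally have "nrm (\<lambda>z. f z - c * (\<phi> z * f z)) \<le> sqrt (1 + x / real M) * nrm f"
      by (rule power2_le_imp_le) (use x nrm_nonneg[OF f] in auto)
    then show "(\<lambda>z. (1 - \<phi> z / of_nat M) * f z) \<in> H \<and>
        nrm (\<lambda>z. (1 - \<phi> z / of_nat M) * f z) \<le> sqrt (1 + x / real M) * nrm f"
      unfolding eq using diff_mem[OF f g] by simp
  qed
  then have "bounded_mult (sqrt (1 + x / real M) ^ M) (\<lambda>z. (1 - \<phi> z / of_nat M) ^ M)"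
    by (rule bounded_mult_power) (use x in auto)
  moreover have "sqrt (1 + x / real M) ^ M \<le> exp (\<eta> + 1)"
  proof (rule power2_le_imp_le)
    have "(sqrt (1 + x / real M) ^ M)\<^sup>2 = (1 + x / real M) ^ M"
      using x by (simp add: power_mult[symmetric] mult.commute[of _ 2]) (simp add: power_mult)
    also have "\<dots> \<le> exp (x / real M) ^ M"
      using x by (intro power_mono exp_ge_add_one_self) auto
    also have "\<dots> = exp x"
      using M by (simp add: exp_of_nat_mult[symmetric])
    \<comment> \<open>The assumption \<open>C\<^sup>2 \<le> real M\<close> makes x at most 2 \<eta>
      + 1.\<close>
    also have "\<dots> \<le> exp (2 * (\<eta> + 1))"
      using M by (simp add: x_def divide_le_eq)
    finally show "(sqrt (1 + x / real M) ^ M)\<^sup>2 \<le> (exp (\<eta> + 1))\<^sup>2"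
      by (simp only: exp_double)
  qed auto
  ultimately show ?thesis by (rule bounded_mult_mono)
qed

lemma mult_norm_le: "bounded_mult C \<phi> \<Longrightarrow> 0 \<le> C \<Longrightarrow> mult_norm H ip \<phi> \<le> ennreal C"
proof -
  assume b: "bounded_mult C \<phi>" and C: "0 \<le> C"
  have "\<phi> \<in> multipliers H" using bounded_multD(1)[OF b] by (simp add: multipliers_def)
  moreover have "nrm (\<lambda>z. \<phi> z * f z) \<le> C" if "f \<in> H" "nrm f \<le> 1" for f
    using bounded_multD(2)[OF b that(1)] mult_left_mono[OF that(2) C] by simp
  ultimately show ?thesis
    unfolding mult_norm_def by (auto intro!: SUP_least ennreal_leI)
qed

lemma bounded_mult_if_mult_norm_le:
  assumes le: "mult_norm H ip \<phi> \<le> ennreal C" and C: "0 \<le> C"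
  shows "bounded_mult C \<phi>"
  unfolding bounded_mult_def
proof
  fix f assume f: "f \<in> H"
  have mult: "\<phi> \<in> multipliers H"
    using le by (auto simp: mult_norm_def top_unique split: if_splits)
  then have m: "(\<lambda>z. \<phi> z * g z) \<in> H" if "g \<in> H" for g
    using that by (simp add: multipliers_def)
  have unit: "nrm (\<lambda>z. \<phi> z * g z) \<le> C" if "g \<in> H" "nrm g \<le> 1" for g
  proof -
    have "ennreal (nrm (\<lambda>z. \<phi> z * g z)) \<le> ennreal C"
      using that le mult unfolding mult_norm_def
      by (auto intro: SUP_upper2 order_trans[rotated])
    then show ?thesis using C by (simp add: ennreal_le_iff)
  qed
  have "nrm (\<lambda>z. \<phi> z * f z) \<le> C * nrm f"
  proof (cases "nrm f = 0")
    case True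
    then have "f = (\<lambda>z. 0)" using f nrm_zero_iff by blast
    then show ?thesis using True by simp
  next
    case False
    then have n0: "nrm f > 0" using nrm_nonneg[OF f] by simp
    define c where "c = complex_of_real (1 / nrm f)"
    have "nrm (\<lambda>z. \<phi> z * (c * f z)) \<le> C"
      using n0 nrm_scale[OF f, of c] by (intro unit scale_mem f) (simp add: c_def norm_divide)
    moreover have "nrm (\<lambda>z. \<phi> z * (c * f z)) = nrm (\<lambda>z. \<phi> z * f z) / nrm f"
      using nrm_scale[OF m[OF f], of c] n0 by (simp add: c_def norm_divide mult_ac)
    ultimately show ?thesis using n0 by (simp add: divide_le_eq)
  qed
  with m[OF f] show "(\<lambda>z. \<phi> z * f z) \<in> H \<and> nrm (\<lambda>z. \<phi> z * f z) \<le> C * nrm f" by blast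
qed

text \<open>Evaluate the product of \<phi> and \<open>kf w\<close> at w: the value is
  \<open>\<phi> w\<close> times \<open>(nrm (kf w))\<^sup>2\<close>, while point evaluation at w
  costs only one factor \<open>nrm (kf w)\<close> and the norm of \<open>kf w\<close> supplies the
  other.\<close>

lemma bounded_mult_eval:
  assumes b: "bounded_mult C \<phi>" and w: "w \<in> X" and pos: "nrm (kf w) > 0"
  shows "cmod (\<phi> w) \<le> C"
proof -
  note m = bounded_multD[OF b kernel_mem[OF w]]
  have "K w w = complex_of_real ((nrm (kf w))\<^sup>2)"
    using ip_self[OF kernel_mem[OF w]] reproducing[OF kernel_mem[OF w] w] w by simp
  then have "cmod (\<phi> w) * (nrm (kf w))\<^sup>2 = cmod (\<phi> w * kf w w)"
    using w by (simp add: norm_mult norm_power)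
  also have "\<dots> \<le> nrm (\<lambda>z. \<phi> z * kf w z) * nrm (kf w)"
    by (rule eval_bound[OF m(1) w])
  also have "\<dots> \<le> C * nrm (kf w) * nrm (kf w)"
    using m(2) pos by (intro mult_right_mono) auto
  finally show ?thesis using pos by (simp add: power2_eq_square)
qed

end

section \<open>The Drury-Arveson kernel\<close>

text \<open>The Hermitian inner product, linear in the first argument; the real inner product of the
  type is its real part.\<close>

definition hip :: "complex ^ 'd \<Rightarrow> complex ^ 'd \<Rightarrow> complex"
  where "hip z w = (\<Sum>i\<in>UNIV. z $ i * cnj (w $ i))"

lemma da_kernel_hip: "da_kernel z w = 1 / (1 - hip z w)"
  by (simp add: da_kernel_def hip_def)

lemma norm_hip_le: "norm (hip z w) \<le> norm z * norm w"
proof -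
  have "norm (hip z w) \<le> (\<Sum>i\<in>UNIV. \<bar>norm (z $ i)\<bar> * \<bar>norm (w $ i)\<bar>)"
    unfolding hip_def by (rule order_trans[OF norm_sum]) (simp add: norm_mult)
  also have "\<dots> \<le> norm z * norm w"
    unfolding norm_vec_def by (rule L2_set_mult_ineq)
  finally show ?thesis .
qed

lemma cnj_hip: "cnj (hip z w) = hip w z"
  by (simp add: hip_def mult.commute)

lemma hip_self: "hip z z = complex_of_real ((norm z)\<^sup>2)"
  by (simp add: hip_def norm_vec_def L2_set_def sum_nonneg complex_norm_square[symmetric] del: of_real_power)

lemma hip_scaleR_left: "hip (r *\<^sub>R z) w = complex_of_real r * hip z w"
  by (simp add: hip_def sum_distrib_left scaleR_conv_of_real[where 'a=complex] mult.assoc)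

lemma hip_scaleR_right: "hip z (r *\<^sub>R w) = complex_of_real r * hip z w"
  by (simp add: hip_def sum_distrib_left scaleR_conv_of_real[where 'a=complex] mult_ac)

lemma hip_diff_left: "hip (z - z') w = hip z w - hip z' w"
  by (simp add: hip_def sum_subtractf algebra_simps)

lemma hip_diff_right: "hip z (w - w') = hip z w - hip z w'"
  by (simp add: hip_def sum_subtractf algebra_simps)

lemma continuous_on_hip [continuous_intros]:
  "continuous_on S f \<Longrightarrow> continuous_on S g \<Longrightarrow> continuous_on S (\<lambda>x. hip (f x) (g x))"
  unfolding hip_def by (intro continuous_intros)

lemma norm_hip_less_one:
  assumes "norm z \<le> 1" "norm w < 1"
  shows "norm (hip z w) < 1"
proof -
  have "norm z * norm w \<le> norm w" using assms(1) by (simp add: mult_left_le_one_le)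
  with norm_hip_le[of z w] assms(2) show ?thesis by linarith
qed

lemma norm_da_kernel_le:
  assumes "norm z \<le> 1" "norm w \<le> r" "r < 1"
  shows "norm (da_kernel z w) \<le> 1 / (1 - r)"
proof -
  have "norm z * norm w \<le> 1 * r" using assms by (intro mult_mono) auto
  then have "norm (hip z w) \<le> r" using norm_hip_le[of z w] by linarith
  then have "1 - r \<le> norm (1 - hip z w)"
    using norm_triangle_ineq2[of 1 "hip z w"] by simp
  then show ?thesis using assms(3) by (simp add: da_kernel_hip norm_divide frac_le)
qed

text \<open>The map a \<mapsto> 1/(1 - a) sends the unit disc into the half plane Re > 1/2, because
  |1 - a|^2 = 1 - 2 Re a + |a|^2 < 2 Re (1 - a). This is the positivity behind every comparison of
  potentials.\<close>

lemma Re_recip_one_minus: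
  assumes "norm a < 1"
  shows "1 / 2 < Re (1 / (1 - a))"
proof -
  have ne: "1 - a \<noteq> 0" using assms by auto
  have "(norm a)\<^sup>2 < 1" using assms by (simp add: power_less_one_iff)
  then have "(norm (1 - a))\<^sup>2 < 2 * Re (1 - a)"
    by (simp add: cmod_power2 power2_diff)
  moreover have "Re (1 / (1 - a)) = Re (1 - a) / (norm (1 - a))\<^sup>2"
    by (simp add: Re_divide cmod_power2)
  ultimately show ?thesis using ne by (simp add: less_divide_eq)
qed

lemma Re_da_kernel_gt:
  "norm z \<le> 1 \<Longrightarrow> norm w < 1 \<Longrightarrow> 1 / 2 < Re (da_kernel z w)"
  unfolding da_kernel_hip by (intro Re_recip_one_minus norm_hip_less_one)

lemma cnj_da_kernel: "cnj (da_kernel z w) = da_kernel w z"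
  by (simp add: da_kernel_hip cnj_hip)

lemma da_kernel_scaleR: "da_kernel (r *\<^sub>R z) (s *\<^sub>R w) = da_kernel z ((r * s) *\<^sub>R w)"
  by (simp add: da_kernel_hip hip_scaleR_left hip_scaleR_right mult.assoc)

lemma continuous_on_da_kernel [continuous_intros]:
  assumes "continuous_on S f" "continuous_on S g"
    and "\<And>x. x \<in> S \<Longrightarrow> norm (f x) \<le> 1" "\<And>x. x \<in> S \<Longrightarrow> norm (g x) < 1"
  shows "continuous_on S (\<lambda>x. da_kernel (f x) (g x))"
  unfolding da_kernel_hip using assms norm_hip_less_one
  by (intro continuous_intros) fastforce+

subsection \<open>Polynomials\<close>

text \<open>The exponents \<open>\<alpha> k\<close> may coincide for different k; equal monomials
  are collected. Sums and products of polynomials can therefore be indexed directly by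
  \<open>A <+> B\<close> and \<open>A \<times> B\<close>.\<close>

lemma complex_polynomial_sum_monomials:
  assumes "finite I"
  shows "complex_polynomial (\<lambda>z. \<Sum>k\<in>I. c k * (\<Prod>i\<in>UNIV. (z $ i) ^ \<alpha> k i))"
proof -
  have "(\<Sum>k\<in>I. c k * (\<Prod>i\<in>UNIV. (z $ i) ^ \<alpha> k i)) =
      (\<Sum>\<beta>\<in>\<alpha> ` I. (\<Sum>k\<in>{k\<in>I. \<alpha> k = \<beta>}. c k) * (\<Prod>i\<in>UNIV. (z $ i) ^ \<beta> i))" for z
    by (subst sum.image_gen[OF assms, of _ \<alpha>]) (auto simp: sum_distrib_right intro!: sum.cong)
  then show ?thesis
    unfolding complex_polynomial_def using assms by (intro exI[of _ "\<alpha> ` I"]) auto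
qed

lemma complex_polynomial_const: "complex_polynomial (\<lambda>z. c)"
  using complex_polynomial_sum_monomials[of "{()}" "\<lambda>_. c" "\<lambda>_ _. 0"] by simp

lemma complex_polynomial_add:
  assumes "complex_polynomial p" "complex_polynomial q"
  shows "complex_polynomial (\<lambda>z. p z + q z)"
proof -
  obtain A c where A: "finite A" "p = (\<lambda>z. \<Sum>\<alpha>\<in>A. c \<alpha> * (\<Prod>i\<in>UNIV. (z $ i) ^ \<alpha> i))"
    using assms(1) unfolding complex_polynomial_def by blast
  obtain B d where B: "finite B" "q = (\<lambda>z. \<Sum>\<alpha>\<in>B. d \<alpha> * (\<Prod>i\<in>UNIV. (z $ i) ^ \<alpha> i))"
    using assms(2) unfolding complex_polynomial_def by blast
  have "complex_polynomial (\<lambda>z. \<Sum>k\<in>A <+> B. (case k of Inl \<alpha> \<Rightarrow> c \<alpha> | Inr \<alpha> \<Rightarrow> d \<alpha>) *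
      (\<Prod>i\<in>UNIV. (z $ i) ^ (case k of Inl \<alpha> \<Rightarrow> \<alpha> | Inr \<alpha> \<Rightarrow> \<alpha>) i))"
    using A B by (intro complex_polynomial_sum_monomials) auto
  then show ?thesis using A B by (simp add: sum.Plus)
qed

lemma complex_polynomial_mult:
  assumes "complex_polynomial p" "complex_polynomial q"
  shows "complex_polynomial (\<lambda>z. p z * q z)"
proof -
  obtain A c where A: "finite A" "p = (\<lambda>z. \<Sum>\<alpha>\<in>A. c \<alpha> * (\<Prod>i\<in>UNIV. (z $ i) ^ \<alpha> i))"
    using assms(1) unfolding complex_polynomial_def by blast
  obtain B d where B: "finite B" "q = (\<lambda>z. \<Sum>\<alpha>\<in>B. d \<alpha> * (\<Prod>i\<in>UNIV. (z $ i) ^ \<alpha> i))"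
    using assms(2) unfolding complex_polynomial_def by blast
  have "complex_polynomial (\<lambda>z. \<Sum>k\<in>A \<times> B. (c (fst k) * d (snd k)) *
      (\<Prod>i\<in>UNIV. (z $ i) ^ (fst k i + snd k i)))"
    using A B by (intro complex_polynomial_sum_monomials) auto
  moreover have "(\<Sum>k\<in>A \<times> B. (c (fst k) * d (snd k)) *
      (\<Prod>i\<in>UNIV. (z $ i) ^ (fst k i + snd k i))) = p z * q z" for z
    unfolding A(2) B(2) sum_product sum.cartesian_product
    by (intro sum.cong refl) (auto simp: power_add prod.distrib mult_ac)
  ultimately show ?thesis by simp
qed

lemma complex_polynomial_nth: "complex_polynomial (\<lambda>z. z $ i)"
proof -
  have "complex_polynomial (\<lambda>z :: complex ^ 'a. \<Sum>k\<in>{()}. 1 * (\<Prod>j\<in>UNIV. (z $ j) ^ (if j = i then 1 else 0)))"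
    by (rule complex_polynomial_sum_monomials) simp
  moreover have "(\<Prod>j\<in>UNIV. (z $ j) ^ (if j = i then 1 else 0)) = z $ i" for z :: "complex ^ 'a"
    by (simp add: if_distrib[of "\<lambda>n. _ ^ n"] cong: if_cong)
  ultimately show ?thesis by simp
qed

lemma complex_polynomial_sum:
  "finite I \<Longrightarrow> (\<And>i. i \<in> I \<Longrightarrow> complex_polynomial (p i)) \<Longrightarrow> complex_polynomial (\<lambda>z. \<Sum>i\<in>I. p i z)"
  by (induction I rule: finite_induct) (auto intro: complex_polynomial_const complex_polynomial_add)

lemma complex_polynomial_power: "complex_polynomial p \<Longrightarrow> complex_polynomial (\<lambda>z. p z ^ n)"
  by (induction n) (auto intro: complex_polynomial_const complex_polynomial_mult)

lemma complex_polynomial_hip: "complex_polynomial (\<lambda>z. hip z w)"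
  unfolding hip_def
  by (intro complex_polynomial_sum complex_polynomial_mult complex_polynomial_nth complex_polynomial_const) auto

lemma continuous_on_complex_polynomial: "complex_polynomial p \<Longrightarrow> continuous_on S p"
  unfolding complex_polynomial_def by (auto intro!: continuous_intros)

text \<open>A partial sum of \<open>(1 + hip z w) / (1 - hip z w) = 2 K(z, w) - 1\<close>.\<close>

definition trunc_herglotz :: "nat \<Rightarrow> complex ^ 'd \<Rightarrow> complex ^ 'd \<Rightarrow> complex"
  where "trunc_herglotz N w z = 1 + 2 * (\<Sum>k=1..N. hip z w ^ k)"

lemma complex_polynomial_trunc_herglotz: "complex_polynomial (trunc_herglotz N w)"
  unfolding trunc_herglotz_def
  by (intro complex_polynomial_sum complex_polynomial_add complex_polynomial_mult
      complex_polynomial_power complex_polynomial_hip complex_polynomial_const) auto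

text \<open>The tail of the geometric series in a = \<open>hip z w\<close> is -2 a^(N+1)/(1 - a),
  and |a| \<le> |w| on the closed ball. The same bound reappears as the defect in
  \<open>accretive_trunc_herglotz\<close>, so that one choice of N controls both.\<close>

lemma trunc_herglotz_approx:
  assumes z: "norm z \<le> 1" and w: "norm w < 1"
  shows "norm (trunc_herglotz N w z - (2 * da_kernel z w - 1)) \<le> 2 * norm w ^ Suc N / (1 - norm w)"
proof -
  define a where "a = hip z w"
  have aw: "norm a \<le> norm w"
    unfolding a_def using norm_hip_le[of z w] z by (smt (verit) mult_left_le_one_le norm_ge_zero)
  have ne: "1 - a \<noteq> 0" using aw w by auto
  have "(\<Sum>k=1..N. a ^ k) = (\<Sum>k\<le>N. a ^ k) - 1"
    by (simp add: sum.atLeast1_atMost_eq sum.atMost_shift lessThan_Suc_atMost[symmetric] sum.lessThan_Suc_shift del: sum.lessThan_Suc)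
  also have "(\<Sum>k\<le>N. a ^ k) = (1 - a ^ Suc N) / (1 - a)"
    using ne by (subst sum_gp0) auto
  finally have geom: "(\<Sum>k=1..N. a ^ k) = (1 - a ^ Suc N) / (1 - a) - 1" .
  have "trunc_herglotz N w z - (2 * da_kernel z w - 1) = - 2 * a ^ Suc N / (1 - a)"
    unfolding trunc_herglotz_def da_kernel_hip a_def[symmetric] geom by (simp add: diff_divide_distrib)
  also have "norm \<dots> = 2 * norm a ^ Suc N / norm (1 - a)"
    by (simp add: norm_divide norm_mult norm_power)
  also have "\<dots> \<le> 2 * norm w ^ Suc N / (1 - norm w)"
    using aw w norm_triangle_ineq2[of 1 a] by (intro frac_le mult_left_mono power_mono) auto
  finally show ?thesis .
qed

section \<open>Multipliers of the Drury-Arveson space: contractivity and accretivity\<close>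

locale drury_arveson = rkhs "ball 0 1" "da_kernel :: complex ^ 'd \<Rightarrow> complex ^ 'd \<Rightarrow> complex" H ip
  for H ip
begin

lemma nrm_comb_Re:
  assumes "finite I" "\<And>i. i \<in> I \<Longrightarrow> w i \<in> ball 0 1"
  shows "(nrm (\<lambda>z. \<Sum>i\<in>I. c i * kf (w i) z))\<^sup>2
    = Re (\<Sum>j\<in>I. \<Sum>i\<in>I. cnj (c j) * c i * da_kernel (w j) (w i))"
proof -
  have "complex_of_real ((nrm (\<lambda>z. \<Sum>i\<in>I. c i * kf (w i) z))\<^sup>2)
    = (\<Sum>j\<in>I. \<Sum>i\<in>I. cnj (c j) * c i * da_kernel (w j) (w i))"
    by (rule nrm_comb[OF assms])
  from arg_cong[OF this, of Re] show ?thesis by (simp only: Re_complex_of_real)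
qed

text \<open>
  The kernel \<open>(\<parallel>a\<parallel>\<^sup>2 - \<langle>z, a\<rangle>\<langle>a, w\<rangle>) K(z, w)\<close> is positive, since by Lagrange's identity
  \<open>\<parallel>a\<parallel>\<^sup>2\<langle>z, w\<rangle> - \<langle>z, a\<rangle>\<langle>a, w\<rangle>\<close> is half the sum of the \<open>u k l z * cnj (u k l w)\<close> below.
\<close>

lemma bounded_mult_hip: "bounded_mult (norm a) (\<lambda>z. hip z a)"
proof (rule bounded_mult_if_kernel)
  fix F :: "(complex ^ 'd) set" and b :: "complex ^ 'd \<Rightarrow> complex"
  assume F: "finite F" "F \<subseteq> ball 0 1"
  then have wX: "w \<in> ball 0 1" if "w \<in> F" for w using that by blast
  define u where "u k l z = z $ k * a $ l - z $ l * a $ k" for k l and z :: "complex ^ 'd"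
  have u_sum: "(\<Sum>k\<in>UNIV. \<Sum>l\<in>UNIV. u k l z * cnj (u k l w)) = 2 * (hip a a * hip z w - hip z a * hip a w)"
    for z w
  proof -
    have "(\<Sum>k\<in>UNIV. \<Sum>l\<in>UNIV. u k l z * cnj (u k l w)) =
      (\<Sum>k\<in>UNIV. \<Sum>l\<in>UNIV. (z $ k * cnj (w $ k)) * (a $ l * cnj (a $ l)))
      + (\<Sum>k\<in>UNIV. \<Sum>l\<in>UNIV. (a $ k * cnj (a $ k)) * (z $ l * cnj (w $ l)))
      - (\<Sum>k\<in>UNIV. \<Sum>l\<in>UNIV. (z $ k * cnj (a $ k)) * (a $ l * cnj (w $ l)))
      - (\<Sum>k\<in>UNIV. \<Sum>l\<in>UNIV. (a $ k * cnj (w $ k)) * (z $ l * cnj (a $ l)))"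
      unfolding sum.distrib[symmetric] sum_subtractf[symmetric] u_def
      by (intro sum.cong refl) (simp add: algebra_simps)
    then show ?thesis unfolding sum_product[symmetric] hip_def[symmetric] by simp
  qed
  have key: "hip z a * cnj (hip w a) * da_kernel z w = complex_of_real ((norm a)\<^sup>2) * da_kernel z w
      - complex_of_real ((norm a)\<^sup>2)
      - 1/2 * (\<Sum>k\<in>UNIV. \<Sum>l\<in>UNIV. u k l z * cnj (u k l w) * da_kernel z w)"
    if "z \<in> F" "w \<in> F" for z w
  proof -
    have "norm (hip z w) < 1" using wX[OF that(1)] wX[OF that(2)] by (intro norm_hip_less_one) auto
    then have ne: "1 - hip z w \<noteq> 0" by auto
    \<comment> \<open>This identity replaces \<open>hip z w\<close> times the kernel in Lagrange's
      identity, leaving the kernel multiplied by \<open>(norm a)\<^sup>2\<close> minus two positive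
      kernels: a constant and the Lagrange sum.\<close>
    have "hip z w * da_kernel z w = da_kernel z w - 1"
      unfolding da_kernel_hip using ne by (simp add: field_simps)
    note hk = this
    have "(\<Sum>k\<in>UNIV. \<Sum>l\<in>UNIV. u k l z * cnj (u k l w) * da_kernel z w)
        = 2 * (hip a a * hip z w - hip z a * hip a w) * da_kernel z w"
      unfolding u_sum[symmetric] by (simp add: sum_distrib_right)
    moreover have "2 * (hip a a * hip z w - hip z a * hip a w) * da_kernel z w
        = 2 * (hip a a * (da_kernel z w - 1) - hip z a * hip a w * da_kernel z w)"
      unfolding hk[symmetric] by (simp add: algebra_simps)
    ultimately show ?thesis
      unfolding hip_self[symmetric] cnj_hip by (simp add: right_diff_distrib)
  qed
  \<comment> \<open>The contribution of the Lagrange sum, as a sum of squared norms of kernel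
    combinations and hence nonnegative.\<close>
  define S where "S = (\<Sum>k\<in>UNIV. \<Sum>l\<in>UNIV. (nrm (\<lambda>z. \<Sum>w\<in>F. b w * cnj (u k l w) * kf w z))\<^sup>2)"
  have "complex_of_real ((nrm (\<lambda>z. \<Sum>w\<in>F. b w * cnj (hip w a) * kf w z))\<^sup>2)
    = (\<Sum>z\<in>F. \<Sum>w\<in>F. cnj (b z) * b w * (hip z a * cnj (hip w a) * da_kernel z w))"
    by (subst nrm_comb[where w = "\<lambda>w. w" and c = "\<lambda>w. b w * cnj (hip w a)", OF F(1) wX])
      (auto intro!: sum.cong simp: mult_ac)
  also have "\<dots> = (\<Sum>z\<in>F. \<Sum>w\<in>F. complex_of_real ((norm a)\<^sup>2) * (cnj (b z) * b w * da_kernel z w)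
      - complex_of_real ((norm a)\<^sup>2) * (cnj (b z) * b w)
      - 1/2 * (\<Sum>k\<in>UNIV. \<Sum>l\<in>UNIV. cnj (b z * cnj (u k l z)) * (b w * cnj (u k l w)) * da_kernel z w))"
    by (intro sum.cong refl, subst key)
      (simp_all add: right_diff_distrib sum_distrib_left mult_ac)
  also have "\<dots> = complex_of_real ((norm a)\<^sup>2) * (\<Sum>z\<in>F. \<Sum>w\<in>F. cnj (b z) * b w * da_kernel z w)
      - complex_of_real ((norm a)\<^sup>2) * (\<Sum>z\<in>F. \<Sum>w\<in>F. cnj (b z) * b w)
      - 1/2 * (\<Sum>z\<in>F. \<Sum>w\<in>F. \<Sum>k\<in>UNIV. \<Sum>l\<in>UNIV. cnj (b z * cnj (u k l z)) * (b w * cnj (u k l w)) * da_kernel z w)"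
    by (simp only: sum_subtractf sum_distrib_left)
  also have "(\<Sum>z\<in>F. \<Sum>w\<in>F. cnj (b z) * b w) = complex_of_real ((cmod (\<Sum>w\<in>F. b w))\<^sup>2)"
    unfolding complex_norm_square cnj_sum by (subst mult.commute) (simp only: sum_product)
  also have "(\<Sum>z\<in>F. \<Sum>w\<in>F. cnj (b z) * b w * da_kernel z w)
      = complex_of_real ((nrm (\<lambda>z. \<Sum>w\<in>F. b w * kf w z))\<^sup>2)"
    by (rule nrm_comb[where w = "\<lambda>w. w", OF F(1) wX, symmetric])
  also have "(\<Sum>z\<in>F. \<Sum>w\<in>F. \<Sum>k\<in>UNIV. \<Sum>l\<in>UNIV. cnj (b z * cnj (u k l z)) * (b w * cnj (u k l w)) * da_kernel z w)
     = (\<Sum>k\<in>UNIV. \<Sum>l\<in>UNIV. \<Sum>z\<in>F. \<Sum>w\<in>F. cnj (b z * cnj (u k l z)) * (b w * cnj (u k l w)) * da_kernel z w)"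
  proof -
    have swap: "(\<Sum>w\<in>F. \<Sum>k\<in>UNIV. \<Sum>l\<in>UNIV. g w k l) = (\<Sum>k\<in>UNIV. \<Sum>l\<in>UNIV. \<Sum>w\<in>F. g w k l)"
      for g :: "complex ^ 'd \<Rightarrow> 'd \<Rightarrow> 'd \<Rightarrow> complex"
      by (subst sum.swap, intro sum.cong refl, subst sum.swap, rule refl)
    show ?thesis unfolding swap ..
  qed
  also have "\<dots> = complex_of_real S"
    unfolding S_def of_real_sum
    by (intro sum.cong refl, rule nrm_comb[where w = "\<lambda>w. w", OF F(1) wX, symmetric])
  finally have "complex_of_real ((nrm (\<lambda>z. \<Sum>w\<in>F. b w * cnj (hip w a) * kf w z))\<^sup>2)
    = complex_of_real ((norm a)\<^sup>2 * (nrm (\<lambda>z. \<Sum>w\<in>F. b w * kf w z))\<^sup>2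
      - (norm a)\<^sup>2 * (cmod (\<Sum>w\<in>F. b w))\<^sup>2 - 1/2 * S)"
    by simp
  then have "(nrm (\<lambda>z. \<Sum>w\<in>F. b w * cnj (hip w a) * kf w z))\<^sup>2
    = (norm a)\<^sup>2 * (nrm (\<lambda>z. \<Sum>w\<in>F. b w * kf w z))\<^sup>2
      - (norm a)\<^sup>2 * (cmod (\<Sum>w\<in>F. b w))\<^sup>2 - 1/2 * S"
    unfolding of_real_eq_iff .
  moreover have "S \<ge> 0" unfolding S_def by (intro sum_nonneg) auto
  moreover have "0 \<le> (norm a)\<^sup>2 * (cmod (\<Sum>w\<in>F. b w))\<^sup>2" by simp
  ultimately have "(nrm (\<lambda>z. \<Sum>w\<in>F. b w * cnj (hip w a) * kf w z))\<^sup>2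
    \<le> (norm a * nrm (\<lambda>z. \<Sum>w\<in>F. b w * kf w z))\<^sup>2"
    unfolding power_mult_distrib by linarith
  then show "nrm (\<lambda>z. \<Sum>w\<in>F. b w * cnj (hip w a) * kf w z) \<le> norm a * nrm (\<lambda>z. \<Sum>w\<in>F. b w * kf w z)"
    by (rule power2_le_imp_le) (use nrm_nonneg[OF comb_mem[where w = "\<lambda>w. w", OF F(1) wX]] in auto)
qed simp

lemma bounded_mult_hip_power: "bounded_mult (norm a ^ n) (\<lambda>z. hip z a ^ n)"
  by (intro bounded_mult_power bounded_mult_hip) simp

lemma ex_bounded_mult_trunc_herglotz: "\<exists>C\<ge>0. bounded_mult C (trunc_herglotz N w)"
proof -
  have "bounded_mult (cmod 1 + cmod 2 * (\<Sum>k=1..N. norm w ^ k)) (\<lambda>z. 1 + 2 * (\<Sum>k=1..N. hip z w ^ k))"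
    by (intro bounded_mult_add bounded_mult_const bounded_mult_scale bounded_mult_sum
        bounded_mult_hip_power) auto
  then show ?thesis unfolding trunc_herglotz_def[abs_def]
    by (intro exI[of _ "cmod 1 + cmod 2 * (\<Sum>k=1..N. norm w ^ k)"]) (auto intro!: add_nonneg_nonneg sum_nonneg)
qed

text \<open>
  Let L be the multiplication by \<open>\<lambda>z. hip z w\<close>.  With y and e as below, \<open>L y = y - (f - e)\<close>,
  and \<open>\<parallel>L y\<parallel> \<le> \<parallel>y\<parallel>\<close> is the claim up to an error controlled by e.
\<close>

lemma accretive_trunc_herglotz:
  assumes w: "norm w < 1"
  shows "accretive (2 * norm w ^ Suc N / (1 - norm w)) (trunc_herglotz N w)"
  unfolding accretive_def
proof
  fix f assume f: "f \<in> H"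
  define r where "r = norm w"
  have r: "0 \<le> r" "r < 1" using w by (auto simp: r_def)
  define y where "y = (\<lambda>z. (\<Sum>k\<le>N. hip z w ^ k) * f z)"
  define e where "e = (\<lambda>z. hip z w ^ Suc N * f z)"
  define x where "x = (\<lambda>z. (\<Sum>k=1..N. hip z w ^ k) * f z)"
  have "bounded_mult (\<Sum>k=1..N. r ^ k) (\<lambda>z. \<Sum>k=1..N. hip z w ^ k)"
    unfolding r_def by (intro bounded_mult_sum bounded_mult_hip_power) auto
  note x = bounded_multD[OF this f, folded x_def]
  have shift: "(\<Sum>k\<le>N. a ^ k) = 1 + (\<Sum>k=1..N. a ^ k)" for a :: "'z :: {comm_ring_1}"
    by (simp add: sum.atLeast1_atMost_eq sum.atMost_shift)
  have "(\<Sum>k=1..N. r ^ k) \<le> 1 / (1 - r)"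
  proof -
    have "(\<Sum>k=1..N. r ^ k) \<le> (\<Sum>k\<le>N. r ^ k)" using shift[of r] by simp
    also have "\<dots> = (1 - r ^ Suc N) / (1 - r)" using r by (subst sum_gp0) auto
    also have "\<dots> \<le> 1 / (1 - r)" using r by (intro divide_right_mono) auto
    finally show ?thesis .
  qed
  then have xn: "nrm x \<le> 1 / (1 - r) * nrm f"
    using x(2) mult_right_mono[OF _ nrm_nonneg[OF f]] by (meson order_trans)
  have yx: "y = (\<lambda>z. f z + x z)"
    unfolding y_def x_def shift by (simp add: distrib_right)
  have y: "y \<in> H" unfolding yx by (intro add_mem f x)
  note e = bounded_multD[OF bounded_mult_hip_power f, of w "Suc N", folded e_def]
  have Ly: "(\<lambda>z. hip z w * y z) = (\<lambda>z. y z - (f z - e z))"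
  proof
    fix z
    have "(1 - hip z w) * (\<Sum>k\<le>N. hip z w ^ k) = 1 - hip z w ^ Suc N"
      by (metis one_diff_power_eq' lessThan_Suc_atMost one_diff_power_eq)
    then have "((1 - hip z w) * (\<Sum>k\<le>N. hip z w ^ k)) * f z = (1 - hip z w ^ Suc N) * f z" by simp
    then show "hip z w * y z = y z - (f z - e z)"
      unfolding y_def e_def by (simp add: algebra_simps)
  qed
  have fe: "(\<lambda>z. f z - e z) \<in> H" by (intro diff_mem f e)
  have "nrm (\<lambda>z. y z - (f z - e z)) \<le> 1 * nrm y"
    using bounded_multD(2)[OF bounded_mult_mono[OF bounded_mult_hip, of w 1] y] w unfolding Ly by simp
  then have "(nrm (\<lambda>z. y z - (f z - e z)))\<^sup>2 \<le> (nrm y)\<^sup>2"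
    by (intro power_mono nrm_nonneg diff_mem[OF y fe]) simp
  then have 1: "(nrm (\<lambda>z. f z - e z))\<^sup>2 \<le> 2 * Re (ip y (\<lambda>z. f z - e z))"
    using nrm_diff_sq[OF y fe] by simp
  have Pf: "(\<lambda>z. trunc_herglotz N w z * f z) = (\<lambda>z. f z + 2 * x z)"
    unfolding trunc_herglotz_def x_def by (simp add: algebra_simps)
  have "Re (ip (\<lambda>z. trunc_herglotz N w z * f z) f) = (nrm f)\<^sup>2 + 2 * Re (ip x f)"
    unfolding Pf using ip_add[OF f scale_mem[OF x(1)] f, of 2] ip_scale[OF x(1) f, of 2]
    by (simp add: nrm_sq[OF f])
  moreover have "Re (ip y (\<lambda>z. f z - e z)) = (nrm f)\<^sup>2 + Re (ip x f) - Re (ip f e) - Re (ip x e)"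
    unfolding yx using ip_add[OF f x(1) fe] ip_diff_right[OF f e(1) f] ip_diff_right[OF f e(1) x(1)]
    by (simp add: nrm_sq[OF f])
  moreover have "(nrm (\<lambda>z. f z - e z))\<^sup>2 = (nrm f)\<^sup>2 - 2 * Re (ip f e) + (nrm e)\<^sup>2"
    by (rule nrm_diff_sq[OF f e(1)])
  moreover have "- (r ^ Suc N / (1 - r) * (nrm f)\<^sup>2) \<le> Re (ip x e)"
  proof -
    have "\<bar>Re (ip x e)\<bar> \<le> nrm x * nrm e"
      using Cauchy_Schwarz[OF x(1) e(1)] abs_Re_le_cmod[of "ip x e"] by linarith
    also have "\<dots> \<le> (1 / (1 - r) * nrm f) * (r ^ Suc N * nrm f)"
      using xn e(2) r nrm_nonneg[OF f] nrm_nonneg[OF e(1)] unfolding r_def[symmetric] by (intro mult_mono) auto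
    also have "\<dots> = r ^ Suc N / (1 - r) * (nrm f)\<^sup>2"
      by (simp add: power2_eq_square)
    finally show ?thesis by linarith
  qed
  \<comment> \<open>The terms Re \<open>ip f e\<close> cancel, and the left-over inequality bounds
    the form from below by \<open>(nrm e)\<^sup>2\<close> plus 2 Re \<open>ip x e\<close>.\<close>
  ultimately have "2 * - (r ^ Suc N / (1 - r) * (nrm f)\<^sup>2) \<le> Re (ip (\<lambda>z. trunc_herglotz N w z * f z) f)"
    using 1 zero_le_power2[of "nrm e"] by linarith
  then show "- (2 * norm w ^ Suc N / (1 - norm w)) * (nrm f)\<^sup>2 \<le> Re (ip (\<lambda>z. trunc_herglotz N w z * f z) f)"
    unfolding r_def[symmetric] by simp
qed

end

section \<open>Potentials and energy of weighted measures\<close>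

lemma (in finite_measure) bounded_convergence:
  fixes u :: "nat \<Rightarrow> 'a \<Rightarrow> 'b :: {banach, second_countable_topology}"
  assumes u: "\<And>k. u k \<in> borel_measurable M"
    and lim: "\<And>z. z \<in> space M \<Longrightarrow> (\<lambda>k. u k z) \<longlonglongrightarrow> v z"
    and bound: "\<And>k z. z \<in> space M \<Longrightarrow> norm (u k z) \<le> C"
  shows "v \<in> borel_measurable M" "(\<lambda>k. \<integral>z. u k z \<partial>M) \<longlonglongrightarrow> (\<integral>z. v z \<partial>M)"
proof -
  show v: "v \<in> borel_measurable M"
    by (rule borel_measurable_LIMSEQ_metric[OF u lim])
  show "(\<lambda>k. \<integral>z. u k z \<partial>M) \<longlonglongrightarrow> (\<integral>z. v z \<partial>M)"
    using v u lim bound by (intro integral_dominated_convergence[where w = "\<lambda>_. C"]) auto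
qed

lemma sphere_borel_sets_iff: "A \<in> sets sphere_borel \<longleftrightarrow> A \<in> sets borel \<and> A \<subseteq> sphere 0 1"
  unfolding sphere_borel_def by (subst sets_restrict_space_iff) auto

lemma space_sphere_borel: "space sphere_borel = sphere 0 1"
  by (simp add: sphere_borel_def space_restrict_space)

locale sphere_measure = finite_measure M for M :: "(complex ^ 'a) measure" +
  assumes sets_eq: "sets M = sets sphere_borel"
begin

lemma space_eq: "space M = sphere 0 1"
  using sets_eq_imp_space_eq[OF sets_eq] by (simp add: space_sphere_borel)

lemma measurable_continuous:
  fixes f :: "complex ^ 'a \<Rightarrow> 'b :: topological_space"
  assumes "continuous_on (sphere 0 1) f"
  shows "f \<in> borel_measurable M"
  using borel_measurable_continuous_on_restrict[OF assms]
  by (simp add: measurable_cong_sets[OF sets_eq refl] sphere_borel_def)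

lemma integrable_bounded:
  fixes f :: "complex ^ 'a \<Rightarrow> 'b :: {banach, second_countable_topology}"
  assumes "f \<in> borel_measurable M" "\<And>z. z \<in> sphere 0 1 \<Longrightarrow> norm (f z) \<le> C"
  shows "integrable M f"
  using assms by (intro integrable_const_bound[of _ C]) (auto simp: space_eq)

definition potential :: "(complex ^ 'a \<Rightarrow> real) \<Rightarrow> complex ^ 'a \<Rightarrow> real"
  where "potential f w = (\<integral>z. Re (da_kernel z w) * f z \<partial>M)"

text \<open>The factor \<open>r\<^sup>2\<close> arises from K(r z, r w) = K(z, r^2 w). For f = 1
  this is the double integral in \<open>energy\<close> at radius r.\<close>

definition weighted_energy :: "(complex ^ 'a \<Rightarrow> real) \<Rightarrow> real \<Rightarrow> real"
  where "weighted_energy f r = (\<integral>z. f z * potential f (r\<^sup>2 *\<^sub>R z) \<partial>M)"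

lemma measurable_kernel: "norm w < 1 \<Longrightarrow> (\<lambda>z. Re (da_kernel z w)) \<in> borel_measurable M"
  by (intro measurable_continuous continuous_intros) auto

lemma abs_Re_kernel_le:
  "norm z \<le> 1 \<Longrightarrow> norm w \<le> r \<Longrightarrow> r < 1 \<Longrightarrow> \<bar>Re (da_kernel z w)\<bar> \<le> 1 / (1 - r)"
  using norm_da_kernel_le abs_Re_le_cmod order_trans by blast

lemma integrable_kernel:
  assumes "norm w < 1" "f \<in> borel_measurable M" "\<And>z. z \<in> sphere 0 1 \<Longrightarrow> \<bar>f z\<bar> \<le> B"
  shows "integrable M (\<lambda>z. Re (da_kernel z w) * f z)"
proof (rule integrable_bounded)
  show "(\<lambda>z. Re (da_kernel z w) * f z) \<in> borel_measurable M"
    using assms measurable_kernel by simp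
  fix z :: "complex ^ 'a" assume z: "z \<in> sphere 0 1"
  show "norm (Re (da_kernel z w) * f z) \<le> 1 / (1 - norm w) * B"
    unfolding real_norm_def abs_mult using z assms
    by (intro mult_mono abs_Re_kernel_le) auto
qed

lemma continuous_on_potential:
  assumes f: "f \<in> borel_measurable M" "\<And>z. z \<in> sphere 0 1 \<Longrightarrow> \<bar>f z\<bar> \<le> B"
  shows "continuous_on (ball 0 1) (potential f)"
proof (rule continuous_on_sequentiallyI)
  fix u :: "nat \<Rightarrow> complex ^ 'a" and a
  assume u: "\<forall>n. u n \<in> ball 0 1" and a: "a \<in> ball 0 1" and lim: "u \<longlonglongrightarrow> a"
  define r where "r = (norm a + 1) / 2"
  have r: "norm a < r" "r < 1" using a by (auto simp: r_def)
  have "\<forall>\<^sub>F n in sequentially. norm (u n) < r"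
    using order_tendstoD(2)[OF tendsto_norm[OF lim] r(1)] .
  then obtain N where N: "\<And>n. n \<ge> N \<Longrightarrow> norm (u n) < r"
    by (auto simp: eventually_sequentially)
  have "(\<lambda>n. potential f (u (n + N))) \<longlonglongrightarrow> potential f a"
    unfolding potential_def
  proof (rule bounded_convergence(2))
    show "(\<lambda>z. Re (da_kernel z (u (k + N))) * f z) \<in> borel_measurable M" for k
      using u f by (intro borel_measurable_times measurable_kernel) auto
    fix z :: "complex ^ 'a" assume "z \<in> space M"
    then have z: "z \<in> sphere 0 1" by (simp add: space_eq)
    have "continuous_on (ball 0 1) (da_kernel z)"
      using z by (intro continuous_intros) auto
    from continuous_on_tendsto_compose[OF this LIMSEQ_ignore_initial_segment[OF lim, of N] a]
    have "(\<lambda>k. Re (da_kernel z (u (k + N)))) \<longlonglongrightarrow> Re (da_kernel z a)"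
      using u by (intro tendsto_Re) simp
    then show "(\<lambda>k. Re (da_kernel z (u (k + N))) * f z) \<longlonglongrightarrow> Re (da_kernel z a) * f z"
      by (intro tendsto_mult tendsto_const)
    show "norm (Re (da_kernel z (u (k + N))) * f z) \<le> 1 / (1 - r) * B" for k
      unfolding real_norm_def abs_mult using z f(2)[of z] N[of "k + N"] r
      by (intro mult_mono abs_Re_kernel_le) auto
  qed
  then show "(\<lambda>n. potential f (u n)) \<longlonglongrightarrow> potential f a"
    by (rule LIMSEQ_offset)
qed

lemma potential_abs_le:
  assumes f: "f \<in> borel_measurable M" "\<And>z. z \<in> sphere 0 1 \<Longrightarrow> \<bar>f z\<bar> \<le> g z"
    and g: "g \<in> borel_measurable M" "\<And>z. z \<in> sphere 0 1 \<Longrightarrow> g z \<le> B" and w: "norm w < 1"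
  shows "\<bar>potential f w\<bar> \<le> potential g w"
proof -
  have g': "\<bar>g z\<bar> \<le> B" if "z \<in> sphere 0 1" for z
    using f(2)[OF that] g(2)[OF that] by linarith
  have fB: "\<bar>f z\<bar> \<le> B" if "z \<in> sphere 0 1" for z
    using f(2)[OF that] g(2)[OF that] by linarith
  have "\<bar>potential f w\<bar> \<le> (\<integral>z. \<bar>Re (da_kernel z w) * f z\<bar> \<partial>M)"
    unfolding potential_def by (rule integral_abs_bound)
  also have "\<dots> \<le> potential g w"
    unfolding potential_def
  proof (rule integral_mono)
    fix z assume "z \<in> space M"
    then have z: "z \<in> sphere 0 1" by (simp add: space_eq)
    have "Re (da_kernel z w) > 0" using Re_da_kernel_gt[of z w] z w by simp
    then show "\<bar>Re (da_kernel z w) * f z\<bar> \<le> Re (da_kernel z w) * g z"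
      using f(2)[OF z] by (simp add: abs_mult)
  qed (use f g g' fB w in \<open>auto intro!: integrable_kernel[where B = B] integrable_abs\<close>)
  finally show ?thesis .
qed

lemma measurable_potential_scaled:
  assumes f: "f \<in> borel_measurable M" "\<And>z. z \<in> sphere 0 1 \<Longrightarrow> \<bar>f z\<bar> \<le> B" and r: "0 \<le> r" "r < 1"
  shows "(\<lambda>z. potential f (r *\<^sub>R z)) \<in> borel_measurable M"
proof (rule measurable_continuous)
  show "continuous_on (sphere 0 1) (\<lambda>z. potential f (r *\<^sub>R z))"
    by (rule continuous_on_compose2[OF continuous_on_potential[OF f]])
      (use r in \<open>auto intro!: continuous_intros\<close>)
qed

lemma abs_potential_le:
  assumes f: "f \<in> borel_measurable M" "\<And>z. z \<in> sphere 0 1 \<Longrightarrow> \<bar>f z\<bar> \<le> B"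
    and w: "norm w \<le> r" "r < 1"
  shows "\<bar>potential f w\<bar> \<le> 1 / (1 - r) * B * measure M (space M)"
proof -
  have "\<bar>potential f w\<bar> \<le> (\<integral>z. \<bar>Re (da_kernel z w) * f z\<bar> \<partial>M)"
    unfolding potential_def by (rule integral_abs_bound)
  also have "\<dots> \<le> (\<integral>z. 1 / (1 - r) * B \<partial>M)"
  proof (rule integral_mono)
    show "integrable M (\<lambda>z. \<bar>Re (da_kernel z w) * f z\<bar>)"
      using f w by (intro integrable_abs integrable_kernel) auto
    fix z assume "z \<in> space M"
    then show "\<bar>Re (da_kernel z w) * f z\<bar> \<le> 1 / (1 - r) * B"
      unfolding abs_mult using w f(2)[of z] by (intro mult_mono abs_Re_kernel_le) (auto simp: space_eq)
  qed simp
  finally show ?thesis by (simp add: mult.commute)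
qed

lemma weighted_energy_integrable:
  assumes f: "f \<in> borel_measurable M" "\<And>z. z \<in> sphere 0 1 \<Longrightarrow> \<bar>f z\<bar> \<le> B"
    and g: "g \<in> borel_measurable M" "\<And>z. z \<in> sphere 0 1 \<Longrightarrow> \<bar>g z\<bar> \<le> C" and r: "0 \<le> r" "r < 1"
  shows "integrable M (\<lambda>z. g z * potential f (r\<^sup>2 *\<^sub>R z))"
proof (rule integrable_bounded)
  have r2: "r\<^sup>2 < 1" using r by (simp add: power_less_one_iff)
  show "(\<lambda>z. g z * potential f (r\<^sup>2 *\<^sub>R z)) \<in> borel_measurable M"
    using r2 by (intro borel_measurable_times g measurable_potential_scaled[OF f]) auto
  fix z :: "complex ^ 'a" assume z: "z \<in> sphere 0 1"
  show "norm (g z * potential f (r\<^sup>2 *\<^sub>R z)) \<le> C * (1 / (1 - r\<^sup>2) * B * measure M (space M))"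
    unfolding real_norm_def abs_mult using z g(2)[OF z] r2
    by (intro mult_mono abs_potential_le[OF f]) auto
qed

lemma weighted_energy_le:
  assumes f: "f \<in> borel_measurable M" "\<And>z. z \<in> sphere 0 1 \<Longrightarrow> \<bar>f z\<bar> \<le> g z"
    and g: "g \<in> borel_measurable M" "\<And>z. z \<in> sphere 0 1 \<Longrightarrow> g z \<le> B" and r: "0 \<le> r" "r < 1"
  shows "weighted_energy f r \<le> weighted_energy g r"
  unfolding weighted_energy_def
proof (rule integral_mono)
  have r2: "r\<^sup>2 < 1" using r by (simp add: power_less_one_iff)
  have bd: "\<bar>f z\<bar> \<le> B" "\<bar>g z\<bar> \<le> B" if "z \<in> sphere 0 1" for z
    using f(2)[OF that] g(2)[OF that] by auto
  show "integrable M (\<lambda>z. f z * potential f (r\<^sup>2 *\<^sub>R z))"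
    "integrable M (\<lambda>z. g z * potential g (r\<^sup>2 *\<^sub>R z))"
    using bd by (auto intro!: weighted_energy_integrable f g r)
  fix z assume "z \<in> space M"
  then have z: "z \<in> sphere 0 1" by (simp add: space_eq)
  have "f z * potential f (r\<^sup>2 *\<^sub>R z) \<le> \<bar>f z\<bar> * \<bar>potential f (r\<^sup>2 *\<^sub>R z)\<bar>"
    by (simp add: abs_mult[symmetric])
  also have "\<dots> \<le> g z * potential g (r\<^sup>2 *\<^sub>R z)"
    using f(2)[OF z] z r2 by (intro mult_mono potential_abs_le[OF f g]) auto
  finally show "f z * potential f (r\<^sup>2 *\<^sub>R z) \<le> g z * potential g (r\<^sup>2 *\<^sub>R z)" .
qed

text \<open>Simple functions approximating the identity are pushed radially into the closed unit
  ball, so that their multiples by r < 1 stay in the domain of the kernel; on the sphere the limit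
  is unaffected.\<close>

lemma simple_approx:
  obtains \<phi> :: "nat \<Rightarrow> complex ^ 'a \<Rightarrow> complex ^ 'a"
  where "\<And>k. simple_function M (\<phi> k)" "\<And>k z. norm (\<phi> k z) \<le> 1"
    "\<And>z. z \<in> sphere 0 1 \<Longrightarrow> (\<lambda>k. \<phi> k z) \<longlonglongrightarrow> z"
proof -
  have "(\<lambda>z. z) \<in> borel_measurable M" by (intro measurable_continuous continuous_intros)
  then obtain F where F: "\<And>k. simple_function M (F k)" "\<And>z. z \<in> space M \<Longrightarrow> (\<lambda>k. F k z) \<longlonglongrightarrow> z"
    using borel_measurable_implies_sequence_metric[of "\<lambda>z. z" M 0] by blast
  show ?thesis
  proof (rule that[of "\<lambda>k z. (1 / max 1 (norm (F k z))) *\<^sub>R F k z"])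
    show "simple_function M (\<lambda>z. (1 / max 1 (norm (F k z))) *\<^sub>R F k z)" for k
      using simple_function_compose1[OF F(1)[of k], of "\<lambda>x. (1 / max 1 (norm x)) *\<^sub>R x"] .
    show "norm ((1 / max 1 (norm (F k z))) *\<^sub>R F k z) \<le> 1" for k z
      by (simp add: divide_le_eq)
    fix z :: "complex ^ 'a" assume z: "z \<in> sphere 0 1"
    then have "(\<lambda>k. (1 / max 1 (norm (F k z))) *\<^sub>R F k z) \<longlonglongrightarrow> (1 / max 1 (norm z)) *\<^sub>R z"
      by (intro tendsto_intros F) (auto simp: space_eq)
    then show "(\<lambda>k. (1 / max 1 (norm (F k z))) *\<^sub>R F k z) \<longlonglongrightarrow> z"
      using z by simp
  qed
qed

text \<open>Decomposition over the finitely many level sets of \<phi>. As h is evaluated at finitely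
  many points only, it may be an arbitrary function, such as an element of the space.\<close>

lemma integral_simple_compose:
  fixes h :: "complex ^ 'a \<Rightarrow> 'b :: {banach, second_countable_topology, real_normed_field}"
  assumes \<phi>: "simple_function M \<phi>" and f: "integrable M f"
  shows "(\<integral>z. h (\<phi> z) * of_real (f z) \<partial>M) =
    (\<Sum>a\<in>\<phi> ` space M. h a * of_real (\<integral>z. indicator (\<phi> -` {a} \<inter> space M) z * f z \<partial>M))"
proof -
  have fin: "finite (\<phi> ` space M)" using \<phi> by (rule simple_functionD)
  have int: "integrable M (\<lambda>z. indicator (\<phi> -` {a} \<inter> space M) z * f z)" for a
    using integrable_mult_indicator[OF _ f, of "\<phi> -` {a} \<inter> space M"] simple_functionD(2)[OF \<phi>, of "{a}"] by simp
  have "(\<integral>z. h (\<phi> z) * of_real (f z) \<partial>M)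
      = (\<integral>z. (\<Sum>a\<in>\<phi> ` space M. h a * of_real (indicator (\<phi> -` {a} \<inter> space M) z * f z)) \<partial>M)"
  proof (rule Bochner_Integration.integral_cong[OF refl])
    fix z assume z: "z \<in> space M"
    have "(\<Sum>a\<in>\<phi> ` space M. h a * of_real (indicator (\<phi> -` {a} \<inter> space M) z * f z))
      = (\<Sum>a\<in>\<phi> ` space M. if a = \<phi> z then h a * of_real (f z) else 0)"
      using z by (intro sum.cong refl) (auto simp: indicator_def)
    also have "\<dots> = h (\<phi> z) * of_real (f z)" using fin z by (subst sum.delta) auto
    finally show "h (\<phi> z) * of_real (f z) = (\<Sum>a\<in>\<phi> ` space M. h a * of_real (indicator (\<phi> -` {a} \<inter> space M) z * f z))" ..
  qed
  also have "\<dots> = (\<Sum>a\<in>\<phi> ` space M. h a * of_real (\<integral>z. indicator (\<phi> -` {a} \<inter> space M) z * f z \<partial>M))"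
    using int by (subst Bochner_Integration.integral_sum) (auto intro!: integrable_of_real simp del: of_real_mult)
  finally show ?thesis .
qed

end

section \<open>Energy as a squared norm\<close>

locale drury_arveson_sphere = drury_arveson H ip + sphere_measure M
  for H :: "(complex ^ 'd \<Rightarrow> complex) set" and ip and M :: "(complex ^ 'd) measure"
begin

text \<open>The energy is the squared norm of the potential, here as a limit over discretizations of the measure.\<close>

lemma energy_approx:
  assumes f: "f \<in> borel_measurable M" "\<And>z. z \<in> sphere 0 1 \<Longrightarrow> \<bar>f z\<bar> \<le> B" and r: "0 \<le> r" "r < 1"
  shows "\<exists>g :: nat \<Rightarrow> complex ^ 'd \<Rightarrow> complex. (\<forall>k. g k \<in> H)
    \<and> (\<lambda>k. (nrm (g k))\<^sup>2) \<longlonglongrightarrow> weighted_energy f r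
    \<and> (\<forall>p\<in>H. continuous_on (ball 0 1) p \<longrightarrow>
      (\<lambda>k. ip p (g k)) \<longlonglongrightarrow> (\<integral>z. p (r *\<^sub>R z) * complex_of_real (f z) \<partial>M))"
proof -
  obtain \<phi> where \<phi>: "\<And>k. simple_function M (\<phi> k)" "\<And>k z. norm (\<phi> k z) \<le> 1"
    and lim: "\<And>z. z \<in> sphere 0 1 \<Longrightarrow> (\<lambda>k. \<phi> k z) \<longlonglongrightarrow> z"
    using simple_approx by blast
  have r2: "r\<^sup>2 < 1" using r by (simp add: power_less_one_iff)
  have int_f: "integrable M f" using f by (intro integrable_bounded) auto
  define A where "A k = \<phi> k ` space M" for k
  define G where "G k a = (\<integral>z. indicator (\<phi> k -` {a} \<inter> space M) z * f z \<partial>M)" for k a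
  \<comment> \<open>The discretized measure has mass \<open>G k a\<close> at a, and pairing p with
    \<open>g k\<close> integrates the dilate of p by r against it.\<close>
  define g where "g k = (\<lambda>z. \<Sum>a\<in>A k. complex_of_real (G k a) * kf (r *\<^sub>R a) z)" for k
  have fin: "finite (A k)" for k unfolding A_def by (rule simple_functionD[OF \<phi>(1)])
  have rb: "norm (r *\<^sub>R a) \<le> r" if "norm a \<le> 1" for a :: "complex ^ 'd"
    using r that mult_left_mono[OF that r(1)] by simp
  have inb: "r *\<^sub>R a \<in> ball 0 1" if "a \<in> A k" for a k
    using that rb[of a] r(2) \<phi>(2) unfolding A_def by force
  have meas_\<phi>: "(\<lambda>z. h (\<phi> k z)) \<in> borel_measurable M" for k and h :: "complex ^ 'd \<Rightarrow> 'z :: topological_space"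
    by (rule borel_measurable_simple_function[OF simple_function_compose1[OF \<phi>(1)]])
  have gH: "g k \<in> H" for k unfolding g_def by (intro comb_mem fin inb)
  have cont_lim: "(\<lambda>k. p (r *\<^sub>R \<phi> k z)) \<longlonglongrightarrow> p (r *\<^sub>R z)"
    if p: "continuous_on (ball 0 1) p" and z: "z \<in> sphere 0 1" for p :: "complex ^ 'd \<Rightarrow> complex" and z
  proof (rule continuous_on_tendsto_compose[OF p])
    show "(\<lambda>k. r *\<^sub>R \<phi> k z) \<longlonglongrightarrow> r *\<^sub>R z" by (intro tendsto_intros lim z)
    show "\<forall>\<^sub>F k in sequentially. r *\<^sub>R \<phi> k z \<in> ball 0 1"
      using le_less_trans[OF rb[OF \<phi>(2)] r(2)] by simp
  qed (use z r in auto)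
  have "(\<lambda>k. ip p (g k)) \<longlonglongrightarrow> (\<integral>z. p (r *\<^sub>R z) * complex_of_real (f z) \<partial>M)"
    if pH: "p \<in> H" and pc: "continuous_on (ball 0 1) p" for p
  proof -
    have "compact (p ` cball 0 r)"
      using r by (intro compact_continuous_image continuous_on_subset[OF pc]) auto
    then obtain D where D: "\<And>z. norm z \<le> r \<Longrightarrow> cmod (p z) \<le> D"
      by (force dest!: compact_imp_bounded simp: bounded_iff)
    have "(\<lambda>k. \<integral>z. p (r *\<^sub>R \<phi> k z) * complex_of_real (f z) \<partial>M) \<longlonglongrightarrow> (\<integral>z. p (r *\<^sub>R z) * complex_of_real (f z) \<partial>M)"
    proof (rule bounded_convergence(2))
      show "(\<lambda>z. p (r *\<^sub>R \<phi> k z) * complex_of_real (f z)) \<in> borel_measurable M" for k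
        using f by (intro borel_measurable_times meas_\<phi>[of "\<lambda>a. p (r *\<^sub>R a)"]) auto
      show "(\<lambda>k. p (r *\<^sub>R \<phi> k z) * complex_of_real (f z)) \<longlonglongrightarrow> p (r *\<^sub>R z) * complex_of_real (f z)"
        if "z \<in> space M" for z
        using that by (intro tendsto_intros cont_lim pc) (auto simp: space_eq)
      show "norm (p (r *\<^sub>R \<phi> k z) * complex_of_real (f z)) \<le> D * B" if "z \<in> space M" for k z
        unfolding norm_mult using that f(2)[of z] D[OF rb[OF \<phi>(2)]] order_trans[OF norm_ge_zero D[OF rb[OF \<phi>(2)]]]
        by (intro mult_mono) (auto simp: space_eq)
    qed
    moreover have "(\<integral>z. p (r *\<^sub>R \<phi> k z) * complex_of_real (f z) \<partial>M) = ip p (g k)" for k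
    proof -
      have "ip p (g k) = (\<Sum>a\<in>A k. cnj (complex_of_real (G k a)) * p (r *\<^sub>R a))"
        unfolding g_def by (rule ip_comb[OF fin inb pH])
      then show ?thesis
        using integral_simple_compose[OF \<phi>(1) int_f, of "\<lambda>a. p (r *\<^sub>R a)" k]
        unfolding A_def G_def by (simp add: mult.commute)
    qed
    ultimately show ?thesis by simp
  qed
  moreover have "(\<lambda>k. (nrm (g k))\<^sup>2) \<longlonglongrightarrow> weighted_energy f r"
  proof -
    \<comment> \<open>The potential with its integration variable discretized. The squared norm of
      \<open>g k\<close> is the integral of f times this potential at discretized points, and
      bounded convergence is applied once inside and once outside.\<close>
    define V where "V k w = (\<integral>z. Re (da_kernel (\<phi> k z) w) * f z \<partial>M)" for k w
    have V: "V k w = (\<Sum>a\<in>A k. Re (da_kernel a w) * G k a)" for k w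
      using integral_simple_compose[OF \<phi>(1) int_f, of "\<lambda>a. Re (da_kernel a w)" k]
      unfolding V_def A_def G_def by simp
    have "(nrm (g k))\<^sup>2 = (\<integral>z. f z * V k (r\<^sup>2 *\<^sub>R \<phi> k z) \<partial>M)" for k
    proof -
      have "(nrm (g k))\<^sup>2 = Re (\<Sum>b\<in>A k. \<Sum>a\<in>A k. cnj (complex_of_real (G k b)) * complex_of_real (G k a) * da_kernel (r *\<^sub>R b) (r *\<^sub>R a))"
        unfolding g_def by (rule nrm_comb_Re[OF fin inb])
      also have "\<dots> = (\<Sum>b\<in>A k. \<Sum>a\<in>A k. G k b * G k a * Re (da_kernel b (r\<^sup>2 *\<^sub>R a)))"
        by (simp add: da_kernel_scaleR power2_eq_square flip: of_real_mult)
      also have "\<dots> = (\<Sum>a\<in>A k. V k (r\<^sup>2 *\<^sub>R a) * G k a)"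
        unfolding V sum_distrib_right by (subst sum.swap) (simp add: mult_ac)
      also have "\<dots> = (\<integral>z. f z * V k (r\<^sup>2 *\<^sub>R \<phi> k z) \<partial>M)"
        using integral_simple_compose[OF \<phi>(1) int_f, of "\<lambda>a. V k (r\<^sup>2 *\<^sub>R a)" k]
        unfolding A_def G_def by (simp add: mult.commute)
      finally show ?thesis .
    qed
    moreover have "(\<lambda>k. \<integral>z. f z * V k (r\<^sup>2 *\<^sub>R \<phi> k z) \<partial>M) \<longlonglongrightarrow> weighted_energy f r"
      unfolding weighted_energy_def
    proof (rule bounded_convergence(2))
      have wn: "norm (r\<^sup>2 *\<^sub>R \<phi> k z) \<le> r\<^sup>2" for k z
        using \<phi>(2)[of k z] mult_left_mono[OF \<phi>(2)[of k z], of "r\<^sup>2"] by simp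
      have kb: "norm (Re (da_kernel (\<phi> k z) w) * f z) \<le> 1 / (1 - r\<^sup>2) * B"
        if "z \<in> space M" "norm w \<le> r\<^sup>2" for k z w
        unfolding real_norm_def abs_mult using that f(2)[of z] \<phi>(2) r2
        by (intro mult_mono abs_Re_kernel_le) (auto simp: space_eq)
      show "(\<lambda>z. f z * V k (r\<^sup>2 *\<^sub>R \<phi> k z)) \<in> borel_measurable M" for k
        using f by (intro borel_measurable_times meas_\<phi>[of "\<lambda>a. V k (r\<^sup>2 *\<^sub>R a)"]) auto
      show "(\<lambda>k. f z * V k (r\<^sup>2 *\<^sub>R \<phi> k z)) \<longlonglongrightarrow> f z * potential f (r\<^sup>2 *\<^sub>R z)"
        if z: "z \<in> space M" for z
      proof (intro tendsto_mult tendsto_const)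
        show "(\<lambda>k. V k (r\<^sup>2 *\<^sub>R \<phi> k z)) \<longlonglongrightarrow> potential f (r\<^sup>2 *\<^sub>R z)"
          unfolding V_def potential_def
        proof (rule bounded_convergence(2))
          show "(\<lambda>y. Re (da_kernel (\<phi> k y) (r\<^sup>2 *\<^sub>R \<phi> k z)) * f y) \<in> borel_measurable M" for k
            using f by (intro borel_measurable_times meas_\<phi>[of "\<lambda>a. Re (da_kernel a (r\<^sup>2 *\<^sub>R \<phi> k z))"]) auto
          fix y assume y: "y \<in> space M"
          have ne: "1 - hip y (r\<^sup>2 *\<^sub>R z) \<noteq> 0"
            using norm_hip_less_one[of y "r\<^sup>2 *\<^sub>R z"] y z r2 by (auto simp: space_eq)
          have h: "(\<lambda>k. hip (\<phi> k y) (r\<^sup>2 *\<^sub>R \<phi> k z)) \<longlonglongrightarrow> hip y (r\<^sup>2 *\<^sub>R z)"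
            unfolding hip_def using y z by (intro tendsto_intros lim) (auto simp: space_eq)
          show "(\<lambda>k. Re (da_kernel (\<phi> k y) (r\<^sup>2 *\<^sub>R \<phi> k z)) * f y) \<longlonglongrightarrow> Re (da_kernel y (r\<^sup>2 *\<^sub>R z)) * f y"
            unfolding da_kernel_hip by (intro tendsto_intros h ne)
          show "norm (Re (da_kernel (\<phi> k y) (r\<^sup>2 *\<^sub>R \<phi> k z)) * f y) \<le> 1 / (1 - r\<^sup>2) * B" for k
            by (intro kb y wn)
        qed
      qed
      show "norm (f z * V k (r\<^sup>2 *\<^sub>R \<phi> k z)) \<le> B * (1 / (1 - r\<^sup>2) * B * measure M (space M))"
        if z: "z \<in> space M" for k z
      proof -
        have "\<bar>V k (r\<^sup>2 *\<^sub>R \<phi> k z)\<bar> \<le> (\<integral>y. \<bar>Re (da_kernel (\<phi> k y) (r\<^sup>2 *\<^sub>R \<phi> k z)) * f y\<bar> \<partial>M)"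
          unfolding V_def by (rule integral_abs_bound)
        also have "\<dots> \<le> (\<integral>y. 1 / (1 - r\<^sup>2) * B \<partial>M)"
        proof (rule integral_mono)
          have "(\<lambda>y. Re (da_kernel (\<phi> k y) (r\<^sup>2 *\<^sub>R \<phi> k z)) * f y) \<in> borel_measurable M"
            using f by (intro borel_measurable_times meas_\<phi>[of "\<lambda>a. Re (da_kernel a (r\<^sup>2 *\<^sub>R \<phi> k z))"]) auto
          then show "integrable M (\<lambda>y. \<bar>Re (da_kernel (\<phi> k y) (r\<^sup>2 *\<^sub>R \<phi> k z)) * f y\<bar>)"
            by (intro integrable_abs integrable_bounded[where C = "1 / (1 - r\<^sup>2) * B"] kb wn) (auto simp: space_eq)
        qed (use kb[OF _ wn] in \<open>auto simp: real_norm_def\<close>)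
        finally have "\<bar>V k (r\<^sup>2 *\<^sub>R \<phi> k z)\<bar> \<le> 1 / (1 - r\<^sup>2) * B * measure M (space M)"
          by (simp add: mult.commute)
        then show ?thesis
          unfolding real_norm_def abs_mult using z f(2)[of z]
          by (intro mult_mono) (auto simp: space_eq)
      qed
    qed
    ultimately show ?thesis by simp
  qed
  ultimately show ?thesis using gH by blast
qed

lemma weighted_energy_nonneg:
  assumes f: "f \<in> borel_measurable M" "\<And>z. z \<in> sphere 0 1 \<Longrightarrow> \<bar>f z\<bar> \<le> B" and r: "0 \<le> r" "r < 1"
  shows "0 \<le> weighted_energy f r"
proof -
  obtain g where "(\<lambda>k. (nrm (g k))\<^sup>2) \<longlonglongrightarrow> weighted_energy f r"
    using energy_approx[OF assms] by blast
  then show ?thesis by (rule LIMSEQ_le_const) auto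
qed

text \<open>Cauchy-Schwarz between p and the discretizations, with the limit taken on both
  sides.\<close>

lemma integral_le_energy:
  assumes f: "f \<in> borel_measurable M" "\<And>z. z \<in> sphere 0 1 \<Longrightarrow> \<bar>f z\<bar> \<le> B" and r: "0 \<le> r" "r < 1"
    and p: "p \<in> H" "continuous_on (ball 0 1) p"
  shows "cmod (\<integral>z. p (r *\<^sub>R z) * complex_of_real (f z) \<partial>M) \<le> nrm p * sqrt (weighted_energy f r)"
proof -
  obtain g where g: "\<And>k. g k \<in> H" "(\<lambda>k. (nrm (g k))\<^sup>2) \<longlonglongrightarrow> weighted_energy f r"
    and g': "\<And>p. p \<in> H \<Longrightarrow> continuous_on (ball 0 1) p \<Longrightarrow>
      (\<lambda>k. ip p (g k)) \<longlonglongrightarrow> (\<integral>z. p (r *\<^sub>R z) * complex_of_real (f z) \<partial>M)"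
    using energy_approx[OF f r] by blast
  show ?thesis
  proof (rule LIMSEQ_le)
    show "(\<lambda>k. cmod (ip p (g k))) \<longlonglongrightarrow> cmod (\<integral>z. p (r *\<^sub>R z) * complex_of_real (f z) \<partial>M)"
      by (intro tendsto_intros g' p)
    show "(\<lambda>k. nrm p * sqrt ((nrm (g k))\<^sup>2)) \<longlonglongrightarrow> nrm p * sqrt (weighted_energy f r)"
      by (intro tendsto_intros g)
    show "\<exists>N. \<forall>n\<ge>N. cmod (ip p (g n)) \<le> nrm p * sqrt ((nrm (g n))\<^sup>2)"
      using Cauchy_Schwarz[OF p(1) g(1)] by (simp add: real_sqrt_unique nrm_nonneg[OF g(1)])
  qed
qed

end

section \<open>Weak convergence to zero\<close>

text \<open>Elements of the space vanish off the ball, whereas a polynomial must keep its values on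
  the sphere in order to be integrated there; this is the element of the space belonging to
  p.\<close>

definition restr_ball :: "(complex ^ 'd \<Rightarrow> complex) \<Rightarrow> complex ^ 'd \<Rightarrow> complex"
  where "restr_ball p = (\<lambda>z. if z \<in> ball 0 1 then p z else 0)"

context drury_arveson_sphere
begin

lemma measurable_polynomial: "complex_polynomial p \<Longrightarrow> p \<in> borel_measurable M"
  by (intro measurable_continuous continuous_on_complex_polynomial)

lemma polynomial_bounded: "complex_polynomial p \<Longrightarrow> \<exists>D. \<forall>z. norm z \<le> 1 \<longrightarrow> cmod (p z) \<le> D"
  using compact_imp_bounded[OF compact_continuous_image[OF continuous_on_complex_polynomial compact_cball[of 0 1]], of p]
  by (force simp: bounded_iff)

lemma integrable_polynomial:
  assumes "complex_polynomial p" and f: "f \<in> borel_measurable M" "\<And>z. z \<in> sphere 0 1 \<Longrightarrow> \<bar>f z\<bar> \<le> B"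
  shows "integrable M (\<lambda>z. p z * complex_of_real (f z))"
proof -
  obtain D where D: "\<And>z. norm z \<le> 1 \<Longrightarrow> cmod (p z) \<le> D" using polynomial_bounded[OF assms(1)] by auto
  show ?thesis
  proof (rule integrable_bounded)
    show "(\<lambda>z. p z * complex_of_real (f z)) \<in> borel_measurable M"
      using measurable_polynomial[OF assms(1)] f by measurable
    show "cmod (p z * complex_of_real (f z)) \<le> D * B" if "z \<in> sphere 0 1" for z
      unfolding norm_mult using that f(2)[OF that] D[of z] order_trans[OF norm_ge_zero D[of z]]
      by (intro mult_mono) auto
  qed
qed

text \<open>Dilates of p converge to p on the sphere. The estimate at radius r involves the norm of
  p itself rather than that of its dilate, because the radius is absorbed by the energy; it is thus
  uniform as r tends to 1.\<close>

lemma integral_polynomial_le_energy: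
  assumes f: "f \<in> borel_measurable M" "\<And>z. z \<in> sphere 0 1 \<Longrightarrow> \<bar>f z\<bar> \<le> B"
    and E: "\<And>r. 0 \<le> r \<Longrightarrow> r < 1 \<Longrightarrow> weighted_energy f r \<le> E"
    and p: "complex_polynomial p" "restr_ball p \<in> H"
  shows "cmod (\<integral>z. p z * complex_of_real (f z) \<partial>M) \<le> nrm (restr_ball p) * sqrt E"
proof -
  define r where "r n = real n / real (Suc n)" for n
  have r: "0 \<le> r n" "r n < 1" for n unfolding r_def by auto
  have r_lim: "r \<longlonglongrightarrow> 1" unfolding r_def by (rule LIMSEQ_n_over_Suc_n)
  have rz: "r n *\<^sub>R z \<in> ball 0 1" if "norm z = 1" for n z using that r[of n] by simp
  obtain D where D: "\<And>z. norm z \<le> 1 \<Longrightarrow> cmod (p z) \<le> D" using polynomial_bounded[OF p(1)] by auto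
  have "(\<lambda>n. \<integral>z. p (r n *\<^sub>R z) * complex_of_real (f z) \<partial>M) \<longlonglongrightarrow> (\<integral>z. p z * complex_of_real (f z) \<partial>M)"
  proof (rule bounded_convergence(2))
    show "(\<lambda>z. p (r n *\<^sub>R z) * complex_of_real (f z)) \<in> borel_measurable M" for n
    proof (intro borel_measurable_times)
      show "(\<lambda>z. p (r n *\<^sub>R z)) \<in> borel_measurable M"
        by (rule measurable_continuous)
          (auto intro!: continuous_intros continuous_on_compose2[OF continuous_on_complex_polynomial[OF p(1), of UNIV]])
    qed (use f in measurable)
    fix z assume "z \<in> space M"
    then have z: "z \<in> sphere 0 1" by (simp add: space_eq)
    have "(\<lambda>n. p (r n *\<^sub>R z)) \<longlonglongrightarrow> p (1 *\<^sub>R z)"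
      by (rule continuous_on_tendsto_compose[OF continuous_on_complex_polynomial[OF p(1), of UNIV]])
        (intro tendsto_intros r_lim, simp_all)
    then show "(\<lambda>n. p (r n *\<^sub>R z) * complex_of_real (f z)) \<longlonglongrightarrow> p z * complex_of_real (f z)"
      by (intro tendsto_mult tendsto_const) simp
    have "norm (r n *\<^sub>R z) \<le> 1" for n using rz[of z n] z by simp
    then show "cmod (p (r n *\<^sub>R z) * complex_of_real (f z)) \<le> D * B" for n
      unfolding norm_mult using f(2)[OF z] D[of "r n *\<^sub>R z"] order_trans[OF norm_ge_zero D[of "r n *\<^sub>R z"]]
      by (intro mult_mono) auto
  qed
  then have "(\<lambda>n. cmod (\<integral>z. p (r n *\<^sub>R z) * complex_of_real (f z) \<partial>M)) \<longlonglongrightarrow> cmod (\<integral>z. p z * complex_of_real (f z) \<partial>M)"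
    by (intro tendsto_intros)
  then show ?thesis
  proof (rule LIMSEQ_le_const2, intro exI allI impI)
    fix n
    have eq: "(\<integral>z. p (r n *\<^sub>R z) * complex_of_real (f z) \<partial>M) = (\<integral>z. restr_ball p (r n *\<^sub>R z) * complex_of_real (f z) \<partial>M)"
    proof (rule Bochner_Integration.integral_cong[OF refl])
      fix z assume "z \<in> space M"
      then have "r n *\<^sub>R z \<in> ball 0 1" by (intro rz) (simp add: space_eq)
      then show "p (r n *\<^sub>R z) * complex_of_real (f z) = restr_ball p (r n *\<^sub>R z) * complex_of_real (f z)"
        by (simp only: restr_ball_def if_True)
    qed
    have "continuous_on (ball 0 1) (restr_ball p)"
      using continuous_on_cong[of "ball 0 1" "ball 0 1" "restr_ball p" p]
        continuous_on_complex_polynomial[OF p(1)] by (auto simp: restr_ball_def)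
    then have "cmod (\<integral>z. p (r n *\<^sub>R z) * complex_of_real (f z) \<partial>M) \<le> nrm (restr_ball p) * sqrt (weighted_energy f (r n))"
      unfolding eq by (intro integral_le_energy[where B = B] f r p)
    also have "\<dots> \<le> nrm (restr_ball p) * sqrt E"
      using E[OF r] nrm_nonneg[OF p(2)] by (intro mult_left_mono) auto
    finally show "cmod (\<integral>z. p (r n *\<^sub>R z) * complex_of_real (f z) \<partial>M) \<le> nrm (restr_ball p) * sqrt E" .
  qed
qed

text \<open>
  By minimizing the norm among the averages of the tails of \<open>p\<close> (encoded by the pointwise bounds below),
  weak convergence to 0 is turned into norm convergence.
\<close>

lemma integral_polynomial_tendsto_zero:
  assumes f: "f \<in> borel_measurable M" "\<And>z. z \<in> sphere 0 1 \<Longrightarrow> \<bar>f z\<bar> \<le> B"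
    and E: "\<And>r. 0 \<le> r \<Longrightarrow> r < 1 \<Longrightarrow> weighted_energy f r \<le> E"
    and p: "\<And>n. complex_polynomial (p n)" "\<And>n. restr_ball (p n) \<in> H" "\<And>n. nrm (restr_ball (p n)) \<le> C"
    and lim: "\<And>z. z \<in> ball 0 1 \<Longrightarrow> (\<lambda>n. p n z) \<longlonglongrightarrow> 0"
  shows "(\<lambda>n. \<integral>z. p n z * complex_of_real (f z) \<partial>M) \<longlonglongrightarrow> 0"
proof (rule ccontr)
  define I where "I q = (\<integral>z. q z * complex_of_real (f z) \<partial>M)" for q
  assume "\<not> ?thesis"
  then obtain \<epsilon> where \<epsilon>: "\<epsilon> > 0" "\<And>N. \<exists>n\<ge>N. \<epsilon> \<le> cmod (I (p n))"
    unfolding I_def lim_sequentially by (auto simp: not_less)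
  have I_lin: "I (\<lambda>z. a * q z + b * q' z) = a * I q + b * I q'"
    if "complex_polynomial q" "complex_polynomial q'" for a b q q'
    using integrable_polynomial[OF that(1) f] integrable_polynomial[OF that(2) f]
    unfolding I_def by (simp add: distrib_right mult.assoc)
  have R_lin: "restr_ball (\<lambda>z. a * q z + b * q' z) = (\<lambda>z. a * restr_ball q z + b * restr_ball q' z)" for a b q q'
    unfolding restr_ball_def by auto
  \<comment> \<open>Every condition is convex in q. The last one lets q inherit each pointwise bound
    valid for the whole tail from k on, so members of \<open>S k\<close> become small on the ball as
    k grows.\<close>
  define S where "S k = {q. complex_polynomial q \<and> restr_ball q \<in> H \<and> nrm (restr_ball q) \<le> C \<and> \<epsilon> \<le> Re (I q)
    \<and> (\<forall>z\<in>ball 0 1. \<forall>b. (\<forall>n\<ge>k. cmod (p n z) \<le> b) \<longrightarrow> cmod (q z) \<le> b)}" for k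
  define mid where "mid q q' = (\<lambda>z. 1/2 * q z + 1/2 * q' z)" for q q' :: "complex ^ 'd \<Rightarrow> complex"
  define Q where "Q q = (nrm (restr_ball q))\<^sup>2" for q
  have SE: "\<exists>q. q \<in> S k" for k
  proof -
    obtain n where n: "n \<ge> k" "\<epsilon> \<le> cmod (I (p n))" using \<epsilon>(2) by blast
    \<comment> \<open>A unimodular factor turns the integral into its absolute value: the lower
      bound has to be imposed on the real part, since a lower bound on the modulus is not preserved
      by midpoints.\<close>
    define u where "u = cnj (I (p n)) / complex_of_real (cmod (I (p n)))"
    have "I (p n) \<noteq> 0" using n(2) \<epsilon>(1) by auto
    then have u: "cmod u = 1" "u * I (p n) = complex_of_real (cmod (I (p n)))"
      unfolding u_def by (auto simp: norm_divide complex_norm_square[symmetric] power2_eq_square mult.commute[of "cnj _"])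
    have eq: "(\<lambda>z. u * p n z) = (\<lambda>z. u * p n z + 0 * p n z)" by simp
    have "(\<lambda>z. u * p n z) \<in> S k"
      unfolding S_def
    proof (intro CollectI conjI)
      show "complex_polynomial (\<lambda>z. u * p n z)"
        by (intro complex_polynomial_mult complex_polynomial_const p)
      have R: "restr_ball (\<lambda>z. u * p n z) = (\<lambda>z. u * restr_ball (p n) z)"
        by (auto simp: restr_ball_def)
      show "restr_ball (\<lambda>z. u * p n z) \<in> H" unfolding R by (intro scale_mem p)
      show "nrm (restr_ball (\<lambda>z. u * p n z)) \<le> C" unfolding R nrm_scale[OF p(2)] using p u by simp
      show "\<epsilon> \<le> Re (I (\<lambda>z. u * p n z))"
        unfolding eq I_lin[OF p(1) p(1)] using u(2) n(2) by simp
      show "\<forall>z\<in>ball 0 1. \<forall>b. (\<forall>n\<ge>k. cmod (p n z) \<le> b) \<longrightarrow> cmod (u * p n z) \<le> b"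
        using n(1) by (simp add: norm_mult u)
    qed
    then show ?thesis by blast
  qed
  have mid_S: "mid q q' \<in> S k" if "q \<in> S k" "q' \<in> S k" for q q' k
    unfolding S_def
  proof (intro CollectI conjI)
    note q = that[unfolded S_def, simplified]
    show "complex_polynomial (mid q q')" unfolding mid_def
      using q by (intro complex_polynomial_add complex_polynomial_mult complex_polynomial_const) auto
    show RH: "restr_ball (mid q q') \<in> H" unfolding mid_def R_lin
      using q by (intro add_mem scale_mem) auto
    have "nrm (restr_ball (mid q q')) \<le> 1/2 * nrm (restr_ball q) + 1/2 * nrm (restr_ball q')"
      unfolding mid_def R_lin using q nrm_triangle[of "\<lambda>z. 1/2 * restr_ball q z" "\<lambda>z. 1/2 * restr_ball q' z"]
        scale_mem[of "restr_ball q" "1/2"] scale_mem[of "restr_ball q'" "1/2"]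
        nrm_scale[of "restr_ball q" "1/2"] nrm_scale[of "restr_ball q'" "1/2"] by simp
    then show "nrm (restr_ball (mid q q')) \<le> C" using q by linarith
    show "\<epsilon> \<le> Re (I (mid q q'))"
      unfolding mid_def using q by (subst I_lin) auto
    show "\<forall>z\<in>ball 0 1. \<forall>b. (\<forall>n\<ge>k. cmod (p n z) \<le> b) \<longrightarrow> cmod (mid q q' z) \<le> b"
    proof (intro ballI allI impI)
      fix z b assume *: "z \<in> ball 0 1" "\<forall>n\<ge>k. cmod (p n z) \<le> b"
      then have "cmod (q z) \<le> b" "cmod (q' z) \<le> b" using q by auto
      moreover have "cmod (mid q q' z) \<le> 1/2 * cmod (q z) + 1/2 * cmod (q' z)"
        unfolding mid_def by (rule order_trans[OF norm_triangle_ineq]) (simp add: norm_mult norm_divide)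
      ultimately show "cmod (mid q q' z) \<le> b" by linarith
    qed
  qed
  obtain x where x: "\<And>k. x k \<in> S k"
    and cauchy: "\<And>e. e > 0 \<Longrightarrow> \<exists>N. \<forall>m\<ge>N. \<forall>n\<ge>N. 2 * Q (x m) + 2 * Q (x n) - 4 * Q (mid (x m) (x n)) < e"
  proof (rule minimizing_sequence[of S mid 0 Q "C\<^sup>2"])
    show "S (Suc k) \<subseteq> S k" for k unfolding S_def by auto
    show "S k \<noteq> {}" for k using SE by blast
    show "\<exists>q\<in>S k. Q q \<le> C\<^sup>2" for k
    proof -
      obtain q where q: "q \<in> S k" using SE by blast
      then have "Q q \<le> C\<^sup>2" unfolding Q_def S_def by (auto intro!: power_mono nrm_nonneg)
      with q show ?thesis by blast
    qed
  qed (use mid_S in \<open>auto simp: Q_def\<close>)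
  have xH: "restr_ball (x k) \<in> H" and x_pol: "complex_polynomial (x k)" and xI: "\<epsilon> \<le> Re (I (x k))" for k
    using x[of k] unfolding S_def by auto
  have "2 * Q (x m) + 2 * Q (x n) - 4 * Q (mid (x m) (x n)) = (nrm (\<lambda>z. restr_ball (x m) z - restr_ball (x n) z))\<^sup>2" for m n
  proof -
    have "restr_ball (mid (x m) (x n)) = (\<lambda>z. 1/2 * (restr_ball (x m) z + restr_ball (x n) z))"
      by (auto simp: mid_def restr_ball_def)
    then have "nrm (restr_ball (mid (x m) (x n))) = 1/2 * nrm (\<lambda>z. restr_ball (x m) z + restr_ball (x n) z)"
      using nrm_scale[OF add_mem[OF xH xH], of "1/2" m n] by simp
    then have "4 * Q (mid (x m) (x n)) = (nrm (\<lambda>z. restr_ball (x m) z + restr_ball (x n) z))\<^sup>2"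
      unfolding Q_def by (simp only: power_mult_distrib) (simp add: power_divide)
    then show ?thesis
      unfolding nrm_add_sq[OF xH xH] nrm_diff_sq[OF xH xH] Q_def by simp
  qed
  note diff = this
  have "\<exists>g\<in>H. (\<lambda>n. nrm (\<lambda>z. restr_ball (x n) z - g z)) \<longlonglongrightarrow> 0"
  proof (rule complete[OF xH])
    fix e :: real assume e: "e > 0"
    obtain N where N: "\<forall>m\<ge>N. \<forall>n\<ge>N. 2 * Q (x m) + 2 * Q (x n) - 4 * Q (mid (x m) (x n)) < e\<^sup>2"
      using cauchy[of "e\<^sup>2"] e by auto
    show "\<exists>N. \<forall>m\<ge>N. \<forall>n\<ge>N. nrm (\<lambda>z. restr_ball (x m) z - restr_ball (x n) z) < e"
      by (rule exI[of _ N]) (use N e diff in \<open>auto intro!: power2_less_imp_less[of _ e]\<close>)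
  qed
  then obtain g where g: "g \<in> H" and g_lim: "(\<lambda>n. nrm (\<lambda>z. restr_ball (x n) z - g z)) \<longlonglongrightarrow> 0" by blast
  have "g z = 0" if z: "z \<in> ball 0 1" for z
  proof -
    have "(\<lambda>n. x n z) \<longlonglongrightarrow> 0"
    proof (rule LIMSEQ_I)
      fix e :: real assume e: "e > 0"
      obtain N where N: "\<And>n. n \<ge> N \<Longrightarrow> cmod (p n z) < e / 2"
        using LIMSEQ_D[OF lim[OF z], of "e/2"] e by auto
      show "\<exists>N. \<forall>n\<ge>N. norm (x n z - 0) < e"
      proof (intro exI[of _ N] allI impI)
        fix n assume n: "n \<ge> N"
        have "\<forall>k\<ge>n. cmod (p k z) \<le> e / 2" using N n by (auto intro: less_imp_le)
        then have "cmod (x n z) \<le> e / 2"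
          using x[of n] z unfolding S_def by blast
        then show "norm (x n z - 0) < e" using e by simp
      qed
    qed
    moreover have "(\<lambda>n. x n z) \<longlonglongrightarrow> g z"
      using nrm_limit_eval[OF xH g g_lim z] z by (simp add: restr_ball_def)
    ultimately show ?thesis by (rule LIMSEQ_unique[rotated])
  qed
  then have "g = (\<lambda>z. 0)" using support[OF g] by (metis ext)
  then have "(\<lambda>n. nrm (restr_ball (x n)) * sqrt E) \<longlonglongrightarrow> 0 * sqrt E"
    using g_lim by (intro tendsto_intros) simp
  \<comment> \<open>The norms tend to 0 because the limit g vanishes, but the energy estimate and
    the lower bound \<epsilon> for the integrals keep them away from 0.\<close>
  moreover have "\<epsilon> \<le> nrm (restr_ball (x n)) * sqrt E" for n
    using integral_polynomial_le_energy[OF f E x_pol xH, of n] xI[of n] complex_Re_le_cmod[of "I (x n)"]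
    unfolding I_def by linarith
  ultimately have "\<epsilon> \<le> 0" by (auto intro: LIMSEQ_le_const)
  with \<epsilon>(1) show False by simp
qed

end

text \<open>The density D of N is merely integrable, whereas \<open>lim\<close> concerns bounded
  densities. Truncating D at height k leaves an error of at most a bound for the \<open>p n\<close>
  times the integral of D - min D k, uniformly in n.\<close>

lemma (in finite_measure) tendsto_zero_absolutely_continuous:
  fixes p :: "nat \<Rightarrow> 'a \<Rightarrow> complex"
  assumes N: "finite_measure N" "sets N = sets M" "absolutely_continuous M N"
    and p: "\<And>n. p n \<in> borel_measurable M" "\<And>n x. x \<in> space M \<Longrightarrow> cmod (p n x) \<le> C"
    and lim: "\<And>f B. f \<in> borel_measurable M \<Longrightarrow> (\<And>x. x \<in> space M \<Longrightarrow> 0 \<le> f x \<and> f x \<le> B) \<Longrightarrow>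
      (\<lambda>n. \<integral>x. p n x * complex_of_real (f x) \<partial>M) \<longlonglongrightarrow> 0"
  shows "(\<lambda>n. \<integral>x. p n x \<partial>N) \<longlonglongrightarrow> 0"
proof -
  obtain D where D: "D \<in> borel_measurable M" "AE x in M. RN_deriv M N x = ennreal (D x)" "\<And>x. 0 \<le> D x"
    using real_RN_deriv[OF N(1,3,2)] by metis
  have dens: "density M (\<lambda>x. ennreal (D x)) = N"
  proof -
    have "density M (\<lambda>x. ennreal (D x)) = density M (RN_deriv M N)"
      using D by (intro density_cong) (auto elim: eventually_mono)
    then show ?thesis using density_RN_deriv[OF N(3,2)] by simp
  qed
  have int_D: "integrable M D"
  proof (rule integrableI_nonneg)
    have "(\<integral>\<^sup>+x. ennreal (D x) \<partial>M) = emeasure N (space M)"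
      using D(1) by (subst dens[symmetric]) (simp add: emeasure_density)
    also have "\<dots> < \<infinity>"
      using finite_measure.emeasure_finite[OF N(1), of "space M"] by (simp add: top.not_eq_extremum)
    finally show "(\<integral>\<^sup>+x. ennreal (D x) \<partial>M) < \<infinity>" .
  qed (use D in auto)
  have C: "C \<ge> 0" if "space M \<noteq> {}"
    using that p(2)[of _ 0] norm_ge_zero order_trans by (metis all_not_in_conv)
  have pN: "(\<integral>x. p n x \<partial>N) = (\<integral>x. p n x * complex_of_real (D x) \<partial>M)" for n
    using D p by (subst dens[symmetric], subst integral_density) (auto simp: scaleR_conv_of_real mult.commute)
  define h where "h k x = min (D x) (real k)" for k :: nat and x
  have h: "h k \<in> borel_measurable M" "0 \<le> h k x" "h k x \<le> D x" "h k x \<le> real k" for k x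
    using D unfolding h_def by auto
  have int_h: "integrable M (h k)" for k
    by (rule Bochner_Integration.integrable_bound[OF int_D]) (use h D in auto)
  have int_p: "integrable M (\<lambda>x. p n x * complex_of_real (g x))" if "integrable M g" for g n
  proof (rule Bochner_Integration.integrable_bound)
    show "integrable M (\<lambda>x. C * g x)" using that by simp
    show "AE x in M. norm (p n x * complex_of_real (g x)) \<le> norm (C * g x)"
      using p(2) C by (intro AE_I2) (auto simp: norm_mult abs_mult intro!: mult_right_mono order_trans[OF p(2) abs_ge_self])
  qed (use p that in measurable)
  have tail: "(\<lambda>k. \<integral>x. D x - h k x \<partial>M) \<longlonglongrightarrow> (\<integral>x. 0 \<partial>M)"
  proof (rule integral_dominated_convergence[where w = D])
    show "AE x in M. (\<lambda>k. D x - h k x) \<longlonglongrightarrow> 0"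
    proof (intro AE_I2 tendsto_eventually)
      fix x
      obtain K where "D x \<le> real K" using real_arch_simple by blast
      then show "\<forall>\<^sub>F k in sequentially. D x - h k x = 0"
        unfolding eventually_sequentially h_def by (intro exI[of _ K]) auto
    qed
  qed (use D h int_D in auto)
  show ?thesis
  proof (rule LIMSEQ_I)
    fix e :: real assume e: "e > 0"
    define C' where "C' = max C 1"
    obtain k where k: "\<bar>\<integral>x. D x - h k x \<partial>M\<bar> < e / (2 * C')"
      using LIMSEQ_D[OF tail, of "e / (2 * C')"] e by (auto simp: C'_def)
    have "(\<lambda>n. \<integral>x. p n x * complex_of_real (h k x) \<partial>M) \<longlonglongrightarrow> 0"
      using h by (intro lim[of _ "real k"]) auto
    from LIMSEQ_D[OF this, of "e/2"] e
    obtain N0 where N0: "\<And>n. n \<ge> N0 \<Longrightarrow> cmod (\<integral>x. p n x * complex_of_real (h k x) \<partial>M) < e / 2"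
      by auto
    show "\<exists>n0. \<forall>n\<ge>n0. norm ((\<integral>x. p n x \<partial>N) - 0) < e"
    proof (intro exI[of _ N0] allI impI)
      fix n assume n: "n \<ge> N0"
      have "(\<integral>x. p n x \<partial>N) = (\<integral>x. p n x * complex_of_real (h k x) \<partial>M)
          + (\<integral>x. p n x * complex_of_real (D x - h k x) \<partial>M)"
        unfolding pN using int_p[OF int_D, of n] int_p[OF int_h, of n k] by (simp add: right_diff_distrib)
      moreover have "cmod (\<integral>x. p n x * complex_of_real (D x - h k x) \<partial>M) \<le> C' * (\<integral>x. D x - h k x \<partial>M)"
      proof -
        have "cmod (\<integral>x. p n x * complex_of_real (D x - h k x) \<partial>M) \<le> (\<integral>x. cmod (p n x * complex_of_real (D x - h k x)) \<partial>M)"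
          by (rule integral_norm_bound)
        also have "\<dots> \<le> (\<integral>x. C' * (D x - h k x) \<partial>M)"
        proof (rule integral_mono)
          show "integrable M (\<lambda>x. cmod (p n x * complex_of_real (D x - h k x)))"
            using int_D int_h by (intro integrable_norm int_p) auto
          show "integrable M (\<lambda>x. C' * (D x - h k x))" using int_D int_h by auto
          fix x assume "x \<in> space M"
          then have "cmod (p n x) \<le> C'" using p(2)[of x n] by (simp add: C'_def)
          then show "cmod (p n x * complex_of_real (D x - h k x)) \<le> C' * (D x - h k x)"
            unfolding norm_mult using h(3)[of k x] by (simp add: mult_right_mono del: of_real_diff)
        qed
        finally show ?thesis by simp
      qed
      moreover have "C' * (\<integral>x. D x - h k x \<partial>M) < e / 2"
      proof -
        have "C' * (\<integral>x. D x - h k x \<partial>M) < C' * (e / (2 * C'))"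
          using k by (intro mult_strict_left_mono) (auto simp: C'_def)
        also have "\<dots> = e / 2" by (simp add: C'_def)
        finally show ?thesis .
      qed
      ultimately show "norm ((\<integral>x. p n x \<partial>N) - 0) < e"
        using N0[OF n] norm_triangle_ineq[of "\<integral>x. p n x * complex_of_real (h k x) \<partial>M" "\<integral>x. p n x * complex_of_real (D x - h k x) \<partial>M"]
        by simp
    qed
  qed
qed

section \<open>Complex measures\<close>

locale signed_measure =
  fixes M :: "'a measure" and s :: "'a set \<Rightarrow> real"
  assumes sums: "range A \<subseteq> sets M \<Longrightarrow> disjoint_family A \<Longrightarrow> (\<lambda>n. s (A n)) sums s (\<Union>n :: nat. A n)"
begin

text \<open>Additivity along the constant sequence of empty sets: a convergent series with constant
  terms has terms 0.\<close>

lemma empty: "s {} = 0"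
proof -
  have "(\<lambda>n :: nat. s {}) sums s (\<Union>n :: nat. {})"
    by (rule sums) (auto simp: disjoint_family_on_def)
  then have "(\<lambda>n :: nat. s {}) \<longlonglongrightarrow> 0"
    by (intro summable_LIMSEQ_zero sums_summable)
  then show ?thesis by (simp add: LIMSEQ_const_iff)
qed

lemma Un: "A \<in> sets M \<Longrightarrow> B \<in> sets M \<Longrightarrow> A \<inter> B = {} \<Longrightarrow> s (A \<union> B) = s A + s B"
proof -
  assume AB: "A \<in> sets M" "B \<in> sets M" "A \<inter> B = {}"
  have "(\<lambda>n. s (binaryset A B n)) sums s (\<Union>n. binaryset A B n)"
    using AB by (intro sums) (auto simp: disjoint_family_on_def binaryset_def)
  moreover have "(\<lambda>n. s (binaryset A B n)) sums (s A + s B)"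
    by (rule binaryset_sums) (rule empty)
  ultimately show ?thesis by (simp add: UN_binaryset_eq sums_unique2)
qed

lemma Diff: "A \<in> sets M \<Longrightarrow> B \<in> sets M \<Longrightarrow> B \<subseteq> A \<Longrightarrow> s (A - B) = s A - s B"
  using Un[of "A - B" B] by (simp add: Un_absorb2 Diff_disjoint inf_commute Un_Diff_cancel2)

text \<open>
  An unbounded set splits into an unbounded one and one of measure at least 1 in absolute value;
  iterating, the second parts are disjoint, which contradicts additivity.
\<close>

lemma bounded: "\<exists>C. \<forall>B\<in>sets M. \<bar>s B\<bar> \<le> C"
proof (rule ccontr)
  define unb where "unb E \<longleftrightarrow> E \<in> sets M \<and> (\<forall>C. \<exists>B\<in>sets M. B \<subseteq> E \<and> C < \<bar>s B\<bar>)" for E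
  assume "\<not> ?thesis"
  then have top: "unb (space M)"
    unfolding unb_def by (meson not_le sets.sets_into_space sets.top)
  have step: "\<exists>F. unb F \<and> F \<subseteq> E \<and> 1 \<le> \<bar>s (E - F)\<bar>" if E: "unb E" for E
  proof -
    have ES: "E \<in> sets M" using E by (simp add: unb_def)
    \<comment> \<open>The margin |s E| makes both B and its complement in E have measure at least 1
      in absolute value, so that whichever of the two is unbounded, the other one can be split
      off.\<close>
    obtain B where B: "B \<in> sets M" "B \<subseteq> E" "1 + \<bar>s E\<bar> < \<bar>s B\<bar>"
      using E unfolding unb_def by blast
    have EB: "E - B \<in> sets M" using ES B by auto
    have sEB: "1 \<le> \<bar>s (E - B)\<bar>" using Diff[OF ES B(1,2)] B(3) by linarith
    have "unb B \<or> unb (E - B)"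
    proof (rule ccontr)
      assume "\<not> ?thesis"
      then have nu: "\<not> unb B" "\<not> unb (E - B)" by auto
      obtain C1 where C1: "\<And>A. A \<in> sets M \<Longrightarrow> A \<subseteq> B \<Longrightarrow> \<bar>s A\<bar> \<le> C1"
        using nu(1) B(1) unfolding unb_def by (meson not_less)
      obtain C2 where C2: "\<And>A. A \<in> sets M \<Longrightarrow> A \<subseteq> E - B \<Longrightarrow> \<bar>s A\<bar> \<le> C2"
        using nu(2) EB unfolding unb_def by (meson not_less)
      obtain A where A: "A \<in> sets M" "A \<subseteq> E" "C1 + C2 < \<bar>s A\<bar>"
        using E unfolding unb_def by blast
      have "s A = s (A \<inter> B) + s (A - B)"
        using Un[of "A \<inter> B" "A - B"] A B by (simp add: Int_Diff_Un Int_Diff_disjoint)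
      moreover have "\<bar>s (A \<inter> B)\<bar> \<le> C1" "\<bar>s (A - B)\<bar> \<le> C2"
        using A B by (auto intro!: C1 C2)
      ultimately show False using A(3) by linarith
    qed
    then show ?thesis
    proof
      assume "unb B"
      then show ?thesis using B sEB by blast
    next
      assume "unb (E - B)"
      moreover have "E - (E - B) = B" using B by auto
      ultimately show ?thesis using B by (intro exI[of _ "E - B"]) auto
    qed
  qed
  have "\<exists>F. \<forall>n. unb (F n) \<and> (F (Suc n) \<subseteq> F n \<and> 1 \<le> \<bar>s (F n - F (Suc n))\<bar>)"
    by (rule dependent_nat_choice) (use top step in blast)+
  then obtain F where F: "\<And>n. unb (F n)" "\<And>n. F (Suc n) \<subseteq> F n" "\<And>n. 1 \<le> \<bar>s (F n - F (Suc n))\<bar>"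
    by blast
  have anti: "F n \<subseteq> F m" if "m \<le> n" for m n
    using lift_Suc_antimono_le[of F] F(2) that by blast
  have "disjoint_family (\<lambda>n. F n - F (Suc n))"
    unfolding disjoint_family_on_def
  proof (intro ballI impI)
    fix m n :: nat assume "m \<noteq> n"
    then consider "Suc m \<le> n" | "Suc n \<le> m" by linarith
    then show "(F m - F (Suc m)) \<inter> (F n - F (Suc n)) = {}"
      by cases (use anti in blast)+
  qed
  then have "(\<lambda>n. s (F n - F (Suc n))) sums s (\<Union>n. F n - F (Suc n))"
    using F(1) by (intro sums) (auto simp: unb_def)
  then have "(\<lambda>n. s (F n - F (Suc n))) \<longlonglongrightarrow> 0"
    by (intro summable_LIMSEQ_zero sums_summable)
  then obtain n where "\<bar>s (F n - F (Suc n))\<bar> < 1"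
    using LIMSEQ_D[of _ 0 1] by fastforce
  with F(3)[of n] show False by linarith
qed

text \<open>The set function inside \<open>positive_variation\<close>. As \<open>measure_of\<close>
  yields the zero measure unless its argument is countably additive, nothing about
  \<open>positive_variation\<close> can be read off before
  \<open>pos_var_countably_additive\<close>.\<close>

definition pos_var :: "'a set \<Rightarrow> ennreal"
  where "pos_var A = (SUP B\<in>{B \<in> sets M. B \<subseteq> A}. ennreal (s B))"

lemma pos_var_le: "(\<And>B. B \<in> sets M \<Longrightarrow> B \<subseteq> A \<Longrightarrow> s B \<le> c) \<Longrightarrow> pos_var A \<le> ennreal c"
  unfolding pos_var_def by (auto intro!: SUP_least ennreal_leI)

lemma le_pos_var: "B \<in> sets M \<Longrightarrow> B \<subseteq> A \<Longrightarrow> ennreal (s B) \<le> pos_var A"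
  unfolding pos_var_def by (auto intro: SUP_upper)

text \<open>Subsets of A and of B combine to a subset of the union. If one of them has negative
  measure, \<open>ennreal\<close> truncates it to 0 and the other subset alone is enough.\<close>

lemma pos_var_add:
  assumes A: "A \<in> sets M" "B \<in> sets M" "A \<inter> B = {}"
  shows "pos_var A + pos_var B \<le> pos_var (A \<union> B)"
proof -
  have ne: "{C \<in> sets M. C \<subseteq> A} \<noteq> {}" for A :: "'a set" by auto
  have key: "ennreal (s C) + ennreal (s D) \<le> pos_var (A \<union> B)"
    if C: "C \<in> sets M" "C \<subseteq> A" and D: "D \<in> sets M" "D \<subseteq> B" for C D
  proof (cases "0 \<le> s C \<and> 0 \<le> s D")
    case True
    then have "ennreal (s C) + ennreal (s D) = ennreal (s (C \<union> D))"
      using Un[of C D] C D A(3) by (subst Un) auto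
    also have "\<dots> \<le> pos_var (A \<union> B)" using C D by (intro le_pos_var) auto
    finally show ?thesis .
  next
    case False
    then have "ennreal (s C) = 0 \<or> ennreal (s D) = 0" by (auto simp: ennreal_neg)
    then show ?thesis
      using le_pos_var[OF C(1) le_supI1[OF C(2)], of B] le_pos_var[OF D(1) le_supI2[OF D(2)], of A] by auto
  qed
  have "ennreal (s C) + pos_var B \<le> pos_var (A \<union> B)" if "C \<in> sets M" "C \<subseteq> A" for C
    unfolding pos_var_def[of B] ennreal_SUP_add_right[OF ne]
    using key that by (auto intro!: SUP_least)
  then show ?thesis
    unfolding pos_var_def[of A] ennreal_SUP_add_left[OF ne, symmetric]
    by (auto intro!: SUP_least)
qed

text \<open>One inequality is finite superadditivity with monotonicity. For the other, a set B in
  the union is cut into its traces on the \<open>A i\<close>: its measure is the sum of theirs, and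
  truncating the summands at 0 only increases the sum.\<close>

lemma pos_var_countably_additive: "countably_additive (sets M) pos_var"
  unfolding countably_additive_def
proof (intro allI impI)
  fix A :: "nat \<Rightarrow> 'a set"
  assume A: "range A \<subseteq> sets M" "disjoint_family A" "(\<Union>i. A i) \<in> sets M"
  show "(\<Sum>i. pos_var (A i)) = pos_var (\<Union>i. A i)"
  proof (rule antisym)
    have fin: "(\<Sum>i<n. pos_var (A i)) \<le> pos_var (\<Union>i<n. A i)" for n
    proof (induction n)
      case (Suc n)
      have "A i \<inter> A n = {}" if "i < n" for i
        using disjoint_family_onD[OF A(2), of i n] that by simp
      then have "(\<Union>i<n. A i) \<inter> A n = {}" by auto
      moreover have "(\<Union>i<Suc n. A i) = (\<Union>i<n. A i) \<union> A n" by (auto simp: less_Suc_eq)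
      moreover have "(\<Union>i<n. A i) \<in> sets M" "A n \<in> sets M" using A by auto
      ultimately have "pos_var (\<Union>i<n. A i) + pos_var (A n) \<le> pos_var (\<Union>i<Suc n. A i)"
        using pos_var_add by simp
      then show ?case
        unfolding sum.lessThan_Suc by (rule order_trans[OF add_right_mono[OF Suc]])
    qed simp
    have mono: "pos_var (\<Union>i<n. A i) \<le> pos_var (\<Union>i. A i)" for n
      unfolding pos_var_def by (rule SUP_subset_mono) auto
    show "(\<Sum>i. pos_var (A i)) \<le> pos_var (\<Union>i. A i)"
      by (rule suminf_le_const) (auto intro: order_trans[OF fin mono])
  next
    have fin: "ennreal (\<Sum>i<n. f i) \<le> (\<Sum>i<n. ennreal (f i))" for n and f :: "nat \<Rightarrow> real"
    proof (induction n)
      case (Suc n)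
      have "ennreal (a + b) \<le> ennreal a + ennreal b" for a b
      proof (cases "0 \<le> a \<and> 0 \<le> b")
        case False
        then have "ennreal (a + b) \<le> ennreal a \<or> ennreal (a + b) \<le> ennreal b"
          by (auto intro!: ennreal_leI)
        then show ?thesis by (auto intro: add_increasing add_increasing2)
      qed simp
      then have "ennreal (\<Sum>i<Suc n. f i) \<le> ennreal (\<Sum>i<n. f i) + ennreal (f n)" by simp
      also have "\<dots> \<le> (\<Sum>i<n. ennreal (f i)) + ennreal (f n)" by (intro add_right_mono Suc)
      finally show ?case by simp
    qed simp
    show "pos_var (\<Union>i. A i) \<le> (\<Sum>i. pos_var (A i))"
      unfolding pos_var_def[of "\<Union>i. A i"]
    proof (rule SUP_least, clarify)
      fix B assume B: "B \<in> sets M" "B \<subseteq> (\<Union>i. A i)"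
      have "(\<lambda>i. s (B \<inter> A i)) sums s (\<Union>i. B \<inter> A i)"
        using A B by (intro sums) (auto simp: disjoint_family_on_def)
      also have "(\<Union>i. B \<inter> A i) = B" using B by auto
      finally have "(\<lambda>n. ennreal (\<Sum>i<n. s (B \<inter> A i))) \<longlonglongrightarrow> ennreal (s B)"
        unfolding sums_def by (rule tendsto_ennrealI)
      then show "ennreal (s B) \<le> (\<Sum>i. pos_var (A i))"
      proof (rule LIMSEQ_le_const2, intro exI allI impI)
        fix n
        have "ennreal (\<Sum>i<n. s (B \<inter> A i)) \<le> (\<Sum>i<n. ennreal (s (B \<inter> A i)))" by (rule fin)
        also have "\<dots> \<le> (\<Sum>i<n. pos_var (A i))" using A B by (intro sum_mono le_pos_var) auto
        also have "\<dots> \<le> (\<Sum>i. pos_var (A i))" by (intro sum_le_suminf) auto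
        finally show "ennreal (\<Sum>i<n. s (B \<inter> A i)) \<le> (\<Sum>i. pos_var (A i))" .
      qed
    qed
  qed
qed

lemma sets_positive_variation: "sets (positive_variation M s) = sets M"
  and space_positive_variation: "space (positive_variation M s) = space M"
  unfolding positive_variation_def by (auto simp: sets.space_closed sets.sigma_sets_eq)

lemma emeasure_positive_variation:
  assumes "A \<in> sets M"
  shows "emeasure (positive_variation M s) A = pos_var A"
proof -
  have "positive (sets M) pos_var"
    unfolding positive_def pos_var_def by (auto simp: empty)
  then show ?thesis
    unfolding positive_variation_def pos_var_def[abs_def, symmetric]
    using assms pos_var_countably_additive
    by (intro emeasure_measure_of_sigma sets.sigma_algebra_axioms) auto
qed

lemma finite_measure_positive_variation: "finite_measure (positive_variation M s)"
proof
  obtain C where C: "\<And>B. B \<in> sets M \<Longrightarrow> \<bar>s B\<bar> \<le> C" using bounded by blast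
  have "pos_var (space M) \<le> ennreal C" using C by (intro pos_var_le) (auto simp: abs_le_iff)
  then show "emeasure (positive_variation M s) (space (positive_variation M s)) \<noteq> \<infinity>"
    by (auto simp: space_positive_variation emeasure_positive_variation top_unique)
qed

lemma measure_positive_variation_le:
  assumes "A \<in> sets M" "\<And>B. B \<in> sets M \<Longrightarrow> B \<subseteq> A \<Longrightarrow> s B \<le> c"
  shows "measure (positive_variation M s) A \<le> c"
proof -
  have "0 \<le> c" using assms(2)[of "{}"] empty by simp
  then show ?thesis
    using enn2real_mono[OF pos_var_le[OF assms(2)]] unfolding measure_def emeasure_positive_variation[OF assms(1)]
    by auto
qed

lemma le_measure_positive_variation:
  assumes "A \<in> sets M" "B \<in> sets M" "B \<subseteq> A"
  shows "s B \<le> measure (positive_variation M s) A"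
proof -
  interpret P: finite_measure "positive_variation M s" by (rule finite_measure_positive_variation)
  have "ennreal (s B) \<le> ennreal (measure (positive_variation M s) A)"
    using le_pos_var[OF assms(2,3)] emeasure_positive_variation[OF assms(1)] by (simp add: P.emeasure_eq_measure)
  then show ?thesis by (simp add: ennreal_le_iff)
qed

lemma uminus: "signed_measure M (\<lambda>A. - s A)"
  by unfold_locales (intro sums_minus sums)

text \<open>Taking complements in A: - s B = s (A - B) - s A for B \<subseteq> A. Bounding s (A - B)
  by the positive variation of A gives one inequality, and the same argument for -s the
  other.\<close>

lemma Jordan:
  assumes A: "A \<in> sets M"
  shows "s A = measure (positive_variation M s) A - measure (positive_variation M (\<lambda>A. - s A)) A"
proof -
  interpret N: signed_measure M "\<lambda>A. - s A" by (rule uminus)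
  have "measure (positive_variation M (\<lambda>A. - s A)) A \<le> measure (positive_variation M s) A - s A"
  proof (rule N.measure_positive_variation_le[OF A])
    fix B assume B: "B \<in> sets M" "B \<subseteq> A"
    have "s (A - B) \<le> measure (positive_variation M s) A"
      using A B by (intro le_measure_positive_variation) auto
    then show "- s B \<le> measure (positive_variation M s) A - s A" using Diff[OF A B] by simp
  qed
  moreover have "measure (positive_variation M s) A \<le> measure (positive_variation M (\<lambda>A. - s A)) A + s A"
  proof (rule measure_positive_variation_le[OF A])
    fix B assume B: "B \<in> sets M" "B \<subseteq> A"
    have "- s (A - B) \<le> measure (positive_variation M (\<lambda>A. - s A)) A"
      using A B by (intro N.le_measure_positive_variation) auto
    then show "s B \<le> measure (positive_variation M (\<lambda>A. - s A)) A + s A" using Diff[OF A B] by simp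
  qed
  ultimately show ?thesis by simp
qed

lemma positive_variation_null:
  assumes "A \<in> sets M" "\<And>B. B \<in> sets M \<Longrightarrow> B \<subseteq> A \<Longrightarrow> s B = 0"
  shows "emeasure (positive_variation M s) A = 0"
  using pos_var_le[of A 0] assms by (simp add: emeasure_positive_variation)

end

lemma complex_measure_Re: "complex_measure M m \<Longrightarrow> signed_measure M (\<lambda>A. Re (m A))"
  unfolding complex_measure_def signed_measure_def by (auto intro: sums_Re)

lemma complex_measure_Im: "complex_measure M m \<Longrightarrow> signed_measure M (\<lambda>A. Im (m A))"
  unfolding complex_measure_def signed_measure_def by (auto intro: sums_Im)

section \<open>The four Jordan parts of a complex measure and a dominating measure\<close>

locale complex_measure_on =
  fixes M :: "'a measure" and m :: "'a set \<Rightarrow> complex"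
  assumes complex_measure: "complex_measure M m"
begin

text \<open>Indexing by numbers makes the four variations one family. All indices from 3 on give the
  same set function, so each \<open>part j\<close> is a signed measure without a restriction on
  j.\<close>

definition part :: "nat \<Rightarrow> 'a set \<Rightarrow> real"
  where "part j A = (if j = 0 then Re (m A) else if j = 1 then - Re (m A)
    else if j = 2 then Im (m A) else - Im (m A))"

definition var :: "nat \<Rightarrow> 'a measure"
  where "var j = positive_variation M (part j)"

lemma part_cases: "part 0 = (\<lambda>A. Re (m A))" "part 1 = (\<lambda>A. - Re (m A))"
  "part 2 = (\<lambda>A. Im (m A))" "part 3 = (\<lambda>A. - Im (m A))"
  by (auto simp: part_def)

sublocale part: signed_measure M "part j" for j
proof -
  interpret R: signed_measure M "\<lambda>A. Re (m A)" by (rule complex_measure_Re[OF complex_measure])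
  interpret I: signed_measure M "\<lambda>A. Im (m A)" by (rule complex_measure_Im[OF complex_measure])
  have "part j \<in> {part 0, part 1, part 2, part 3}"
    by (auto simp: part_def fun_eq_iff)
  then show "signed_measure M (part j)"
    using R.signed_measure_axioms I.signed_measure_axioms R.uminus I.uminus
    unfolding part_cases by auto
qed

sublocale var: finite_measure "var j" for j
  unfolding var_def by (rule part.finite_measure_positive_variation)

lemma sets_var [simp]: "sets (var j) = sets M" and space_var [simp]: "space (var j) = space M"
  unfolding var_def by (rule part.sets_positive_variation part.space_positive_variation)+

lemma integral_var:
  "complex_measure_integral M m f =
    ((\<integral>x. f x \<partial>var 0) - (\<integral>x. f x \<partial>var 1)) + \<i> * ((\<integral>x. f x \<partial>var 2) - (\<integral>x. f x \<partial>var 3))"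
  unfolding complex_measure_integral_def real_measure_integral_def var_def part_cases by simp

lemma measure_var:
  assumes "A \<in> sets M"
  shows "m A = Complex (measure (var 0) A - measure (var 1) A) (measure (var 2) A - measure (var 3) A)"
  using part.Jordan[OF assms, of 0] part.Jordan[OF assms, of 2]
  unfolding var_def part_cases by (simp add: complex_eq_iff)

lemma integral_indicator:
  assumes "A \<in> sets M"
  shows "complex_measure_integral M m (\<lambda>x. complex_of_real (indicator A x)) = m A"
  unfolding integral_var measure_var[OF assms] using assms
  by (simp add: complex_eq_iff)

lemma var_null:
  assumes "A \<in> sets M" "\<And>B. B \<in> sets M \<Longrightarrow> B \<subseteq> A \<Longrightarrow> m B = 0"
  shows "emeasure (var j) A = 0"
  unfolding var_def by (rule part.positive_variation_null) (use assms in \<open>auto simp: part_def\<close>)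

text \<open>A finite measure comparable with the total variation: it dominates
  \<open>cmod (m A)\<close>, and it vanishes on A as soon as m vanishes on all measurable subsets of
  A.\<close>

definition total :: "'a measure"
  where "total = measure_of (space M) (sets M) (\<lambda>A. \<Sum>j<4. emeasure (var j) A)"

lemma sets_total [simp]: "sets total = sets M" and space_total [simp]: "space total = space M"
  unfolding total_def by (auto simp: sets.space_closed sets.sigma_sets_eq)

lemma emeasure_total:
  assumes "A \<in> sets M"
  shows "emeasure total A = (\<Sum>j<4. emeasure (var j) A)"
proof -
  have "countably_additive (sets M) (\<lambda>A. \<Sum>j<4. emeasure (var j) A)"
    unfolding countably_additive_def
    by (auto simp: suminf_sum suminf_emeasure)
  moreover have "positive (sets M) (\<lambda>A. \<Sum>j<4. emeasure (var j) A)"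
    by (auto simp: positive_def)
  ultimately show ?thesis
    unfolding total_def using assms
    by (intro emeasure_measure_of_sigma sets.sigma_algebra_axioms) auto
qed

sublocale total: finite_measure total
  by (rule finite_measureI) (simp add: emeasure_total)

lemma total_null:
  assumes "A \<in> sets M" "\<And>B. B \<in> sets M \<Longrightarrow> B \<subseteq> A \<Longrightarrow> m B = 0"
  shows "emeasure total A = 0"
  using assms(1) by (simp add: emeasure_total var_null[OF assms])

lemma var_le_total: "A \<in> sets M \<Longrightarrow> j < 4 \<Longrightarrow> emeasure (var j) A \<le> emeasure total A"
  using member_le_sum[of j "{..<4}" "\<lambda>j. emeasure (var j) A"] by (simp add: emeasure_total)

lemma AE_var:
  assumes "AE x in total. P x" "j < 4"
  shows "AE x in var j. P x"
proof -
  obtain N where N: "{x \<in> space M. \<not> P x} \<subseteq> N" "emeasure total N = 0" "N \<in> sets M"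
    using assms(1) by (auto elim!: AE_E)
  then have "emeasure (var j) N = 0" using var_le_total[of N j] assms(2) by simp
  with N show ?thesis by (intro AE_I[of _ _ N]) auto
qed

lemma norm_measure_le:
  assumes A: "A \<in> sets M"
  shows "cmod (m A) \<le> measure total A"
proof -
  have "measure total A = (\<Sum>j<4. measure (var j) A)"
    using emeasure_total[OF A]
    by (intro measure_eq_emeasure_eq_ennreal) (auto simp: var.emeasure_eq_measure sum_nonneg)
  then have "measure total A = measure (var 0) A + measure (var 1) A + measure (var 2) A + measure (var 3) A"
    by (simp add: eval_nat_numeral)
  moreover have "cmod (m A) \<le> \<bar>measure (var 0) A - measure (var 1) A\<bar> + \<bar>measure (var 2) A - measure (var 3) A\<bar>"
    using cmod_le[of "m A"] unfolding measure_var[OF A] by simp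
  ultimately show ?thesis
    using measure_nonneg[of "var 0" A] measure_nonneg[of "var 1" A]
      measure_nonneg[of "var 2" A] measure_nonneg[of "var 3" A] by linarith
qed

lemma integral_convergence:
  assumes u: "\<And>k. u k \<in> borel_measurable M" and v: "v \<in> borel_measurable M"
    and lim: "AE x in total. (\<lambda>k. u k x) \<longlonglongrightarrow> v x"
    and bound: "\<And>k x. x \<in> space M \<Longrightarrow> cmod (u k x) \<le> C"
  shows "(\<lambda>k. complex_measure_integral M m (u k)) \<longlonglongrightarrow> complex_measure_integral M m v"
proof -
  have "(\<lambda>k. \<integral>x. u k x \<partial>var j) \<longlonglongrightarrow> (\<integral>x. v x \<partial>var j)" if "j < 4" for j
  proof (rule integral_dominated_convergence[where w = "\<lambda>_. C"])
    show "AE x in var j. (\<lambda>k. u k x) \<longlonglongrightarrow> v x" by (rule AE_var[OF lim that])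
    show "AE x in var j. norm (u k x) \<le> C" for k using bound by (intro AE_I2) auto
  qed (use u v in \<open>auto simp: measurable_cong_sets[OF sets_var refl]\<close>)
  then show ?thesis unfolding integral_var by (intro tendsto_intros) auto
qed

end

section \<open>Measures of finite energy are Henkin\<close>

context sphere_measure
begin

lemma potential_const: "potential (\<lambda>_. B) w = B * potential (\<lambda>_. 1) w"
  unfolding potential_def by (simp add: mult.commute)

lemma weighted_energy_const: "weighted_energy (\<lambda>_. B) r = B\<^sup>2 * weighted_energy (\<lambda>_. 1) r"
  unfolding weighted_energy_def by (subst potential_const) (simp add: power2_eq_square mult.assoc)

text \<open>In \<open>energy\<close> the inner integral runs over the second argument of the kernel,
  in \<open>potential\<close> over the first; exchanging the arguments is conjugation, which
  preserves the real part.\<close>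

lemma Re_da_kernel_swap: "Re (da_kernel (r *\<^sub>R z) (r *\<^sub>R w)) = Re (da_kernel w (r\<^sup>2 *\<^sub>R z))"
proof -
  have "da_kernel (r *\<^sub>R w) (r *\<^sub>R z) = da_kernel w (r\<^sup>2 *\<^sub>R z)"
    unfolding da_kernel_scaleR power2_eq_square ..
  then show ?thesis using cnj_da_kernel[of "r *\<^sub>R w" "r *\<^sub>R z"] by (metis cnj.sel(1))
qed

lemma energy_eq: "energy M = (SUP r\<in>{0..<1}. ereal (weighted_energy (\<lambda>_. 1) r))"
  unfolding energy_def weighted_energy_def potential_def Re_da_kernel_swap by simp

end

context drury_arveson
begin

lemma nrm_kf_pos: "w \<in> ball 0 1 \<Longrightarrow> 0 < nrm (kf w)"
proof -
  assume w: "w \<in> ball 0 1"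
  then have "0 < (nrm (kf w))\<^sup>2"
    using nrm_kf[OF w] Re_da_kernel_gt[of w w] by simp
  then show ?thesis using nrm_nonneg[OF kernel_mem[OF w]] by (simp add: zero_less_power2)
qed

lemma da_kernel_zero: "da_kernel z 0 = 1"
  by (simp add: da_kernel_hip hip_def)

text \<open>The constant 1 is the kernel function \<open>kf 0\<close>, of norm 1, so that
  \<open>restr_ball p\<close> is p applied as a multiplier to a unit vector.\<close>

lemma bounded_mult_restr_ball:
  assumes "bounded_mult C p"
  shows "restr_ball p \<in> H" "nrm (restr_ball p) \<le> C"
proof -
  have 0: "0 \<in> ball (0 :: complex ^ 'd) 1" by simp
  have eq: "restr_ball p = (\<lambda>z. p z * kf 0 z)"
    by (auto simp: restr_ball_def da_kernel_zero)
  have "(nrm (kf 0))\<^sup>2 = 1" using nrm_kf[OF 0] by (simp add: da_kernel_zero)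
  then have "nrm (kf 0) = 1" using nrm_kf_pos[OF 0] by (simp add: power2_eq_1_iff)
  then show "restr_ball p \<in> H" "nrm (restr_ball p) \<le> C"
    unfolding eq using bounded_multD[OF assms kernel_mem[OF 0]] by auto
qed

text \<open>The sup norm bound on the open ball from \<open>bounded_mult_eval\<close> extends to the
  sphere by continuity of p.\<close>

lemma bounded_mult_polynomial_le:
  assumes b: "bounded_mult C p" and p: "complex_polynomial p" and z: "norm z \<le> 1"
  shows "cmod (p z) \<le> C"
proof -
  have "closed {z. cmod (p z) \<le> C}"
    by (intro closed_Collect_le continuous_intros continuous_on_complex_polynomial p)
  moreover have "ball 0 1 \<subseteq> {z. cmod (p z) \<le> C}"
    using bounded_mult_eval[OF b] nrm_kf_pos by blast
  ultimately have "closure (ball 0 1) \<subseteq> {z. cmod (p z) \<le> C}"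
    by (intro closure_minimal)
  then show ?thesis using z by auto
qed

theorem henkin_if_absolutely_continuous:
  assumes m: "complex_measure sphere_borel m"
    and \<mu>: "prob_space \<mu>" "sets \<mu> = sets sphere_borel" "energy \<mu> < \<infinity>"
    and ac: "complex_absolutely_continuous \<mu> m"
  shows "henkin H ip m"
  unfolding henkin_def
proof (intro allI impI)
  interpret \<mu>: prob_space \<mu> by (rule \<mu>(1))
  interpret drury_arveson_sphere H ip \<mu> by unfold_locales (rule \<mu>(2))
  interpret m: complex_measure_on sphere_borel m by unfold_locales (rule m)
  fix p :: "nat \<Rightarrow> complex ^ 'd \<Rightarrow> complex"
  assume p: "\<forall>n. complex_polynomial (p n)" and bdd: "(SUP n. mult_norm H ip (p n)) < \<infinity>"
    and lim: "\<forall>z\<in>ball 0 1. (\<lambda>n. p n z) \<longlonglongrightarrow> 0"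
  obtain C where C: "0 \<le> C" "(SUP n. mult_norm H ip (p n)) = ennreal C"
    using bdd by (cases "SUP n. mult_norm H ip (p n)") auto
  have b: "bounded_mult C (p n)" for n
  proof (rule bounded_mult_if_mult_norm_le[OF _ C(1)])
    show "mult_norm H ip (p n) \<le> ennreal C" unfolding C(2)[symmetric] by (rule SUP_upper) simp
  qed
  obtain E where E: "\<And>r. 0 \<le> r \<Longrightarrow> r < 1 \<Longrightarrow> weighted_energy (\<lambda>_. 1) r \<le> E"
  proof -
    have "0 \<le> energy \<mu>"
      unfolding energy_eq by (rule SUP_upper2[of 0]) (auto intro!: weighted_energy_nonneg[where B = 1])
    then obtain E where E: "energy \<mu> = ereal E" using \<mu>(3) by (cases "energy \<mu>") auto
    have "ereal (weighted_energy (\<lambda>_. 1) r) \<le> ereal E" if "0 \<le> r" "r < 1" for r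
      unfolding E[symmetric] energy_eq by (rule SUP_upper) (use that in auto)
    then show ?thesis using that by auto
  qed
  have "(\<lambda>n. \<integral>x. p n x \<partial>m.var j) \<longlonglongrightarrow> 0" for j
  proof (rule \<mu>.tendsto_zero_absolutely_continuous)
    show "finite_measure (m.var j)" by unfold_locales
    show "sets (m.var j) = sets \<mu>" by (simp add: \<mu>(2))
    show "absolutely_continuous \<mu> (m.var j)"
      unfolding absolutely_continuous_def
    proof
      fix A assume A: "A \<in> null_sets \<mu>"
      then have AS: "A \<in> sets sphere_borel" by (auto simp: \<mu>(2)[symmetric])
      \<comment> \<open>A variation takes all measurable subsets of A into account; these are again
        \<mu>-null, so m vanishes on each of them.\<close>
      have "emeasure (m.var j) A = 0"
      proof (rule m.var_null[OF AS])
        fix B assume B: "B \<in> sets sphere_borel" "B \<subseteq> A"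
        then have "B \<in> null_sets \<mu>" using null_sets_subset[OF A] by (simp add: \<mu>(2))
        then show "m B = 0" using ac by (simp add: complex_absolutely_continuous_def)
      qed
      then show "A \<in> null_sets (m.var j)" using AS by auto
    qed
    show "p n \<in> borel_measurable \<mu>" for n using p by (intro measurable_polynomial) auto
    show "cmod (p n x) \<le> C" if "x \<in> space \<mu>" for n x
      using that p by (intro bounded_mult_polynomial_le b) (auto simp: space_eq)
    fix f :: "complex ^ 'd \<Rightarrow> real" and B assume f: "f \<in> borel_measurable \<mu>" "\<And>x. x \<in> space \<mu> \<Longrightarrow> 0 \<le> f x \<and> f x \<le> B"
    then have fB: "\<bar>f z\<bar> \<le> B" if "z \<in> sphere 0 1" for z
      using that by (auto simp: space_eq)
    show "(\<lambda>n. \<integral>x. p n x * complex_of_real (f x) \<partial>\<mu>) \<longlonglongrightarrow> 0"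
    proof (rule integral_polynomial_tendsto_zero[OF f(1) fB])
      fix r :: real assume r: "0 \<le> r" "r < 1"
      have "weighted_energy f r \<le> weighted_energy (\<lambda>_. B) r"
        by (rule weighted_energy_le[OF f(1) _ _ _ r]) (use fB in auto)
      also have "\<dots> \<le> B\<^sup>2 * E"
        by (subst weighted_energy_const, rule mult_left_mono) (use E[OF r] in auto)
      finally show "weighted_energy f r \<le> B\<^sup>2 * E" .
    qed (use p lim bounded_mult_restr_ball[OF b] in auto)
  qed
  then have "(\<lambda>n. complex_measure_integral sphere_borel m (p n)) \<longlonglongrightarrow> (0 - 0) + \<i> * (0 - 0)"
    unfolding m.integral_var by (intro tendsto_intros)
  then show "(\<lambda>n. complex_measure_integral sphere_borel m (p n)) \<longlonglongrightarrow> 0" by simp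
qed

end

section \<open>A minimax argument\<close>

text \<open>
  Minimize \<open>\<Sum>i. (max 0 (a i h - b))\<^sup>2\<close>: at a minimizer with positive value,
  its gradient would provide weights violating the hypothesis.
\<close>

lemma finite_minimax:
  fixes a :: "nat \<Rightarrow> 'h \<Rightarrow> real" and mix :: "real \<Rightarrow> 'h \<Rightarrow> 'h \<Rightarrow> 'h"
  assumes mix: "\<And>t h h'. 0 \<le> t \<Longrightarrow> t \<le> 1 \<Longrightarrow> h \<in> S \<Longrightarrow> h' \<in> S \<Longrightarrow> mix t h h' \<in> S"
    and a_mix: "\<And>t h h' i. 0 \<le> t \<Longrightarrow> t \<le> 1 \<Longrightarrow> h \<in> S \<Longrightarrow> h' \<in> S \<Longrightarrow> i < n \<Longrightarrow>
      a i (mix t h h') = (1 - t) * a i h + t * a i h'"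
    and bound: "\<And>i h. i < n \<Longrightarrow> h \<in> S \<Longrightarrow> \<bar>a i h\<bar> \<le> D i"
    and weights: "\<And>c. (\<And>i. i < n \<Longrightarrow> 0 \<le> c i) \<Longrightarrow> (\<Sum>i<n. c i) = 1 \<Longrightarrow> \<exists>h\<in>S. (\<Sum>i<n. c i * a i h) \<le> b"
    and n: "n > 0" and \<eta>: "\<eta> > 0"
  shows "\<exists>h\<in>S. \<forall>i<n. a i h \<le> b + \<eta>"
proof (rule ccontr)
  assume neg: "\<not> ?thesis"
  define q where "q h = (\<Sum>i<n. (max 0 (a i h - b))\<^sup>2)" for h
  have q_ge: "\<eta>\<^sup>2 \<le> q h" if "h \<in> S" for h
  proof -
    obtain i where i: "i < n" "b + \<eta> < a i h" using neg \<open>h \<in> S\<close> by (meson not_le)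
    have "\<eta>\<^sup>2 \<le> (max 0 (a i h - b))\<^sup>2" using i \<eta> by (intro power_mono) auto
    also have "\<dots> \<le> q h" unfolding q_def using i by (intro member_le_sum) auto
    finally show ?thesis .
  qed
  have "\<exists>h\<in>S. (\<Sum>i<n. (if i = 0 then 1 else 0) * a i h) \<le> b"
    using n by (intro weights) auto
  then have ne: "S \<noteq> {}" by auto
  define \<iota> where "\<iota> = Inf (q ` S)"
  have bdd: "bdd_below (q ` S)" using q_ge by (intro bdd_belowI2[where m = "\<eta>\<^sup>2"]) auto
  have \<iota>_le: "\<iota> \<le> q h" if "h \<in> S" for h
    unfolding \<iota>_def using that bdd by (intro cInf_lower) auto
  have \<iota>_pos: "\<iota> > 0"
  proof -
    have "\<eta>\<^sup>2 \<le> \<iota>" unfolding \<iota>_def using ne q_ge by (intro cInf_greatest) auto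
    then show ?thesis using \<eta> by (smt (verit) zero_less_power)
  qed
  define D' where "D' = (\<Sum>i<n. (2 * D i)\<^sup>2)"
  have D': "0 \<le> D'" unfolding D'_def by (intro sum_nonneg) auto
  \<comment> \<open>Length of the step from h0 towards h1: small enough for the first-order gain, of
    size 2 t \<iota>, to beat both the quadratic error t^2 D' and the accuracy t^2 to which h0
    minimizes.\<close>
  define t where "t = min (1/2) (\<iota> / (1 + D'))"
  have t: "0 < t" "t \<le> 1" using \<iota>_pos D' by (auto simp: t_def)
  have "t \<le> \<iota> / (1 + D')" unfolding t_def by simp
  then have t_le: "t * (1 + D') \<le> \<iota>"
    using D' by (simp add: pos_le_divide_eq)
  have "\<exists>h\<in>S. q h < \<iota> + t\<^sup>2"
    using cInf_lessD[of "q ` S" "\<iota> + t\<^sup>2"] ne t unfolding \<iota>_def by auto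
  then obtain h0 where h0: "h0 \<in> S" "q h0 < \<iota> + t\<^sup>2" by blast
  \<comment> \<open>Half the gradient of the sum of squares with respect to the values
    \<open>a i h\<close>; divided by its sum it becomes an admissible system of weights.\<close>
  define l where "l i = max 0 (a i h0 - b)" for i
  have l: "0 \<le> l i" for i by (simp add: l_def)
  have "(\<Sum>i<n. l i) \<noteq> 0"
  proof
    assume "(\<Sum>i<n. l i) = 0"
    then have "\<forall>i<n. l i = 0" using l by (subst (asm) sum_nonneg_eq_0_iff) auto
    then have "q h0 = 0" unfolding q_def l_def[symmetric] by simp
    then show False using q_ge[OF h0(1)] \<eta> by simp
  qed
  then have L: "(\<Sum>i<n. l i) > 0" using l sum_nonneg[of "{..<n}" l] by fastforce
  define L where "L = (\<Sum>i<n. l i)"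
  have "\<exists>h\<in>S. (\<Sum>i<n. l i / L * a i h) \<le> b"
    by (rule weights) (use l L in \<open>auto simp: L_def sum_divide_distrib[symmetric]\<close>)
  then obtain h1 where h1: "h1 \<in> S" "(\<Sum>i<n. l i / L * a i h1) \<le> b" by blast
  have "(\<Sum>i<n. l i * a i h1) = L * (\<Sum>i<n. l i / L * a i h1)"
    unfolding sum_distrib_left using L by (intro sum.cong refl) (simp add: L_def)
  also have "\<dots> \<le> L * b" using h1(2) L by (intro mult_left_mono) (auto simp: L_def)
  finally have w: "(\<Sum>i<n. l i * (a i h1 - b)) \<le> 0"
    by (simp add: right_diff_distrib sum_subtractf L_def sum_distrib_right)
  have l_sq: "(\<Sum>i<n. l i * (a i h0 - b)) = q h0"
    unfolding q_def l_def by (intro sum.cong refl) (auto simp: max_def power2_eq_square)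
  have "q (mix t h0 h1) \<le> (\<Sum>i<n. (l i)\<^sup>2 + 2 * t * (l i * (a i h1 - b) - l i * (a i h0 - b)) + t\<^sup>2 * (2 * D i)\<^sup>2)"
    unfolding q_def
  proof (rule sum_mono)
    fix i assume "i \<in> {..<n}"
    then have i: "i < n" by simp
    define y where "y = a i h1 - a i h0"
    have e1: "a i (mix t h0 h1) - b = (a i h0 - b) + t * y"
      using a_mix[of t h0 h1 i] t h0 h1 i by (simp add: y_def algebra_simps)
    \<comment> \<open>Quadratic upper bound for the squared positive part, whose derivative is twice
      the positive part.\<close>
    have e2: "(max 0 (x + s))\<^sup>2 \<le> (max 0 x)\<^sup>2 + 2 * max 0 x * s + s\<^sup>2" for x s :: real
    proof (cases "0 \<le> x")
      case True
      have "(max 0 (x + s))\<^sup>2 \<le> (x + s)\<^sup>2" by (simp add: max_def)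
      then show ?thesis using True by (simp add: power2_sum)
    next
      case False
      then have "max 0 (x + s) \<le> \<bar>s\<bar>" by auto
      then have "(max 0 (x + s))\<^sup>2 \<le> \<bar>s\<bar>\<^sup>2" by (intro power_mono) auto
      then show ?thesis using False by simp
    qed
    have "(max 0 (a i (mix t h0 h1) - b))\<^sup>2 \<le> (l i)\<^sup>2 + 2 * l i * (t * y) + (t * y)\<^sup>2"
      unfolding l_def e1 by (rule e2)
    also have "(t * y)\<^sup>2 \<le> t\<^sup>2 * (2 * D i)\<^sup>2"
    proof -
      have "\<bar>y\<bar> \<le> 2 * D i"
        using bound[OF i h0(1)] bound[OF i h1(1)] unfolding y_def by linarith
      then have "\<bar>y\<bar>\<^sup>2 \<le> (2 * D i)\<^sup>2" by (intro power_mono) auto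
      then show ?thesis by (simp add: power_mult_distrib mult_left_mono)
    qed
    finally show "(max 0 (a i (mix t h0 h1) - b))\<^sup>2
      \<le> (l i)\<^sup>2 + 2 * t * (l i * (a i h1 - b) - l i * (a i h0 - b)) + t\<^sup>2 * (2 * D i)\<^sup>2"
      by (simp add: y_def algebra_simps)
  qed
  also have "\<dots> = q h0 + 2 * t * ((\<Sum>i<n. l i * (a i h1 - b)) - q h0) + t\<^sup>2 * D'"
    unfolding sum.distrib sum_subtractf sum_distrib_left[symmetric] l_sq D'_def
    by (simp add: q_def l_def)
  also have "\<dots> \<le> q h0 + 2 * t * (0 - \<iota>) + t\<^sup>2 * D'"
    using w \<iota>_le[OF h0(1)] t by (intro add_mono mult_left_mono diff_mono order_refl) auto
  finally have "\<iota> < \<iota> + t\<^sup>2 + 2 * t * (0 - \<iota>) + t\<^sup>2 * D'"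
    using \<iota>_le[OF mix[of t h0 h1]] h0 h1 t by fastforce
  then have "t * (2 * \<iota>) < t * (t * (1 + D'))"
    by (simp add: algebra_simps power2_eq_square)
  then have "2 * \<iota> < t * (1 + D')" using t by simp
  with t_le \<iota>_pos show False by linarith
qed

text \<open>The energy of a density supported on K samples its potential just at the points r^2 z
  with z in K, so these parameters suffice to control it; for z on the sphere off a compact K the
  kernel is bounded uniformly over them.\<close>

definition rays :: "(complex ^ 'd) set \<Rightarrow> (complex ^ 'd) set"
  where "rays K = {r *\<^sub>R \<zeta> | r \<zeta>. 0 \<le> r \<and> r < 1 \<and> \<zeta> \<in> K}"

lemma rays_subset_ball: "K \<subseteq> sphere 0 1 \<Longrightarrow> rays K \<subseteq> ball 0 1"
  unfolding rays_def by auto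

text \<open>The inequality 2 t |u| \<le> t^2 + u^2 turns the Cauchy property in L2 into one in L1: t
  = e/(S + 1) is small against the total mass S, and the square integrals are then taken below t e.
  An L1-Cauchy sequence has an almost everywhere convergent subsequence.\<close>

lemma (in finite_measure) subsequence_convergence:
  fixes x :: "nat \<Rightarrow> 'a \<Rightarrow> real"
  assumes x: "\<And>n. x n \<in> borel_measurable M" "\<And>n z. \<bar>x n z\<bar> \<le> B"
    and cauchy: "\<And>e. e > 0 \<Longrightarrow> \<exists>N. \<forall>m\<ge>N. \<forall>n\<ge>N. (\<integral>z. (x m z - x n z)\<^sup>2 \<partial>M) < e"
  obtains r where "strict_mono r" "AE z in M. convergent (\<lambda>n. x (r n) z)"
proof -
  have B: "0 \<le> B" using x(2)[of 0 undefined] by linarith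
  have int: "integrable M (x n)" for n
    using x by (intro integrable_const_bound[of _ B]) auto
  have int2: "integrable M (\<lambda>z. (x m z - x n z)\<^sup>2)" for m n
  proof (rule integrable_const_bound)
    show "AE z in M. norm ((x m z - x n z)\<^sup>2) \<le> (2 * B)\<^sup>2"
    proof (rule AE_I2)
      fix z
      have "\<bar>x m z - x n z\<bar> \<le> 2 * B" using x(2)[of m z] x(2)[of n z] by linarith
      then have "\<bar>x m z - x n z\<bar>\<^sup>2 \<le> (2 * B)\<^sup>2" by (intro power_mono) auto
      then show "norm ((x m z - x n z)\<^sup>2) \<le> (2 * B)\<^sup>2" by simp
    qed
  qed (use x in measurable)
  define S where "S = measure M (space M)"
  have S: "0 \<le> S" by (simp add: S_def)
  have L1: "\<exists>N. \<forall>i\<ge>N. \<forall>j\<ge>N. (\<integral>z. norm (x i z - x j z) \<partial>M) < e" if e: "e > 0" for e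
  proof -
    define t where "t = e / (S + 1)"
    have t: "t > 0" using e S by (simp add: t_def)
    obtain N where N: "\<And>m n. m \<ge> N \<Longrightarrow> n \<ge> N \<Longrightarrow> (\<integral>z. (x m z - x n z)\<^sup>2 \<partial>M) < t * e"
      using cauchy[of "t * e"] t e by auto
    show ?thesis
    proof (intro exI[of _ N] allI impI)
      fix i j assume ij: "i \<ge> N" "j \<ge> N"
      have "(\<integral>z. norm (x i z - x j z) \<partial>M) \<le> (\<integral>z. t / 2 + (x i z - x j z)\<^sup>2 / (2 * t) \<partial>M)"
      proof (rule integral_mono)
        show "integrable M (\<lambda>z. norm (x i z - x j z))" using int by simp
        show "integrable M (\<lambda>z. t / 2 + (x i z - x j z)\<^sup>2 / (2 * t))" using int2 by simp
        fix z
        have "0 \<le> (t - \<bar>x i z - x j z\<bar>)\<^sup>2" by simp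
        then have "2 * t * \<bar>x i z - x j z\<bar> \<le> t\<^sup>2 + (x i z - x j z)\<^sup>2" by (simp add: power2_diff)
        then have "\<bar>x i z - x j z\<bar> \<le> (t\<^sup>2 + (x i z - x j z)\<^sup>2) / (2 * t)"
          using t by (simp add: pos_le_divide_eq mult.commute)
        also have "\<dots> = t / 2 + (x i z - x j z)\<^sup>2 / (2 * t)"
          using t by (simp add: add_divide_distrib power2_eq_square)
        finally show "norm (x i z - x j z) \<le> t / 2 + (x i z - x j z)\<^sup>2 / (2 * t)" by simp
      qed
      also have "\<dots> = t * S / 2 + (\<integral>z. (x i z - x j z)\<^sup>2 \<partial>M) / (2 * t)"
        using int2 by (simp add: S_def)
      also have "\<dots> < t * S / 2 + (t * e) / (2 * t)"
        using N[OF ij] t by (intro add_strict_left_mono divide_strict_right_mono) auto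
      also have "\<dots> \<le> e / 2 + e / 2"
      proof -
        have "t * S \<le> t * (S + 1)" using t by simp
        also have "\<dots> = e" using S by (simp add: t_def)
        finally show ?thesis using t by simp
      qed
      finally show "(\<integral>z. norm (x i z - x j z) \<partial>M) < e" by simp
    qed
  qed
  obtain r where "strict_mono r" "AE z in M. Cauchy (\<lambda>i. x (r i) z)"
    by (rule cauchy_L1_AE_cauchy_subseq[where s = x and M = M, OF int L1])
  then show ?thesis using that by (simp add: Cauchy_convergent_iff)
qed

section \<open>From finitely many kernel functions to all rays through K\<close>

context sphere_measure
begin

text \<open>If every combination were below R on a set A \<subseteq> K of measure more than
  \<delta>, then \<open>indicator A\<close> would have mean potential at most R M(K) for the
  corresponding weights. Minimax yields densities of mass at least \<delta> with potential almost
  below that bound at any finitely many parameters, and a limit h obeys it on all rays. Since h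
  lives on K, its energy is then finite, and \<open>null\<close> contradicts the mass bound.\<close>

lemma large_kernel_combination:
  assumes K: "compact K" "K \<subseteq> sphere 0 1" "K \<noteq> {}" and R: "0 \<le> R" and \<delta>: "0 < \<delta>"
    and null: "\<And>h E. h \<in> borel_measurable M \<Longrightarrow> (\<And>z. 0 \<le> h z \<and> h z \<le> 1) \<Longrightarrow> (\<And>z. z \<notin> K \<Longrightarrow> h z = 0) \<Longrightarrow>
      (\<And>r. 0 \<le> r \<Longrightarrow> r < 1 \<Longrightarrow> weighted_energy h r \<le> E) \<Longrightarrow> (\<integral>z. h z \<partial>M) = 0"
  shows "\<exists>(n :: nat) c w. (\<forall>i<n. 0 \<le> c i \<and> w i \<in> rays K) \<and> (\<Sum>i<n. c i) = 1 \<and>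
    measure M {z\<in>K. (\<Sum>i<n. c i * Re (da_kernel z (w i))) < R} \<le> \<delta>"
proof (rule ccontr)
  assume neg: "\<not> ?thesis"
  have KM: "K \<in> sets M"
    unfolding sets_eq sphere_borel_sets_iff using K by (auto intro: borel_closed compact_imp_closed)
  have ballI: "v \<in> ball 0 1" if "v \<in> rays K" for v using that rays_subset_ball[OF K(2)] by blast
  \<comment> \<open>A countable dense set of parameters: the constraints can be imposed one after
    another, and continuity of the potential extends them to all rays.\<close>
  obtain T where T: "countable T" "T \<subseteq> rays K" "rays K \<subseteq> closure T" using separable by blast
  obtain \<zeta> where "\<zeta> \<in> K" using K(3) by blast
  then have "0 *\<^sub>R \<zeta> \<in> rays K" unfolding rays_def by force
  then have "T \<noteq> {}" using T by auto
  define w where "w = from_nat_into T"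
  have range_w: "range w = T" unfolding w_def by (rule range_from_nat_into[OF \<open>T \<noteq> {}\<close> T(1)])
  have w: "w i \<in> rays K" "norm (w i) < 1" for i
    using range_w T(2) ballI[of "w i"] by auto
  define u where "u i z = Re (da_kernel z (w i))" for i z
  define S where "S = {h. h \<in> borel_measurable M \<and> (\<forall>z. 0 \<le> h z \<and> h z \<le> 1) \<and> (\<forall>z. z \<notin> K \<longrightarrow> h z = 0)
    \<and> \<delta> \<le> (\<integral>z. h z \<partial>M)}"
  define a where "a i h = potential h (w i)" for i h
  define b where "b = R * measure M K"
  have S_abs: "\<bar>h z\<bar> \<le> 1" if "h \<in> S" for h z using that by (auto simp: S_def)
  have S_meas: "h \<in> borel_measurable M" if "h \<in> S" for h using that by (simp add: S_def)
  have S_int: "integrable M h" if "h \<in> S" for h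
    using S_meas[OF that] S_abs[OF that] by (intro integrable_bounded) auto
  have S_ker: "integrable M (\<lambda>z. u i z * h z)" if "h \<in> S" for h i
    unfolding u_def using S_meas[OF that] S_abs[OF that] w by (intro integrable_kernel) auto
  define mix where "mix t h h' = (\<lambda>z. (1 - t) * h z + t * h' z)" for t :: real and h h' :: "complex ^ 'a \<Rightarrow> real"
  have mix_S: "mix t h h' \<in> S" if t: "0 \<le> t" "t \<le> 1" and h: "h \<in> S" "h' \<in> S" for t h h'
    unfolding S_def
  proof (intro CollectI conjI allI impI)
    show "mix t h h' \<in> borel_measurable M" unfolding mix_def using S_meas h by measurable
    fix z
    have hz: "0 \<le> h z" "h z \<le> 1" "0 \<le> h' z" "h' z \<le> 1" using h by (auto simp: S_def)
    then show "0 \<le> mix t h h' z" unfolding mix_def using t by simp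
    show "mix t h h' z \<le> 1" unfolding mix_def using t hz by (intro convex_bound_le) auto
    show "z \<notin> K \<Longrightarrow> mix t h h' z = 0" unfolding mix_def using h by (simp add: S_def)
  next
    have "(\<integral>z. mix t h h' z \<partial>M) = (1 - t) * (\<integral>z. h z \<partial>M) + t * (\<integral>z. h' z \<partial>M)"
      unfolding mix_def using S_int h by simp
    moreover have "(1 - t) * \<delta> + t * \<delta> \<le> (1 - t) * (\<integral>z. h z \<partial>M) + t * (\<integral>z. h' z \<partial>M)"
      using t h by (intro add_mono mult_left_mono) (auto simp: S_def)
    ultimately show "\<delta> \<le> (\<integral>z. mix t h h' z \<partial>M)" by (simp add: algebra_simps)
  qed
  have a_mix: "a i (mix t h h') = (1 - t) * a i h + t * a i h'" if h: "h \<in> S" "h' \<in> S" for t h h' i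
  proof -
    have "a i (mix t h h') = (\<integral>z. (1 - t) * (u i z * h z) + t * (u i z * h' z) \<partial>M)"
      unfolding a_def potential_def mix_def u_def by (intro Bochner_Integration.integral_cong refl) (simp add: algebra_simps)
    then show ?thesis using S_ker[OF h(1), of i] S_ker[OF h(2), of i]
      by (simp add: a_def potential_def u_def)
  qed
  have finite: "\<exists>h\<in>S. \<forall>i<n. a i h \<le> b + \<eta>" if n: "n > 0" and \<eta>: "\<eta> > 0" for n \<eta>
  proof (rule finite_minimax[where mix = mix and D = "\<lambda>i. 1 / (1 - norm (w i)) * 1 * measure M (space M)"])
    show "\<bar>a i h\<bar> \<le> 1 / (1 - norm (w i)) * 1 * measure M (space M)" if "h \<in> S" for i h
      unfolding a_def using S_meas[OF that] S_abs[OF that] w by (intro abs_potential_le) auto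
    fix c :: "nat \<Rightarrow> real" assume c: "\<And>i. i < n \<Longrightarrow> 0 \<le> c i" "(\<Sum>i<n. c i) = 1"
    define A where "A = {z\<in>K. (\<Sum>i<n. c i * u i z) < R}"
    have sum_meas: "(\<lambda>z. \<Sum>i<n. c i * u i z) \<in> borel_measurable M"
      unfolding u_def using w by (intro borel_measurable_sum borel_measurable_times measurable_kernel) auto
    have "A = K \<inter> {z \<in> space M. (\<Sum>i<n. c i * u i z) < R}"
      using K(2) by (auto simp: A_def space_eq)
    also have "\<dots> \<in> sets M" by (intro sets.Int KM borel_measurable_less sum_meas) auto
    finally have A: "A \<in> sets M" .
    have "\<delta> < measure M A"
      using neg c w(1) unfolding A_def u_def by (meson not_le)
    then have ind: "indicator A \<in> S"
      unfolding S_def using A by (auto simp: indicator_def A_def)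
    have "(\<Sum>i<n. c i * a i (indicator A)) = (\<integral>z. (\<Sum>i<n. c i * (u i z * indicator A z)) \<partial>M)"
      unfolding a_def potential_def u_def[symmetric]
      using S_ker[OF ind] by (subst Bochner_Integration.integral_sum) auto
    also have "\<dots> \<le> (\<integral>z. R * indicator K z \<partial>M)"
    proof (rule integral_mono)
      show "integrable M (\<lambda>z. \<Sum>i<n. c i * (u i z * indicator A z))" using S_ker[OF ind] by auto
      show "integrable M (\<lambda>z. R * indicator K z :: real)" using emeasure_finite[of K]
        by (intro integrable_mult_right integrable_real_indicator KM) (simp add: less_top[symmetric])
      fix z
      have "(\<Sum>i<n. c i * (u i z * indicator A z)) = (\<Sum>i<n. c i * u i z) * indicator A z"
        by (simp add: sum_distrib_right mult.assoc)
      also have "\<dots> \<le> R * indicator K z" using R by (auto simp: indicator_def A_def)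
      finally show "(\<Sum>i<n. c i * (u i z * indicator A z)) \<le> R * indicator K z" .
    qed
    also have "\<dots> = b" unfolding b_def using KM by simp
    finally show "\<exists>h\<in>S. (\<Sum>i<n. c i * a i h) \<le> b" using ind by blast
  qed (use mix_S a_mix n \<eta> in auto)
  \<comment> \<open>The first k + 1 constraints with slack 1/(k+1). These sets decrease, and the
    slack disappears in the limit.\<close>
  define C where "C k = {h \<in> S. \<forall>i<Suc k. a i h \<le> b + 1 / (real k + 1)}" for k
  have sq_int: "integrable M (\<lambda>z. h z * h' z)" if "h \<in> S" "h' \<in> S" for h h'
  proof (rule integrable_bounded)
    show "(\<lambda>z. h z * h' z) \<in> borel_measurable M" using that S_meas by measurable
    show "norm (h z * h' z) \<le> 1 * 1" for z
      unfolding real_norm_def abs_mult using S_abs that by (intro mult_mono) auto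
  qed
  \<comment> \<open>Minimizing the L2 norm selects a strongly convergent sequence, so that a
    subsequence converges almost everywhere.\<close>
  define q where "q h = (\<integral>z. h z * h z \<partial>M)" for h :: "complex ^ 'a \<Rightarrow> real"
  obtain x where x: "\<And>k. x k \<in> C k"
    and cauchy: "\<And>e. e > 0 \<Longrightarrow> \<exists>N. \<forall>m\<ge>N. \<forall>n\<ge>N. 2 * q (x m) + 2 * q (x n) - 4 * q (mix (1/2) (x m) (x n)) < e"
  proof (rule minimizing_sequence[of C "mix (1/2)" 0 q "measure M (space M)"])
    show "C (Suc k) \<subseteq> C k" for k
    proof
      fix h assume h: "h \<in> C (Suc k)"
      have "1 / (real (Suc k) + 1) \<le> 1 / (real k + 1)" by (intro divide_left_mono) auto
      then have le: "b + 1 / (real (Suc k) + 1) \<le> b + 1 / (real k + 1)" by simp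
      have "a i h \<le> b + 1 / (real k + 1)" if "i < Suc k" for i
        by (rule order_trans[OF _ le]) (use h that in \<open>simp add: C_def\<close>)
      then show "h \<in> C k" using h by (simp add: C_def)
    qed
    show ne: "C k \<noteq> {}" for k
      using finite[of "Suc k" "1 / (real k + 1)"] unfolding C_def by auto
    show "mix (1/2) h h' \<in> C k" if "h \<in> C k" "h' \<in> C k" for k h h'
      unfolding C_def
    proof (intro CollectI conjI allI impI)
      show "mix (1/2) h h' \<in> S" using that by (intro mix_S) (auto simp: C_def)
      fix i assume "i < Suc k"
      then have "a i h \<le> b + 1 / (real k + 1)" "a i h' \<le> b + 1 / (real k + 1)"
        using that by (auto simp: C_def)
      moreover have "a i (mix (1/2) h h') = (1 - 1/2) * a i h + 1/2 * a i h'"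
        using that by (intro a_mix) (auto simp: C_def)
      moreover have "(1 - 1/2) * s + 1/2 * t \<le> e" if "s \<le> e" "t \<le> e" for s t e :: real
        using that by simp
      ultimately show "a i (mix (1/2) h h') \<le> b + 1 / (real k + 1)" by metis
    qed
    show "0 \<le> q h" for h unfolding q_def by (intro integral_nonneg_AE) auto
    show "\<exists>h\<in>C k. q h \<le> measure M (space M)" for k
    proof -
      obtain h where h: "h \<in> C k" using ne by blast
      then have hS: "h \<in> S" by (simp add: C_def)
      have "q h \<le> (\<integral>z. 1 \<partial>M)"
        unfolding q_def
      proof (rule integral_mono)
        show "h z * h z \<le> 1" for z using hS by (intro mult_le_one) (auto simp: S_def)
      qed (use sq_int[OF hS hS] in auto)
      then show ?thesis using h by auto
    qed
  qed auto
  have xS: "x k \<in> S" for k using x[of k] by (simp add: C_def)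
  have q_mid: "2 * q (x m) + 2 * q (x n) - 4 * q (mix (1/2) (x m) (x n)) = (\<integral>z. (x m z - x n z)\<^sup>2 \<partial>M)" for m n
  proof -
    have "(\<integral>z. (x m z - x n z)\<^sup>2 \<partial>M) = (\<integral>z. x m z * x m z + x n z * x n z - 2 * (x m z * x n z) \<partial>M)"
      by (simp add: power2_eq_square algebra_simps)
    also have "\<dots> = q (x m) + q (x n) - 2 * (\<integral>z. x m z * x n z \<partial>M)"
      unfolding q_def using sq_int xS by simp
    finally have 1: "(\<integral>z. (x m z - x n z)\<^sup>2 \<partial>M) = q (x m) + q (x n) - 2 * (\<integral>z. x m z * x n z \<partial>M)" .
    have "4 * q (mix (1/2) (x m) (x n)) = (\<integral>z. 4 * (mix (1/2) (x m) (x n) z * mix (1/2) (x m) (x n) z) \<partial>M)"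
      unfolding q_def by simp
    also have "\<dots> = (\<integral>z. x m z * x m z + x n z * x n z + 2 * (x m z * x n z) \<partial>M)"
      unfolding mix_def by (intro Bochner_Integration.integral_cong refl) (simp add: algebra_simps)
    also have "\<dots> = q (x m) + q (x n) + 2 * (\<integral>z. x m z * x n z \<partial>M)"
      unfolding q_def using sq_int xS by simp
    finally show ?thesis using 1 by simp
  qed
  obtain r where r: "strict_mono r" and conv: "AE z in M. convergent (\<lambda>n. x (r n) z)"
    by (rule subsequence_convergence[OF S_meas[OF xS] S_abs[OF xS] cauchy[unfolded q_mid]])
  \<comment> \<open>The default 0 at points of divergence keeps h between 0 and 1 everywhere, as
    \<open>null\<close> demands bounds at every point.\<close>
  define h where "h z = (if convergent (\<lambda>n. x (r n) z) then lim (\<lambda>n. x (r n) z) else 0)" for z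
  have h_lim: "AE z in M. (\<lambda>n. x (r n) z) \<longlonglongrightarrow> h z"
    using conv by (auto simp: h_def convergent_LIMSEQ_iff elim: eventually_mono)
  have h_meas: "h \<in> borel_measurable M"
  proof -
    have [measurable]: "x k \<in> borel_measurable M" for k by (rule S_meas[OF xS])
    have [measurable]: "Measurable.pred M (\<lambda>z. convergent (\<lambda>n. x (r n) z))"
      unfolding Cauchy_convergent_iff[symmetric] by measurable
    show ?thesis unfolding h_def by measurable
  qed
  have h01: "0 \<le> h z \<and> h z \<le> 1" for z
  proof (cases "convergent (\<lambda>n. x (r n) z)")
    case True
    then have "(\<lambda>n. x (r n) z) \<longlonglongrightarrow> h z" by (simp add: h_def convergent_LIMSEQ_iff)
    moreover have "0 \<le> x (r n) z" "x (r n) z \<le> 1" for n using xS[of "r n"] by (auto simp: S_def)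
    ultimately show ?thesis by (auto intro: LIMSEQ_le_const LIMSEQ_le_const2)
  qed (simp add: h_def)
  have h_supp: "h z = 0" if "z \<notin> K" for z
  proof -
    have "x (r n) z = 0" for n using xS[of "r n"] that by (simp add: S_def)
    then show ?thesis by (simp add: h_def lim_const)
  qed
  have h_abs: "\<bar>h z\<bar> \<le> 1" for z using h01[of z] by simp
  have "(\<lambda>n. \<integral>z. x (r n) z \<partial>M) \<longlonglongrightarrow> (\<integral>z. h z \<partial>M)"
    by (rule integral_dominated_convergence[where w = "\<lambda>_. 1"])
      (use h_meas S_meas[OF xS] S_abs[OF xS] h_lim in auto)
  moreover have "\<delta> \<le> (\<integral>z. x (r n) z \<partial>M)" for n using xS[of "r n"] by (simp add: S_def)
  ultimately have h_int: "\<delta> \<le> (\<integral>z. h z \<partial>M)" by (auto intro: LIMSEQ_le_const)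
  have pot_w: "potential h (w i) \<le> b" for i
  proof (rule LIMSEQ_le)
    show "(\<lambda>n. a i (x (r n))) \<longlonglongrightarrow> potential h (w i)"
      unfolding a_def potential_def
    proof (rule integral_dominated_convergence[where w = "\<lambda>_. 1 / (1 - norm (w i)) * 1"])
      show "AE z in M. (\<lambda>n. Re (da_kernel z (w i)) * x (r n) z) \<longlonglongrightarrow> Re (da_kernel z (w i)) * h z"
        using h_lim by (auto elim!: eventually_mono intro: tendsto_mult_left)
      show "AE z in M. norm (Re (da_kernel z (w i)) * x (r n) z) \<le> 1 / (1 - norm (w i)) * 1" for n
        unfolding real_norm_def abs_mult using S_abs[OF xS] w(2)[of i]
        by (intro AE_I2 mult_mono abs_Re_kernel_le) (auto simp: space_eq)
    qed (use h_meas S_meas[OF xS] measurable_kernel w in auto)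
    show "(\<lambda>n. b + 1 / (real (r n) + 1)) \<longlonglongrightarrow> b"
    proof -
      have "(\<lambda>n. b + 1 / (real n + 1)) \<longlonglongrightarrow> b + 0"
        by (intro tendsto_intros tendsto_recip_Suc)
      then show ?thesis using LIMSEQ_subseq_LIMSEQ[OF _ r, of "\<lambda>n. b + 1 / (real n + 1)"]
        by (simp add: o_def)
    qed
    show "\<exists>N. \<forall>n\<ge>N. a i (x (r n)) \<le> b + 1 / (real (r n) + 1)"
    proof (intro exI[of _ i] allI impI)
      fix n assume "n \<ge> i"
      then have "i < Suc (r n)" using strict_mono_imp_increasing[OF r, of n] by simp
      then show "a i (x (r n)) \<le> b + 1 / (real (r n) + 1)" using x[of "r n"] by (simp add: C_def)
    qed
  qed
  have pot: "potential h v \<le> b" if v: "v \<in> rays K" for v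
  proof -
    have "v \<in> closure T" using T v by blast
    then obtain s where s: "\<And>n. s n \<in> T" "s \<longlonglongrightarrow> v" by (auto simp: closure_sequential)
    have "s n \<in> ball 0 1" for n using s(1)[of n] T(2) by (intro ballI) auto
    then have "(\<lambda>n. potential h (s n)) \<longlonglongrightarrow> potential h v"
      by (intro continuous_on_tendsto_compose[OF continuous_on_potential[OF h_meas h_abs] s(2) ballI[OF v]])
        (intro always_eventually allI)
    moreover have "potential h (s n) \<le> b" for n using s(1)[of n] pot_w range_w by force
    ultimately show ?thesis by (auto intro: LIMSEQ_le_const2)
  qed
  have "weighted_energy h r \<le> b * measure M (space M)" if r: "0 \<le> r" "r < 1" for r
  proof -
    have r2: "r\<^sup>2 < 1" using r by (simp add: power_less_one_iff)
    have "weighted_energy h r \<le> (\<integral>z. b \<partial>M)"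
      unfolding weighted_energy_def
    proof (rule integral_mono)
      show "integrable M (\<lambda>z. h z * potential h (r\<^sup>2 *\<^sub>R z))"
        using h_meas h_abs r by (intro weighted_energy_integrable) auto
      have b: "0 \<le> b" using R by (simp add: b_def)
      \<comment> \<open>On K the sample point lies on a ray through K; off K the factor
        \<open>h z\<close> is 0 and b is nonnegative.\<close>
      show "h z * potential h (r\<^sup>2 *\<^sub>R z) \<le> b" for z
      proof (cases "z \<in> K")
        case True
        then have "r\<^sup>2 *\<^sub>R z \<in> rays K" using r2 unfolding rays_def by force
        then have "h z * potential h (r\<^sup>2 *\<^sub>R z) \<le> h z * b"
          using h01[of z] by (intro mult_left_mono pot) auto
        also have "\<dots> \<le> 1 * b" using h01[of z] b by (intro mult_right_mono) auto
        finally show ?thesis by simp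
      qed (use b h_supp in simp)
    qed simp
    then show ?thesis by (simp add: mult.commute)
  qed
  then have "(\<integral>z. h z \<partial>M) = 0" using null[OF h_meas h01 h_supp] by blast
  with h_int \<delta> show False by simp
qed

end

section \<open>Henkin measures vanish on small compact sets\<close>

text \<open>Scalar counterpart of \<open>bounded_mult_exp_approx\<close>: with y = x/n, |1 - y|^2 =
  1 + (-2 Re y + |y|^2) \<le> exp (-2 Re y + |y|^2), and the n-th power turns |y|^2 into |x|^2 / n
  \<le> 1.\<close>

lemma norm_one_minus_power_le:
  fixes x :: complex
  assumes n: "n > 0" and x: "(cmod x)\<^sup>2 \<le> real n"
  shows "cmod ((1 - x / of_nat n) ^ n) \<le> exp (1 - Re x)"
proof (rule power2_le_imp_le)
  define y where "y = x / of_nat n"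
  have y: "Re y = Re x / real n" "(cmod y)\<^sup>2 = (cmod x)\<^sup>2 / (real n)\<^sup>2"
    by (simp_all add: y_def Re_divide_of_nat norm_divide power_divide)
  have "(cmod (1 - y))\<^sup>2 = 1 + (- 2 * Re y + (cmod y)\<^sup>2)"
    by (simp add: cmod_power2 power2_diff)
  also have "\<dots> \<le> exp (- 2 * Re y + (cmod y)\<^sup>2)" by (rule exp_ge_add_one_self)
  finally have "((cmod (1 - y))\<^sup>2) ^ n \<le> exp (- 2 * Re y + (cmod y)\<^sup>2) ^ n"
    by (intro power_mono) auto
  also have "\<dots> = exp (real n * (- 2 * Re y + (cmod y)\<^sup>2))"
    by (simp add: exp_of_nat_mult)
  also have "real n * (- 2 * Re y + (cmod y)\<^sup>2) = - 2 * Re x + (cmod x)\<^sup>2 / real n"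
    unfolding y using n by (simp add: field_simps power2_eq_square)
  also have "exp \<dots> \<le> exp (2 * (1 - Re x))"
  proof -
    have "(cmod x)\<^sup>2 / real n \<le> 1" using n x by simp
    then show ?thesis by simp
  qed
  also have "\<dots> = (exp (1 - Re x))\<^sup>2" by (rule exp_double)
  finally show "(cmod ((1 - x / of_nat n) ^ n))\<^sup>2 \<le> (exp (1 - Re x))\<^sup>2"
    by (simp add: y_def norm_power power_mult[symmetric] mult.commute)
qed simp

text \<open>The difference is a polynomial in y with nonnegative coefficients, so moduli may be put
  inside.\<close>

lemma norm_one_plus_power_minus_one_le:
  fixes y :: complex
  shows "cmod ((1 + y) ^ n - 1) \<le> (1 + cmod y) ^ n - 1"
proof (induction n)
  case (Suc n)
  have "cmod ((1 + y) ^ Suc n - 1) = cmod ((1 + y) * ((1 + y) ^ n - 1) + y)"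
    by (simp add: algebra_simps)
  also have "\<dots> \<le> cmod (1 + y) * cmod ((1 + y) ^ n - 1) + cmod y"
    by (rule order_trans[OF norm_triangle_ineq]) (simp add: norm_mult)
  also have "\<dots> \<le> (1 + cmod y) * ((1 + cmod y) ^ n - 1) + cmod y"
    using Suc norm_triangle_ineq[of 1 y] by (intro add_right_mono mult_mono) auto
  also have "\<dots> = (1 + cmod y) ^ Suc n - 1" by (simp add: algebra_simps)
  finally show ?case .
qed simp

lemma norm_one_minus_exp_approx_le:
  fixes x :: complex
  assumes n: "n > 0"
  shows "cmod (1 - (1 - x / of_nat n) ^ n) \<le> exp (cmod x) - 1"
proof -
  have "cmod (1 - (1 - x / of_nat n) ^ n) \<le> (1 + cmod x / real n) ^ n - 1"
    using norm_one_plus_power_minus_one_le[of "- x / of_nat n" n]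
    by (simp add: norm_minus_commute norm_divide)
  also have "(1 + cmod x / real n) ^ n \<le> exp (cmod x / real n) ^ n"
    by (intro power_mono exp_ge_add_one_self) auto
  also have "\<dots> = exp (cmod x)" using n by (simp add: exp_of_nat_mult[symmetric])
  finally show ?thesis by simp
qed

text \<open>On the sphere |z - \<zeta>|^2 = 2 - 2 Re \<open>hip z \<zeta>\<close>, which handles r =
  1. For smaller r the real part 1 - r Re \<open>hip z \<zeta>\<close> is still at least min 1 (1 -
  Re \<open>hip z \<zeta>\<close>), and as the squared distance is at most 4, the factor 1/4 covers
  both entries of the minimum.\<close>

lemma norm_one_minus_hip_ray_ge:
  assumes z: "norm z = 1" and \<zeta>: "norm \<zeta> = 1" and r: "0 \<le> r" "r \<le> 1"
  shows "(dist z \<zeta>)\<^sup>2 / 4 \<le> cmod (1 - hip z (r *\<^sub>R \<zeta>))"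
proof -
  have "complex_of_real ((norm (z - \<zeta>))\<^sup>2) = hip z z + hip \<zeta> \<zeta> - (hip z \<zeta> + hip \<zeta> z)"
    by (subst hip_self[symmetric]) (simp add: hip_diff_left hip_diff_right)
  also have "hip z \<zeta> + hip \<zeta> z = 2 * Re (hip z \<zeta>)"
    using cnj_hip[of z \<zeta>] complex_add_cnj[of "hip z \<zeta>"] by simp
  finally have "complex_of_real ((norm (z - \<zeta>))\<^sup>2) = complex_of_real (2 - 2 * Re (hip z \<zeta>))"
    using z \<zeta> by (simp add: hip_self)
  then have d: "(dist z \<zeta>)\<^sup>2 = 2 - 2 * Re (hip z \<zeta>)"
    unfolding of_real_eq_iff dist_norm .
  have "Re (hip z \<zeta>) \<le> 1" "- 1 \<le> Re (hip z \<zeta>)"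
    using norm_hip_le[of z \<zeta>] abs_Re_le_cmod[of "hip z \<zeta>"] z \<zeta> by auto
  then have "(2 - 2 * Re (hip z \<zeta>)) / 4 \<le> min 1 (1 - Re (hip z \<zeta>))" by (simp add: min_def)
  moreover have "1 - r * Re (hip z \<zeta>) \<le> cmod (1 - hip z (r *\<^sub>R \<zeta>))"
    using complex_Re_le_cmod[of "1 - hip z (r *\<^sub>R \<zeta>)"] by (simp add: hip_scaleR_right)
  moreover have "min 1 (1 - Re (hip z \<zeta>)) \<le> 1 - r * Re (hip z \<zeta>)"
  proof (cases "0 \<le> Re (hip z \<zeta>)")
    case True
    then have "r * Re (hip z \<zeta>) \<le> Re (hip z \<zeta>)" using r by (simp add: mult_left_le_one_le)
    then show ?thesis by simp
  next
    case False
    then have "r * Re (hip z \<zeta>) \<le> 0" using r by (simp add: mult_nonneg_nonpos)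
    then show ?thesis by simp
  qed
  ultimately show ?thesis unfolding d by linarith
qed

section \<open>Bounded polynomials close to the indicator function of K\<close>

context drury_arveson
begin

lemma accretive_mono: "accretive \<eta> \<phi> \<Longrightarrow> \<eta> \<le> \<eta>' \<Longrightarrow> accretive \<eta>' \<phi>"
  unfolding accretive_def
  by (meson mult_right_mono neg_le_iff_le order_trans zero_le_power2)

text \<open>A polynomial form of 1 - exp (- \<epsilon> V) whose multiplier bound is independent of
  n, c, w and \<epsilon>. Weighted by \<epsilon> c, the defects add up to at most 1, and \<eta> = 1
  in \<open>bounded_mult_exp_approx\<close> gives \<open>exp 2\<close>. Of the 2 in the first
  pointwise bound, one unit comes from \<open>norm_one_minus_power_le\<close> and one from the
  truncation error, which is at most \<epsilon> \<le> 1; the summand 1 beside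
  \<open>cmod (V z)\<close> is the same truncation error.\<close>

lemma exp_herglotz_polynomial:
  fixes n :: nat and c :: "nat \<Rightarrow> real" and w :: "nat \<Rightarrow> complex ^ 'd"
  defines "V z \<equiv> \<Sum>i<n. complex_of_real (c i) * (2 * da_kernel z (w i) - 1)"
  assumes c: "\<And>i. i < n \<Longrightarrow> 0 \<le> c i" "(\<Sum>i<n. c i) = 1" and w: "\<And>i. i < n \<Longrightarrow> norm (w i) < 1"
    and \<epsilon>: "0 \<le> \<epsilon>" "\<epsilon> \<le> 1"
  shows "\<exists>\<Phi>. complex_polynomial \<Phi> \<and> bounded_mult (1 + exp 2) \<Phi> \<and>
    (\<forall>z. norm z \<le> 1 \<longrightarrow> cmod (1 - \<Phi> z) \<le> exp (2 - \<epsilon> * Re (V z)) \<and>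
      cmod (\<Phi> z) \<le> exp (\<epsilon> * (cmod (V z) + 1)) - 1)"
proof -
  have "\<forall>\<^sub>F N in sequentially. \<forall>i\<in>{..<n}. 2 * norm (w i) ^ Suc N / (1 - norm (w i)) < 1"
  proof (rule eventually_ball_finite, simp, rule ballI)
    fix i assume i: "i \<in> {..<n}"
    have "(\<lambda>N. 2 * norm (w i) ^ Suc N / (1 - norm (w i))) \<longlonglongrightarrow> 2 * 0 / (1 - norm (w i))"
      using w[of i] i by (intro tendsto_intros LIMSEQ_Suc[OF LIMSEQ_realpow_zero]) auto
    then show "\<forall>\<^sub>F N in sequentially. 2 * norm (w i) ^ Suc N / (1 - norm (w i)) < 1"
      by (rule order_tendstoD) simp
  qed
  \<comment> \<open>A single N makes the truncation error on the closed ball and the accretivity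
    defect at most 1, simultaneously for all i < n.\<close>
  then obtain N where N: "\<And>i. i < n \<Longrightarrow> 2 * norm (w i) ^ Suc N / (1 - norm (w i)) \<le> 1"
    by (force simp: eventually_sequentially intro: less_imp_le)
  define T where "T i = trunc_herglotz N (w i)" for i
  have "\<forall>i. \<exists>C. 0 \<le> C \<and> bounded_mult C (T i)"
    unfolding T_def using ex_bounded_mult_trunc_herglotz by blast
  then obtain C where C: "\<And>i. 0 \<le> C i" "\<And>i. bounded_mult (C i) (T i)"
    by metis
  have T_acc: "accretive 1 (T i)" if "i < n" for i
    using accretive_mono[OF accretive_trunc_herglotz N] w that unfolding T_def by blast
  define p where "p z = (\<Sum>i<n. complex_of_real (\<epsilon> * c i) * T i z)" for z
  define D where "D = (\<Sum>i<n. cmod (complex_of_real (\<epsilon> * c i)) * C i)"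
  have D: "0 \<le> D" unfolding D_def using C by (intro sum_nonneg) auto
  have p_pol: "complex_polynomial p"
    unfolding p_def[abs_def] T_def
    by (intro complex_polynomial_sum complex_polynomial_mult complex_polynomial_const complex_polynomial_trunc_herglotz) auto
  have p_mult: "bounded_mult D p"
    unfolding p_def[abs_def] D_def using C by (intro bounded_mult_sum bounded_mult_scale) auto
  have "accretive (\<Sum>i<n. (\<epsilon> * c i) * 1) p"
    unfolding p_def[abs_def]
    using T_acc C c \<epsilon> by (intro accretive_sum[OF _ bounded_mult_scale] accretive_scale) auto
  moreover have "(\<Sum>i<n. (\<epsilon> * c i) * 1) \<le> 1"
    using c(2) \<epsilon> by (simp add: sum_distrib_left[symmetric])
  ultimately have p_acc: "accretive 1 p" by (rule accretive_mono)
  \<comment> \<open>D bounds p both as a multiplier and pointwise on the closed ball, so this choice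
    serves the operator estimate and the scalar one; the successor ensures m > 0.\<close>
  obtain k where k: "D\<^sup>2 \<le> real k" using real_arch_simple by blast
  define m where "m = Suc k"
  have m: "m > 0" "D\<^sup>2 \<le> real m" using k by (auto simp: m_def)
  \<comment> \<open>Built from sums, products and constants to fit the closure rules for
    polynomials.\<close>
  define \<Phi> where "\<Phi> z = 1 + (- 1) * (1 + (- 1 / of_nat m) * p z) ^ m" for z
  have \<Phi>: "\<Phi> z = 1 - (1 - p z / of_nat m) ^ m" for z by (simp add: \<Phi>_def)
  have "complex_polynomial \<Phi>"
    unfolding \<Phi>_def[abs_def]
    by (intro complex_polynomial_add complex_polynomial_mult complex_polynomial_power complex_polynomial_const p_pol)
  moreover have "bounded_mult (1 + exp 2) \<Phi>"
  proof -
    have "bounded_mult (exp (1 + 1)) (\<lambda>z. (1 - p z / of_nat m) ^ m)"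
      by (rule bounded_mult_exp_approx[OF p_mult p_acc D _ m]) simp
    then have "bounded_mult (cmod 1 + cmod (- 1) * exp (1 + 1)) (\<lambda>z. 1 + (- 1) * (1 - p z / of_nat m) ^ m)"
      by (intro bounded_mult_add bounded_mult_const bounded_mult_scale)
    moreover have "\<Phi> = (\<lambda>z. 1 + (- 1) * (1 - p z / of_nat m) ^ m)" by (simp add: \<Phi> fun_eq_iff)
    ultimately show ?thesis by simp
  qed
  moreover have "cmod (1 - \<Phi> z) \<le> exp (2 - \<epsilon> * Re (V z))" "cmod (\<Phi> z) \<le> exp (\<epsilon> * (cmod (V z) + 1)) - 1"
    if z: "norm z \<le> 1" for z
  proof -
    have "p z - complex_of_real \<epsilon> * V z = (\<Sum>i<n. complex_of_real (\<epsilon> * c i) * (T i z - (2 * da_kernel z (w i) - 1)))"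
      unfolding p_def V_def by (simp add: sum_distrib_left sum_subtractf[symmetric] algebra_simps)
    also have "cmod \<dots> \<le> (\<Sum>i<n. (\<epsilon> * c i) * 1)"
    proof (rule sum_norm_le)
      fix i assume "i \<in> {..<n}"
      then have i: "i < n" by simp
      have "cmod (T i z - (2 * da_kernel z (w i) - 1)) \<le> 1"
        unfolding T_def using trunc_herglotz_approx[OF z w[OF i], of N] N[OF i] by linarith
      then show "cmod (complex_of_real (\<epsilon> * c i) * (T i z - (2 * da_kernel z (w i) - 1))) \<le> (\<epsilon> * c i) * 1"
        unfolding norm_mult norm_of_real using c(1)[OF i] \<epsilon> by (intro mult_mono) auto
    qed
    also have "\<dots> = \<epsilon>" using c(2) by (simp add: sum_distrib_left[symmetric])
    finally have diff: "cmod (p z - complex_of_real \<epsilon> * V z) \<le> \<epsilon>" .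
    then have Re_p: "\<epsilon> * Re (V z) - 1 \<le> Re (p z)"
      using abs_Re_le_cmod[of "p z - complex_of_real \<epsilon> * V z"] \<epsilon> by simp
    have "cmod (p z) \<le> cmod (complex_of_real \<epsilon> * V z) + cmod (p z - complex_of_real \<epsilon> * V z)"
      by (rule norm_triangle_sub)
    then have p_le: "cmod (p z) \<le> \<epsilon> * (cmod (V z) + 1)"
      using diff \<epsilon> by (simp add: norm_mult algebra_simps)
    have "cmod (p z) \<le> D" by (rule bounded_mult_polynomial_le[OF p_mult p_pol z])
    then have "(cmod (p z))\<^sup>2 \<le> real m" using m(2) power_mono[of "cmod (p z)" D 2] by simp
    from norm_one_minus_power_le[OF m(1) this]
    have "cmod (1 - \<Phi> z) \<le> exp (1 - Re (p z))" by (simp add: \<Phi>)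
    also have "\<dots> \<le> exp (2 - \<epsilon> * Re (V z))" using Re_p by simp
    finally show "cmod (1 - \<Phi> z) \<le> exp (2 - \<epsilon> * Re (V z))" .
    have "cmod (\<Phi> z) \<le> exp (cmod (p z)) - 1"
      unfolding \<Phi> by (rule norm_one_minus_exp_approx_le[OF m(1)])
    then show "cmod (\<Phi> z) \<le> exp (\<epsilon> * (cmod (V z) + 1)) - 1"
      using p_le by (meson diff_right_mono exp_le_cancel_iff order_trans)
  qed
  ultimately show ?thesis by blast
qed

text \<open>
  The polynomials constructed from the hypothesis are bounded multipliers which tend to 0 on the ball,
  but to the indicator function of K on the sphere.
\<close>

lemma henkin_compact_null:
  assumes m: "complex_measure sphere_borel m" and henkin: "henkin H ip m"
    and K: "compact K" "K \<subseteq> sphere 0 1" "K \<noteq> {}"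
    and large: "\<And>R \<delta>. 0 \<le> R \<Longrightarrow> 0 < \<delta> \<Longrightarrow> \<exists>(n :: nat) c w. (\<forall>i<n. 0 \<le> c i \<and> w i \<in> rays K) \<and> (\<Sum>i<n. c i) = 1 \<and>
      measure (complex_measure_on.total sphere_borel m)
        {z\<in>K. (\<Sum>i<n. c i * Re (da_kernel z (w i))) < R} \<le> \<delta>"
  shows "m K = 0"
proof -
  interpret m: complex_measure_on sphere_borel m by unfold_locales (rule m)
  interpret t: sphere_measure m.total by unfold_locales simp
  have KS: "K \<in> sets sphere_borel"
    unfolding sphere_borel_sets_iff using K by (auto intro: borel_closed compact_imp_closed)
  \<comment> \<open>The thresholds grow like k^2 to outweigh the scale 1/(k+1) used below, and the
    exceptional sets are summable for Borel-Cantelli.\<close>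
  define P where "P k n c w \<longleftrightarrow> (\<forall>i<n. 0 \<le> c i \<and> w i \<in> rays K) \<and> (\<Sum>i<n. c i) = 1 \<and>
      measure m.total {z\<in>K. (\<Sum>i<n. c i * Re (da_kernel z (w i))) < (real k + 1)\<^sup>2} \<le> (1/2) ^ k"
    for k n :: nat and c w
  have "\<forall>k. \<exists>n c w. P k n c w" unfolding P_def by (intro allI large) auto
  then obtain n c w where P: "\<And>k. P k (n k) (c k) (w k)" by metis
  have c: "\<And>k i. i < n k \<Longrightarrow> 0 \<le> c k i" "\<And>k. (\<Sum>i<n k. c k i) = 1"
    and w: "\<And>k i. i < n k \<Longrightarrow> w k i \<in> rays K"
    and small: "\<And>k. measure m.total {z\<in>K. (\<Sum>i<n k. c k i * Re (da_kernel z (w k i))) < (real k + 1)\<^sup>2} \<le> (1/2) ^ k"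
    using P unfolding P_def by auto
  have w1: "norm (w k i) < 1" if "i < n k" for k i
    using w[OF that] rays_subset_ball[OF K(2)] by auto
  define V where "V k z = (\<Sum>i<n k. complex_of_real (c k i) * (2 * da_kernel z (w k i) - 1))" for k z
  \<comment> \<open>On K off the exceptional set, Re V is at least 2 (k+1)^2 - 1 \<ge> (k+1)^2, so
    \<epsilon> Re V \<ge> k + 1 tends to infinity, whereas \<epsilon> V tends to 0 wherever V stays
    bounded in k.\<close>
  define \<epsilon> where "\<epsilon> k = 1 / (real k + 1)" for k
  have \<epsilon>: "0 \<le> \<epsilon> k" "\<epsilon> k \<le> 1" for k by (auto simp: \<epsilon>_def)
  have \<epsilon>_lim: "\<epsilon> \<longlonglongrightarrow> 0"
    unfolding \<epsilon>_def by (rule tendsto_recip_Suc)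
  have "\<exists>\<Phi>. complex_polynomial \<Phi> \<and> bounded_mult (1 + exp 2) \<Phi> \<and>
    (\<forall>z. norm z \<le> 1 \<longrightarrow> cmod (1 - \<Phi> z) \<le> exp (2 - \<epsilon> k * Re (V k z)) \<and>
      cmod (\<Phi> z) \<le> exp (\<epsilon> k * (cmod (V k z) + 1)) - 1)" for k
    unfolding V_def by (rule exp_herglotz_polynomial) (use c w1 \<epsilon> in auto)
  then obtain \<Phi> where \<Phi>: "\<And>k. complex_polynomial (\<Phi> k)" "\<And>k. bounded_mult (1 + exp 2) (\<Phi> k)"
    and one: "\<And>k z. norm z \<le> 1 \<Longrightarrow> cmod (1 - \<Phi> k z) \<le> exp (2 - \<epsilon> k * Re (V k z))"
    and zero: "\<And>k z. norm z \<le> 1 \<Longrightarrow> cmod (\<Phi> k z) \<le> exp (\<epsilon> k * (cmod (V k z) + 1)) - 1"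
    by metis
  \<comment> \<open>The lower bound d keeps \<open>V k z\<close> below 2/d + 1 for all k. It applies
    to points of the ball with d = 1 - |z| as well as to points of the sphere off K.\<close>
  have to_zero: "(\<lambda>k. \<Phi> k z) \<longlonglongrightarrow> 0"
    if z: "norm z \<le> 1" and d: "d > 0" "\<And>v. v \<in> rays K \<Longrightarrow> d \<le> cmod (1 - hip z v)" for z d
  proof (rule Lim_null_comparison)
    show "\<forall>\<^sub>F k in sequentially. norm (\<Phi> k z) \<le> exp (\<epsilon> k * (2 / d + 2)) - 1"
    proof (intro always_eventually allI)
      fix k
      have "cmod (V k z) \<le> (\<Sum>i<n k. c k i * (2 / d + 1))"
        unfolding V_def
      proof (rule sum_norm_le)
        fix i assume "i \<in> {..<n k}"
        then have i: "i < n k" by simp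
        have "cmod (da_kernel z (w k i)) \<le> 1 / d"
          unfolding da_kernel_hip norm_divide using d(1) d(2)[OF w[OF i]] by (simp add: frac_le)
        then have "cmod (2 * da_kernel z (w k i) - 1) \<le> 2 / d + 1"
          using norm_triangle_ineq4[of "2 * da_kernel z (w k i)" 1] by (simp add: norm_mult)
        then show "cmod (complex_of_real (c k i) * (2 * da_kernel z (w k i) - 1)) \<le> c k i * (2 / d + 1)"
          unfolding norm_mult norm_of_real using c(1)[OF i] by (intro mult_mono) auto
      qed
      also have "\<dots> = 2 / d + 1" using c(2)[of k] by (simp add: sum_distrib_right[symmetric])
      finally have "\<epsilon> k * (cmod (V k z) + 1) \<le> \<epsilon> k * (2 / d + 2)"
        using \<epsilon>(1) by (intro mult_left_mono) auto
      then show "norm (\<Phi> k z) \<le> exp (\<epsilon> k * (2 / d + 2)) - 1"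
        using zero[OF z, of k] by (meson diff_right_mono exp_le_cancel_iff order_trans)
    qed
    have "(\<lambda>k. exp (\<epsilon> k * (2 / d + 2)) - 1) \<longlonglongrightarrow> exp (0 * (2 / d + 2)) - 1"
      by (intro tendsto_intros \<epsilon>_lim)
    then show "(\<lambda>k. exp (\<epsilon> k * (2 / d + 2)) - 1) \<longlonglongrightarrow> 0" by simp
  qed
  have "(\<lambda>k. complex_measure_integral sphere_borel m (\<Phi> k)) \<longlonglongrightarrow> 0"
  proof -
    have "(SUP k. mult_norm H ip (\<Phi> k)) \<le> ennreal (1 + exp 2)"
      by (intro SUP_least mult_norm_le \<Phi>) (simp add: add_nonneg_nonneg)
    also have "\<dots> < \<infinity>" by simp
    finally have "(SUP k. mult_norm H ip (\<Phi> k)) < \<infinity>" .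
    moreover have "(\<lambda>k. \<Phi> k z) \<longlonglongrightarrow> 0" if z: "z \<in> ball 0 1" for z
    proof (rule to_zero[of z "1 - norm z"])
      fix v assume "v \<in> rays K"
      then have "norm v \<le> 1" using rays_subset_ball[OF K(2)] by auto
      then have "cmod (hip z v) \<le> norm z"
        using norm_hip_le[of z v] mult_left_mono[of "norm v" 1 "norm z"] by simp
      then show "1 - norm z \<le> cmod (1 - hip z v)" using norm_triangle_ineq2[of 1 "hip z v"] by simp
    qed (use z in auto)
    ultimately show ?thesis using henkin \<Phi>(1) unfolding henkin_def by blast
  qed
  moreover have "(\<lambda>k. complex_measure_integral sphere_borel m (\<Phi> k)) \<longlonglongrightarrow>
      complex_measure_integral sphere_borel m (\<lambda>x. complex_of_real (indicator K x))"
  proof (rule m.integral_convergence)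
    have eqM: "borel_measurable m.total = borel_measurable (sphere_borel :: (complex ^ 'd) measure)"
      by (rule measurable_cong_sets) auto
    show "\<Phi> k \<in> borel_measurable sphere_borel" for k
      using t.measurable_continuous[OF continuous_on_complex_polynomial[OF \<Phi>(1)], of k] unfolding eqM .
    show "(\<lambda>x. complex_of_real (indicator K x)) \<in> borel_measurable sphere_borel"
      using KS by measurable
    show "cmod (\<Phi> k x) \<le> 1 + exp 2" if "x \<in> space sphere_borel" for k x
      using that by (intro bounded_mult_polynomial_le[OF \<Phi>(2,1)]) (simp add: space_sphere_borel)
    define B where "B k = {z\<in>K. (\<Sum>i<n k. c k i * Re (da_kernel z (w k i))) < (real k + 1)\<^sup>2}" for k
    have B: "B k \<in> sets m.total" for k
    proof -
      have "(\<lambda>z. \<Sum>i<n k. c k i * Re (da_kernel z (w k i))) \<in> borel_measurable m.total"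
        using w1 by (intro borel_measurable_sum borel_measurable_times t.measurable_kernel) auto
      then have "K \<inter> {z \<in> space m.total. (\<Sum>i<n k. c k i * Re (da_kernel z (w k i))) < (real k + 1)\<^sup>2} \<in> sets m.total"
        using KS by (intro sets.Int borel_measurable_less) auto
      also have "K \<inter> {z \<in> space m.total. (\<Sum>i<n k. c k i * Re (da_kernel z (w k i))) < (real k + 1)\<^sup>2} = B k"
        using K(2) by (auto simp: B_def space_sphere_borel)
      finally show ?thesis .
    qed
    \<comment> \<open>Almost every point lies in only finitely many exceptional sets.\<close>
    have "AE x in m.total. \<forall>\<^sub>F k in sequentially. x \<in> space m.total - B k"
    proof (rule borel_cantelli_AE1[OF B])
      show "emeasure m.total (B k) < \<infinity>" for k
        using m.total.emeasure_finite[of "B k"] by (simp add: less_top[symmetric])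
      show "summable (\<lambda>k. measure m.total (B k))"
        by (rule summable_comparison_test'[of "\<lambda>k. (1/2) ^ k" 0]) (use small in \<open>auto simp: B_def\<close>)
    qed
    then show "AE x in m.total. (\<lambda>k. \<Phi> k x) \<longlonglongrightarrow> complex_of_real (indicator K x)"
    proof (eventually_elim, goal_cases)
      case (1 x)
      \<comment> \<open>Membership in the sphere is available only inside the eventual statement;
        its consequence does not depend on k.\<close>
      then have "\<forall>\<^sub>F k in sequentially. norm x = 1"
        by (rule eventually_mono) (auto simp: space_sphere_borel)
      then have x: "norm x = 1" by simp
      show ?case
      proof (cases "x \<in> K")
        case True
        have "\<forall>\<^sub>F k in sequentially. norm (1 - \<Phi> k x) \<le> exp (1 - real k)"
          using 1
        proof (rule eventually_mono)
          fix k assume "x \<in> space m.total - B k"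
          then have "(real k + 1)\<^sup>2 \<le> (\<Sum>i<n k. c k i * Re (da_kernel x (w k i)))"
            using True by (auto simp: B_def)
          moreover have "Re (V k x) = 2 * (\<Sum>i<n k. c k i * Re (da_kernel x (w k i))) - (\<Sum>i<n k. c k i)"
            unfolding V_def by (simp add: sum_subtractf sum_distrib_left algebra_simps)
          ultimately have "2 * (real k + 1)\<^sup>2 - 1 \<le> Re (V k x)" using c(2)[of k] by simp
          moreover have "1 \<le> (real k + 1)\<^sup>2" by simp
          ultimately have "(real k + 1)\<^sup>2 \<le> Re (V k x)" by linarith
          then have "\<epsilon> k * (real k + 1)\<^sup>2 \<le> \<epsilon> k * Re (V k x)" using \<epsilon>(1) by (rule mult_left_mono)
          moreover have "\<epsilon> k * (real k + 1)\<^sup>2 = real k + 1" by (simp add: \<epsilon>_def power2_eq_square)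
          ultimately have "exp (2 - \<epsilon> k * Re (V k x)) \<le> exp (1 - real k)" by simp
          then show "norm (1 - \<Phi> k x) \<le> exp (1 - real k)" using one[of x k] x by linarith
        qed
        moreover have "(\<lambda>k. exp (1 - real k)) \<longlonglongrightarrow> 0"
        proof -
          have "exp (1 - real k) = exp 1 * exp (- 1) ^ k" for k
            by (simp add: exp_of_nat_mult[symmetric] exp_add[symmetric])
          moreover have "(\<lambda>k. exp 1 * exp (- 1) ^ k) \<longlonglongrightarrow> exp 1 * (0 :: real)"
            by (intro tendsto_intros LIMSEQ_realpow_zero) auto
          ultimately show ?thesis by simp
        qed
        ultimately have "(\<lambda>k. 1 - \<Phi> k x) \<longlonglongrightarrow> 0" by (rule Lim_null_comparison)
        then have "(\<lambda>k. 1 - (1 - \<Phi> k x)) \<longlonglongrightarrow> 1 - 0" by (intro tendsto_intros)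
        then show ?thesis using True by simp
      next
        case False
        \<comment> \<open>The bound of \<open>norm_one_minus_hip_ray_ge\<close> with the distance
          from x to K in place of the distance to a single point.\<close>
        define d where "d = (infdist x K)\<^sup>2 / 4"
        have "infdist x K > 0"
          using infdist_pos_not_in_closed[OF compact_imp_closed[OF K(1)] K(3) False] .
        then have d: "d > 0" by (simp add: d_def)
        have "(\<lambda>k. \<Phi> k x) \<longlonglongrightarrow> 0"
        proof (rule to_zero[OF _ d])
          fix v assume "v \<in> rays K"
          then obtain r \<zeta> where v: "v = r *\<^sub>R \<zeta>" "0 \<le> r" "r < 1" "\<zeta> \<in> K" unfolding rays_def by blast
          have "d \<le> (dist x \<zeta>)\<^sup>2 / 4"
            unfolding d_def using infdist_le[OF v(4), of x] infdist_nonneg[of x K]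
            by (intro divide_right_mono power_mono) auto
          also have "\<dots> \<le> cmod (1 - hip x v)"
            unfolding v(1) using v x K(2) by (intro norm_one_minus_hip_ray_ge) auto
          finally show "d \<le> cmod (1 - hip x v)" .
        qed (use x in simp)
        then show ?thesis using False by simp
      qed
    qed
  qed
  ultimately have "complex_measure_integral sphere_borel m (\<lambda>x. complex_of_real (indicator K x)) = 0"
    by (rule LIMSEQ_unique[rotated])
  then show ?thesis using m.integral_indicator[OF KS] by simp
qed

end

section \<open>Densities of finite energy\<close>

text \<open>The mean of 1/(1 - a) over a circle |a| = \<rho> is its value at 0. It is computed with
  the primitive G of 1/h, which exists because h' = 2 \<pi> \<i> (h - 1); \<open>Ln\<close> is
  applied where h has positive real part, and periodicity of h leaves only the linear term of
  G.\<close>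

lemma integral_Re_recip_one_minus_cis:
  assumes "0 \<le> \<rho>" "\<rho> < 1"
  shows "(\<integral>s. indicator {0..1} s *\<^sub>R Re (1 / (1 - complex_of_real \<rho> * cis (2 * pi * (s - t)))) \<partial>lborel) = 1"
proof -
  define h where "h c = 1 - complex_of_real \<rho> * exp (2 * pi * \<i> * (c - complex_of_real t))" for c
  define G where "G c = c - Ln (h c) / (2 * pi * \<i>)" for c
  have h_real: "h (complex_of_real s) = 1 - complex_of_real \<rho> * cis (2 * pi * (s - t))" for s
    by (simp add: h_def cis_conv_exp mult_ac)
  have h_pos: "Re (h (complex_of_real s)) > 0" for s
  proof -
    have "Re (complex_of_real \<rho> * cis (2 * pi * (s - t))) \<le> cmod (complex_of_real \<rho> * cis (2 * pi * (s - t)))"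
      by (rule complex_Re_le_cmod)
    then show ?thesis using assms unfolding h_real by (simp add: norm_mult)
  qed
  have h_Ln: "h (complex_of_real s) \<notin> \<real>\<^sub>\<le>\<^sub>0" for s
    using h_pos[of s] by (auto simp: complex_nonpos_Reals_iff)
  have der: "((\<lambda>s. Re (G (complex_of_real s))) has_vector_derivative Re (1 / h (complex_of_real s))) (at s within {0..1})" for s
  proof -
    have ne: "h (complex_of_real s) \<noteq> 0" using h_pos[of s] by auto
    have "((\<lambda>c. exp (2 * pi * \<i> * (c - complex_of_real t))) has_field_derivative
        exp (2 * pi * \<i> * (complex_of_real s - complex_of_real t)) * (2 * pi * \<i>)) (at (complex_of_real s))"
      by (rule DERIV_chain2[OF DERIV_exp]) (auto intro!: derivative_eq_intros)
    from DERIV_diff[OF DERIV_const[of 1] DERIV_cmult[OF this, of "complex_of_real \<rho>"]]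
    have dh: "(h has_field_derivative (h (complex_of_real s) - 1) * (2 * pi * \<i>)) (at (complex_of_real s))"
      unfolding h_def by (simp add: mult_ac)
    have "((\<lambda>c. Ln (h c)) has_field_derivative inverse (h (complex_of_real s)) * ((h (complex_of_real s) - 1) * (2 * pi * \<i>))) (at (complex_of_real s))"
      by (rule DERIV_chain2[OF has_field_derivative_Ln[OF h_Ln] dh])
    from DERIV_diff[OF DERIV_ident DERIV_cdivide[OF this, of "2 * pi * \<i>"]]
    have "(G has_field_derivative 1 - inverse (h (complex_of_real s)) * ((h (complex_of_real s) - 1) * (2 * pi * \<i>)) / (2 * pi * \<i>)) (at (complex_of_real s))"
      unfolding G_def .
    also have "1 - inverse (h (complex_of_real s)) * ((h (complex_of_real s) - 1) * (2 * pi * \<i>)) / (2 * pi * \<i>) = 1 / h (complex_of_real s)"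
      using ne by (simp add: field_simps)
    finally have "((\<lambda>x. G (complex_of_real x)) has_vector_derivative 1 / h (complex_of_real s)) (at s within {0..1})"
      by (rule has_vector_derivative_real_field)
    then show ?thesis
      by (rule bounded_linear.has_vector_derivative[OF bounded_linear_Re])
  qed
  have "(\<integral>s. indicator {0..1} s *\<^sub>R Re (1 / h (complex_of_real s)) \<partial>lborel) = Re (G (complex_of_real 1)) - Re (G (complex_of_real 0))"
  proof (rule integral_FTC_Icc[OF _ der])
    show "continuous_on {0..1} (\<lambda>s. Re (1 / h (complex_of_real s)))"
      unfolding h_real
    proof (intro continuous_intros ballI)
      show "1 - complex_of_real \<rho> * cis (2 * pi * (s - t)) \<noteq> 0" for s
        using h_pos[of s] unfolding h_real by (metis less_irrefl zero_complex.sel(1))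
    qed
  qed simp
  moreover have "h 1 = h 0"
  proof -
    have "cis (2 * pi * (1 - t)) = cis (2 * pi * (0 - t))"
    proof -
      have "2 * pi * (1 - t) = 2 * pi + 2 * pi * (0 - t)" by (simp add: algebra_simps)
      then show ?thesis by (simp only: cis_mult[symmetric] cis_2pi) simp
    qed
    then show ?thesis using h_real[of 1] h_real[of 0] by simp
  qed
  ultimately show ?thesis unfolding h_real by (simp add: G_def)
qed

text \<open>The normalized arc length of a circle in a complex line has energy 1.\<close>

lemma ex_finite_energy:
  "\<exists>\<mu> :: (complex ^ 'd) measure. prob_space \<mu> \<and> sets \<mu> = sets sphere_borel \<and> energy \<mu> < \<infinity>"
proof -
  define U where "U = restrict_space lborel {0 .. 1 :: real}"
  interpret U: prob_space U
    by (rule prob_spaceI) (simp add: U_def space_restrict_space emeasure_restrict_space)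
  have int_U: "(\<integral>s. f s \<partial>U) = (\<integral>s. indicator {0..1} s *\<^sub>R f s \<partial>lborel)" for f :: "real \<Rightarrow> real"
    unfolding U_def by (subst integral_restrict_space) auto
  \<comment> \<open>The index \<open>undefined :: 'd\<close> just selects some coordinate.\<close>
  define \<gamma> where "\<gamma> s = (axis (undefined :: 'd) (cis (2 * pi * s)))" for s
  have \<gamma>_norm: "norm (\<gamma> s) = 1" for s by (simp add: \<gamma>_def norm_vec_def L2_set_def axis_def if_distrib[of norm] if_distrib[of "\<lambda>x. x\<^sup>2"] cong: if_cong)
  have "continuous_on UNIV \<gamma>"
    unfolding \<gamma>_def axis_def
  proof (intro continuous_on_vec_lambda)
    show "continuous_on UNIV (\<lambda>x. if i = undefined then cis (2 * pi * x) else 0)" for i :: 'd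
      by (cases "i = undefined") (auto intro!: continuous_intros)
  qed
  then have "\<gamma> \<in> borel_measurable borel" by (rule borel_measurable_continuous_onI)
  then have "\<gamma> \<in> borel \<rightarrow>\<^sub>M sphere_borel"
    unfolding sphere_borel_def by (intro measurable_restrict_space2) (auto simp: \<gamma>_norm)
  then have \<gamma>_meas: "\<gamma> \<in> U \<rightarrow>\<^sub>M sphere_borel"
    unfolding U_def by (intro measurable_restrict_space1) simp
  define \<mu> where "\<mu> = distr U sphere_borel \<gamma>"
  interpret \<mu>: prob_space \<mu> unfolding \<mu>_def by (rule U.prob_space_distr[OF \<gamma>_meas])
  interpret \<mu>: sphere_measure \<mu> by unfold_locales (simp add: \<mu>_def)
  have meas: "f \<in> borel_measurable sphere_borel" if "f \<in> borel_measurable \<mu>" for f :: "complex ^ 'd \<Rightarrow> real"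
    using that measurable_cong_sets[OF \<mu>.sets_eq refl] by blast
  have pot: "\<mu>.potential (\<lambda>_. 1) (r *\<^sub>R \<gamma> t) = 1" if r: "0 \<le> r" "r < 1" for r t
  proof -
    have kern: "da_kernel (\<gamma> s) (r *\<^sub>R \<gamma> t) = 1 / (1 - complex_of_real r * cis (2 * pi * (s - t)))" for s
    proof -
      have "hip (\<gamma> s) (\<gamma> t) = (\<Sum>i\<in>(UNIV :: 'd set). if i = undefined then cis (2 * pi * s) * cnj (cis (2 * pi * t)) else 0)"
        unfolding hip_def \<gamma>_def axis_def by (intro sum.cong refl) auto
      also have "\<dots> = cis (2 * pi * (s - t))"
        by (simp add: cis_cnj cis_mult right_diff_distrib)
      finally show ?thesis by (simp add: da_kernel_hip hip_scaleR_right)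
    qed
    have "\<mu>.potential (\<lambda>_. 1) (r *\<^sub>R \<gamma> t) = (\<integral>s. Re (da_kernel (\<gamma> s) (r *\<^sub>R \<gamma> t)) \<partial>U)"
      unfolding \<mu>.potential_def using r
      by (subst \<mu>_def, subst integral_distr[OF \<gamma>_meas]) (auto intro!: meas \<mu>.measurable_kernel simp: \<gamma>_norm)
    then show ?thesis unfolding kern int_U using integral_Re_recip_one_minus_cis[OF r, of t] by simp
  qed
  have "\<mu>.weighted_energy (\<lambda>_. 1) r = 1" if r: "0 \<le> r" "r < 1" for r
  proof -
    have r2: "0 \<le> r\<^sup>2" "r\<^sup>2 < 1" using r by (auto simp: power_less_one_iff)
    have "\<mu>.weighted_energy (\<lambda>_. 1) r = (\<integral>s. \<mu>.potential (\<lambda>_. 1) (r\<^sup>2 *\<^sub>R \<gamma> s) \<partial>U)"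
      unfolding \<mu>.weighted_energy_def
      by (subst \<mu>_def, subst integral_distr[OF \<gamma>_meas])
        (use r2 in \<open>auto intro!: meas \<mu>.measurable_potential_scaled[where B = 1]\<close>)
    then show ?thesis using pot[OF r2] by (simp add: U.prob_space)
  qed
  then have "energy \<mu> = (SUP r\<in>{0..<1 :: real}. 1)" unfolding \<mu>.energy_eq by (intro SUP_cong) auto
  then have "energy \<mu> < \<infinity>" by simp
  then show ?thesis using \<mu>.prob_space_axioms \<mu>.sets_eq by blast
qed

section \<open>Convexity of the energy and a density of maximal support\<close>

context drury_arveson_sphere
begin

lemma weighted_energy_scale: "weighted_energy (\<lambda>z. c * f z) r = c\<^sup>2 * weighted_energy f r"
proof -
  have "potential (\<lambda>z. c * f z) w = c * potential f w" for w
    unfolding potential_def by (simp add: mult.left_commute)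
  then show ?thesis unfolding weighted_energy_def by (simp add: power2_eq_square mult_ac)
qed

text \<open>The energy is a positive quadratic form: its value at f - g is nonnegative, and this
  bounds the mixed terms by the pure ones.\<close>

lemma weighted_energy_midpoint:
  assumes f: "f \<in> borel_measurable M" "\<And>z. z \<in> sphere 0 1 \<Longrightarrow> \<bar>f z\<bar> \<le> B"
    and g: "g \<in> borel_measurable M" "\<And>z. z \<in> sphere 0 1 \<Longrightarrow> \<bar>g z\<bar> \<le> C" and r: "0 \<le> r" "r < 1"
  shows "weighted_energy (\<lambda>z. (f z + g z) / 2) r \<le> (weighted_energy f r + weighted_energy g r) / 2"
proof -
  have r2: "r\<^sup>2 < 1" using r by (simp add: power_less_one_iff)
  define W where "W a b = (\<integral>z. a z * potential b (r\<^sup>2 *\<^sub>R z) \<partial>M)" for a b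
  have nr: "norm (r\<^sup>2 *\<^sub>R z) < 1" if "z \<in> space M" for z using that r2 by (simp add: space_eq)
  have lin: "potential (\<lambda>z. s * f z + t * g z) w = s * potential f w + t * potential g w" if "norm w < 1" for s t w
    unfolding potential_def using integrable_kernel[OF that f] integrable_kernel[OF that g]
    by (simp add: distrib_left mult.left_commute)
  have "weighted_energy (\<lambda>z. s * f z + t * g z) r = s\<^sup>2 * W f f + s * t * W f g + t * s * W g f + t\<^sup>2 * W g g" for s t
  proof -
    have "weighted_energy (\<lambda>z. s * f z + t * g z) r = (\<integral>z. s\<^sup>2 * (f z * potential f (r\<^sup>2 *\<^sub>R z)) + s * t * (f z * potential g (r\<^sup>2 *\<^sub>R z))
        + t * s * (g z * potential f (r\<^sup>2 *\<^sub>R z)) + t\<^sup>2 * (g z * potential g (r\<^sup>2 *\<^sub>R z)) \<partial>M)"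
      unfolding weighted_energy_def
    proof (rule Bochner_Integration.integral_cong[OF refl])
      fix z assume z: "z \<in> space M"
      show "(s * f z + t * g z) * potential (\<lambda>z. s * f z + t * g z) (r\<^sup>2 *\<^sub>R z) =
        s\<^sup>2 * (f z * potential f (r\<^sup>2 *\<^sub>R z)) + s * t * (f z * potential g (r\<^sup>2 *\<^sub>R z))
        + t * s * (g z * potential f (r\<^sup>2 *\<^sub>R z)) + t\<^sup>2 * (g z * potential g (r\<^sup>2 *\<^sub>R z))"
        unfolding lin[OF nr[OF z]] by (simp add: power2_eq_square[of s] power2_eq_square[of t] algebra_simps)
    qed
    also have "\<dots> = s\<^sup>2 * W f f + s * t * W f g + t * s * W g f + t\<^sup>2 * W g g"
      unfolding W_def using weighted_energy_integrable[OF f f r] weighted_energy_integrable[OF f g r]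
        weighted_energy_integrable[OF g f r] weighted_energy_integrable[OF g g r] by simp
    finally show ?thesis .
  qed
  note expand = this
  have "0 \<le> weighted_energy (\<lambda>z. 1 * f z + (- 1) * g z) r"
  proof (rule weighted_energy_nonneg[OF _ _ r])
    show "(\<lambda>z. 1 * f z + (- 1) * g z) \<in> borel_measurable M" using f g by simp
    show "\<bar>1 * f z + (- 1) * g z\<bar> \<le> B + C" if "z \<in> sphere 0 1" for z
      using f(2)[OF that] g(2)[OF that] by simp
  qed
  then have "W f g + W g f \<le> W f f + W g g" unfolding expand by simp
  moreover have "weighted_energy (\<lambda>z. (f z + g z) / 2) r = (W f f + W f g + W g f + W g g) / 4"
    using expand[of "1/2" "1/2"] by (simp add: add_divide_distrib power2_eq_square)
  moreover have "weighted_energy f r = W f f" "weighted_energy g r = W g g"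
    unfolding weighted_energy_def W_def by auto
  ultimately show ?thesis by simp
qed

lemma weighted_energy_convergence:
  assumes f: "\<And>n. f n \<in> borel_measurable M" "\<And>n z. z \<in> sphere 0 1 \<Longrightarrow> \<bar>f n z\<bar> \<le> B"
    and lim: "\<And>z. z \<in> sphere 0 1 \<Longrightarrow> (\<lambda>n. f n z) \<longlonglongrightarrow> g z" and r: "0 \<le> r" "r < 1"
  shows "(\<lambda>n. weighted_energy (f n) r) \<longlonglongrightarrow> weighted_energy g r"
proof -
  have r2: "r\<^sup>2 < 1" using r by (simp add: power_less_one_iff)
  have nr: "norm (r\<^sup>2 *\<^sub>R z) \<le> r\<^sup>2" if "z \<in> space M" for z using that by (simp add: space_eq)
  have pot: "(\<lambda>n. potential (f n) w) \<longlonglongrightarrow> potential g w" if w: "norm w < 1" for w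
    unfolding potential_def
  proof (rule bounded_convergence(2))
    show "(\<lambda>z. Re (da_kernel z w) * f n z) \<in> borel_measurable M" for n
      by (intro borel_measurable_times measurable_kernel w f)
    show "(\<lambda>n. Re (da_kernel z w) * f n z) \<longlonglongrightarrow> Re (da_kernel z w) * g z" if "z \<in> space M" for z
      using that by (intro tendsto_mult tendsto_const lim) (simp add: space_eq)
    show "norm (Re (da_kernel z w) * f n z) \<le> 1 / (1 - norm w) * B" if "z \<in> space M" for n z
      unfolding real_norm_def abs_mult using that f(2)[of z n] w
      by (intro mult_mono abs_Re_kernel_le) (auto simp: space_eq)
  qed
  show ?thesis
    unfolding weighted_energy_def
  proof (rule bounded_convergence(2))
    show "(\<lambda>z. f n z * potential (f n) (r\<^sup>2 *\<^sub>R z)) \<in> borel_measurable M" for n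
      using r2 by (intro borel_measurable_times measurable_potential_scaled[OF f] f) auto
    fix z assume z: "z \<in> space M"
    show "(\<lambda>n. f n z * potential (f n) (r\<^sup>2 *\<^sub>R z)) \<longlonglongrightarrow> g z * potential g (r\<^sup>2 *\<^sub>R z)"
      using z nr[OF z] r2 by (intro tendsto_mult lim pot) (auto simp: space_eq)
    show "norm (f n z * potential (f n) (r\<^sup>2 *\<^sub>R z)) \<le> B * (1 / (1 - r\<^sup>2) * B * measure M (space M))" for n
      unfolding real_norm_def abs_mult using z f(2)[of z n] r2 nr[OF z]
      by (intro mult_mono abs_potential_le[OF f]) (auto simp: space_eq)
  qed
qed

text \<open>Peeling off the first term shows the sum to be the midpoint of \<open>g j\<close> and
  the shorter sum starting at \<open>Suc j\<close>; the offset j is carried along for this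
  induction.\<close>

lemma weighted_energy_geometric_sum:
  assumes g: "\<And>k. g k \<in> borel_measurable M" "\<And>k z. 0 \<le> g k z" "\<And>k z. g k z \<le> 1"
    and E: "\<And>k. weighted_energy (g k) r \<le> 1" and r: "0 \<le> r" "r < 1"
  shows "(\<lambda>z. \<Sum>k<n. (1/2) ^ Suc k * g (j + k) z) \<in> borel_measurable M \<and>
    (\<forall>z. 0 \<le> (\<Sum>k<n. (1/2) ^ Suc k * g (j + k) z) \<and> (\<Sum>k<n. (1/2) ^ Suc k * g (j + k) z) \<le> 1) \<and>
    weighted_energy (\<lambda>z. \<Sum>k<n. (1/2) ^ Suc k * g (j + k) z) r \<le> 1"
proof (induction n arbitrary: j)
  case 0
  then show ?case by (simp add: weighted_energy_def)
next
  case (Suc n)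
  define S where "S z = (\<Sum>k<n. (1/2) ^ Suc k * g (Suc j + k) z)" for z
  have S: "S \<in> borel_measurable M" "\<And>z. 0 \<le> S z" "\<And>z. S z \<le> 1" "weighted_energy S r \<le> 1"
    using Suc[of "Suc j"] unfolding S_def by auto
  have eq: "(\<Sum>k<Suc n. (1/2) ^ Suc k * g (j + k) z) = (g j z + S z) / 2" for z
    unfolding S_def sum.lessThan_Suc_shift
    by (simp add: sum_distrib_left sum_divide_distrib add_divide_distrib)
  have "weighted_energy (\<lambda>z. (g j z + S z) / 2) r \<le> (weighted_energy (g j) r + weighted_energy S r) / 2"
    by (rule weighted_energy_midpoint[where B = 1 and C = 1]) (use g S r in auto)
  also have "\<dots> \<le> 1" using E[of j] S(4) by simp
  finally have "weighted_energy (\<lambda>z. (g j z + S z) / 2) r \<le> 1" .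
  moreover have "(\<lambda>z. (g j z + S z) / 2) \<in> borel_measurable M" using g S by simp
  moreover have "0 \<le> (g j z + S z) / 2 \<and> (g j z + S z) / 2 \<le> 1" for z
    using g(2,3)[of j z] S(2,3)[of z] by simp
  ultimately show ?case unfolding eq by blast
qed

text \<open>The bound by 1 is a normalization, since rescaling changes neither the set where h is
  positive nor the finiteness of the energy. The bound E may depend on h.\<close>

definition finite_energy_densities :: "(complex ^ 'd \<Rightarrow> real) set"
  where "finite_energy_densities = {h \<in> borel_measurable M. (\<forall>z. 0 \<le> h z \<and> h z \<le> 1) \<and>
    (\<exists>E. \<forall>r. 0 \<le> r \<and> r < 1 \<longrightarrow> weighted_energy h r \<le> E)}"

text \<open>A weighted series of densities whose positivity sets have measure tending to the
  supremum attains that supremum. A density positive on a further set of positive measure would beat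
  it after averaging with the maximal one.\<close>

lemma maximal_finite_energy_density:
  "\<exists>h\<in>finite_energy_densities. \<forall>g\<in>finite_energy_densities. AE z in M. 0 < g z \<longrightarrow> 0 < h z"
proof -
  let ?F = finite_energy_densities
  define s where "s h = measure M {z \<in> space M. 0 < h z}" for h :: "complex ^ 'd \<Rightarrow> real"
  have F_meas: "h \<in> borel_measurable M" if "h \<in> ?F" for h
    using that by (simp add: finite_energy_densities_def)
  have F_sets: "{z \<in> space M. 0 < h z} \<in> sets M" if "h \<in> ?F" for h
    using F_meas[OF that] by measurable
  have "(\<lambda>_. 0) \<in> ?F" unfolding finite_energy_densities_def
    by (auto simp: weighted_energy_def)
  then have ne: "?F \<noteq> {}" by blast
  have bdd: "bdd_above (s ` ?F)"
    unfolding s_def by (intro bdd_aboveI2[where M = "measure M (space M)"] bounded_measure)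
  define a where "a = Sup (s ` ?F)"
  have s_le: "s h \<le> a" if "h \<in> ?F" for h
    unfolding a_def using that bdd by (intro cSup_upper) auto
  have "\<exists>h\<in>?F. a - 1 / (real k + 1) < s h" for k
    using less_cSupD[of "s ` ?F" "a - 1 / (real k + 1)"] ne unfolding a_def by auto
  then obtain h where h: "\<And>k. h k \<in> ?F" "\<And>k. a - 1 / (real k + 1) < s (h k)" by metis
  have "\<exists>E. \<forall>r. 0 \<le> r \<and> r < 1 \<longrightarrow> weighted_energy (h k) r \<le> E" for k
    using h(1)[of k] by (simp add: finite_energy_densities_def)
  then obtain E where E: "\<And>k r. 0 \<le> r \<Longrightarrow> r < 1 \<Longrightarrow> weighted_energy (h k) r \<le> E k" by metis
  \<comment> \<open>With this factor each energy is at most c^2 max 1 E = c \<le> 1, so one bound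
    holds for all k and survives the summation.\<close>
  define c where "c k = 1 / max 1 (E k)" for k
  have c: "0 < c k" "c k \<le> 1" for k by (auto simp: c_def)
  define g where "g k z = c k * h k z" for k z
  have h01: "0 \<le> h k z" "h k z \<le> 1" for k z using h(1)[of k] by (auto simp: finite_energy_densities_def)
  have g: "g k \<in> borel_measurable M" "0 \<le> g k z" "g k z \<le> 1" for k z
    unfolding g_def using F_meas[OF h(1)[of k]] h01 c[of k] by (auto intro: mult_le_one)
  have gE: "weighted_energy (g k) r \<le> 1" if r: "0 \<le> r" "r < 1" for k r
  proof -
    have "weighted_energy (g k) r = (c k)\<^sup>2 * weighted_energy (h k) r"
      unfolding g_def[abs_def] by (rule weighted_energy_scale)
    also have "\<dots> \<le> (c k)\<^sup>2 * max 1 (E k)"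
      using E[OF r, of k] by (intro mult_left_mono) auto
    also have "\<dots> = c k" by (simp add: c_def power2_eq_square)
    finally show ?thesis using c(2)[of k] by linarith
  qed
  define S where "S n z = (\<Sum>k<n. (1/2) ^ Suc k * g (0 + k) z)" for n z
  have S_all: "S n \<in> borel_measurable M \<and> (\<forall>z. 0 \<le> S n z \<and> S n z \<le> 1) \<and> weighted_energy (S n) r \<le> 1"
    if "0 \<le> r" "r < 1" for n r
    unfolding S_def[abs_def] by (rule weighted_energy_geometric_sum) (use g gE that in auto)
  have S: "S n \<in> borel_measurable M" "0 \<le> S n z" "S n z \<le> 1" for n z
    using S_all[of 0 n] by auto
  have SE: "weighted_energy (S n) r \<le> 1" if "0 \<le> r" "r < 1" for n r
    using S_all[OF that] by blast
  have summ: "summable (\<lambda>k. (1/2) ^ Suc k * g k z)" for z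
  proof (rule summable_comparison_test'[of "\<lambda>k. (1/2) ^ Suc k" 0])
    show "summable (\<lambda>k. (1/2 :: real) ^ Suc k)" by (subst summable_Suc_iff) (rule summable_geometric, simp)
    show "norm ((1/2) ^ Suc k * g k z) \<le> (1/2) ^ Suc k" for k
      using g(2,3)[of k z] by (simp add: abs_mult mult_le_cancel_left1)
  qed
  define H where "H z = (\<Sum>k. (1/2) ^ Suc k * g k z)" for z
  have S_lim: "(\<lambda>n. S n z) \<longlonglongrightarrow> H z" for z
    using summable_LIMSEQ[OF summ[of z]] unfolding S_def H_def by simp
  have H_meas: "H \<in> borel_measurable M" by (rule borel_measurable_LIMSEQ_real[OF S_lim S(1)])
  have H01: "0 \<le> H z" "H z \<le> 1" for z
    using LIMSEQ_le_const[OF S_lim[of z]] LIMSEQ_le_const2[OF S_lim[of z]] S(2,3) by auto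
  have "weighted_energy H r \<le> 1" if r: "0 \<le> r" "r < 1" for r
  proof (rule LIMSEQ_le_const2)
    show "(\<lambda>n. weighted_energy (S n) r) \<longlonglongrightarrow> weighted_energy H r"
      by (rule weighted_energy_convergence[where B = 1]) (use S S_lim r in auto)
    show "\<exists>N. \<forall>n\<ge>N. weighted_energy (S n) r \<le> 1" using SE r by blast
  qed
  then have HF: "H \<in> ?F"
    unfolding finite_energy_densities_def using H_meas H01 by blast
  have H_pos: "0 < H z" if "0 < h k z" for k z
  proof -
    have "0 < (1/2) ^ Suc k * g k z" using that c(1)[of k] by (simp add: g_def)
    also have "\<dots> \<le> (\<Sum>i\<in>{k}. (1/2) ^ Suc i * g i z)" by simp
    also have "\<dots> \<le> H z" unfolding H_def using g(2) by (intro sum_le_suminf summ) auto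
    finally show ?thesis .
  qed
  have sH: "a \<le> s H"
  proof (rule LIMSEQ_le_const2)
    show "(\<lambda>k. a - 1 / (real k + 1)) \<longlonglongrightarrow> a"
    proof -
      have "(\<lambda>k. a - 1 / (real k + 1)) \<longlonglongrightarrow> a - 0"
        by (intro tendsto_intros tendsto_recip_Suc)
      then show ?thesis by simp
    qed
    have "s (h k) \<le> s H" for k
      unfolding s_def using H_pos F_sets[OF HF] by (intro finite_measure_mono) auto
    then show "\<exists>N. \<forall>k\<ge>N. a - 1 / (real k + 1) \<le> s H"
      using h(2) by (meson less_le_trans less_imp_le)
  qed
  have "AE z in M. 0 < f z \<longrightarrow> 0 < H z" if f: "f \<in> ?F" for f
  proof -
    define A where "A = {z \<in> space M. 0 < f z \<and> \<not> 0 < H z}"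
    define m where "m z = (H z + f z) / 2" for z
    have f01: "0 \<le> f z" "f z \<le> 1" for z using f by (auto simp: finite_energy_densities_def)
    obtain E' E'' where E': "\<And>r. 0 \<le> r \<Longrightarrow> r < 1 \<Longrightarrow> weighted_energy f r \<le> E'"
      "\<And>r. 0 \<le> r \<Longrightarrow> r < 1 \<Longrightarrow> weighted_energy H r \<le> E''"
      using f HF unfolding finite_energy_densities_def by blast
    have mE: "weighted_energy m r \<le> (E'' + E') / 2" if r: "0 \<le> r" "r < 1" for r
    proof -
      have "weighted_energy m r \<le> (weighted_energy H r + weighted_energy f r) / 2"
        unfolding m_def[abs_def]
        by (rule weighted_energy_midpoint[where B = 1 and C = 1]) (use H_meas F_meas[OF f] H01 f01 r in auto)
      then show ?thesis using E'[OF r] by simp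
    qed
    have mF: "m \<in> ?F"
      unfolding finite_energy_densities_def
    proof (intro CollectI conjI allI)
      show "m \<in> borel_measurable M" unfolding m_def using H_meas F_meas[OF f] by simp
      show "0 \<le> m z" "m z \<le> 1" for z unfolding m_def using H01[of z] f01[of z] by auto
      show "\<exists>E. \<forall>r. 0 \<le> r \<and> r < 1 \<longrightarrow> weighted_energy m r \<le> E" using mE by blast
    qed
    have A: "A \<in> sets M" unfolding A_def using H_meas F_meas[OF f] by measurable
    have "{z \<in> space M. 0 < m z} = {z \<in> space M. 0 < H z} \<union> A"
      unfolding A_def m_def using H01 f01 by (auto simp: add_pos_nonneg add_nonneg_pos not_less order_antisym)
    then have "s m = s H + measure M A"
      unfolding s_def using A F_sets[OF HF] by (subst finite_measure_Union[symmetric]) (auto simp: A_def)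
    then have "measure M A = 0"
      using s_le[OF mF] sH measure_nonneg[of M A] by linarith
    then have "A \<in> null_sets M" using A by (simp add: emeasure_eq_measure null_setsI)
    then show ?thesis by (rule AE_I') (auto simp: A_def)
  qed
  with HF show ?thesis by blast
qed

end

text \<open>Inner regularity is applied to the image of M under inclusion of the sphere into the
  whole space, where the Borel sets and compact sets in question have the same measure.\<close>

lemma (in sphere_measure) compact_inner_approx:
  assumes B: "B \<in> sets M" and e: "0 < e"
  obtains K where "compact K" "K \<subseteq> B" "measure M B - measure M K < e"
proof -
  have id: "(\<lambda>z. z) \<in> M \<rightarrow>\<^sub>M borel" by (intro measurable_continuous continuous_intros)
  define D where "D = distr M borel (\<lambda>z. z)"
  have D: "emeasure D A = emeasure M A" if "A \<in> sets borel" "A \<subseteq> sphere 0 1" for A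
  proof -
    have "A \<inter> space M = A" using that by (auto simp: space_eq)
    then show ?thesis unfolding D_def using that by (subst emeasure_distr[OF id]) auto
  qed
  have B': "B \<in> sets borel" "B \<subseteq> sphere 0 1"
    using B unfolding sets_eq sphere_borel_sets_iff by auto
  have "emeasure D B = (SUP K\<in>{K. K \<subseteq> B \<and> compact K}. emeasure D K)"
  proof (rule inner_regular)
    have "emeasure D (space D) = emeasure M (space M)"
      unfolding D_def using id by (subst emeasure_distr) auto
    then show "emeasure D (space D) \<noteq> \<infinity>" by simp
  qed (use B' in \<open>auto simp: D_def\<close>)
  then have sup: "emeasure M B = (SUP K\<in>{K. K \<subseteq> B \<and> compact K}. emeasure D K)"
    using D[OF B'] by simp
  show ?thesis
  proof (cases "measure M B < e")
    case True
    then show ?thesis using that[of "{}"] by simp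
  next
    case False
    then have "ennreal (measure M B - e) < emeasure M B"
      using e by (simp add: emeasure_eq_measure ennreal_lessI)
    then obtain K where K: "K \<subseteq> B" "compact K" "ennreal (measure M B - e) < emeasure D K"
      unfolding sup less_SUP_iff by auto
    have "emeasure D K = ennreal (measure M K)"
      using D[of K] K B' by (auto simp: emeasure_eq_measure borel_compact)
    then have "measure M B - e < measure M K"
      using K(3) False by (simp add: ennreal_less_iff)
    then show ?thesis using that[of K] K by simp
  qed
qed

section \<open>Normalization of a density\<close>

context drury_arveson_sphere
begin

text \<open>Dividing h by its integral c multiplies the energy by \<open>(1 / c)\<^sup>2\<close>.
  Positivity of h almost everywhere makes the null sets of the two measures agree, so absolute
  continuity carries over from M.\<close>

lemma ex_finite_energy_density:
  assumes h: "h \<in> finite_energy_densities" and pos: "AE z in M. 0 < h z" and ne: "0 < measure M (space M)"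
  shows "\<exists>\<mu>. prob_space \<mu> \<and> sets \<mu> = sets sphere_borel \<and> energy \<mu> < \<infinity> \<and> null_sets \<mu> = null_sets M"
proof -
  have h_meas [measurable]: "h \<in> borel_measurable M" and h01: "\<And>z. 0 \<le> h z" "\<And>z. h z \<le> 1"
    using h by (auto simp: finite_energy_densities_def)
  obtain E where E: "\<And>r. 0 \<le> r \<Longrightarrow> r < 1 \<Longrightarrow> weighted_energy h r \<le> E"
    using h by (auto simp: finite_energy_densities_def)
  have int_h: "integrable M h" using h01 by (intro integrable_bounded[OF h_meas, where C = 1]) auto
  define c where "c = (\<integral>z. h z \<partial>M)"
  have "c \<noteq> 0"
  proof
    assume "c = 0"
    then have "AE z in M. h z = 0"
      unfolding c_def using integral_nonneg_eq_0_iff_AE[OF int_h] h01 by auto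
    then have "AE z in M. False" using pos by eventually_elim simp
    then have "emeasure M (space M) = 0" using emeasure_eq_0_AE[of "\<lambda>_. True" M] by simp
    then show False using ne by (simp add: measure_def)
  qed
  then have c: "c > 0" unfolding c_def using integral_nonneg_AE[of h M] h01 by (simp add: order_le_less)
  define g where "g z = (1 / c) * h z" for z
  have g_meas [measurable]: "g \<in> borel_measurable M" and g0: "0 \<le> g z" for z
    unfolding g_def using c h01 by auto
  define \<mu> where "\<mu> = density M (\<lambda>z. ennreal (g z))"
  interpret \<mu>: prob_space \<mu>
  proof
    have "emeasure \<mu> (space \<mu>) = (\<integral>\<^sup>+z. ennreal (g z) \<partial>M)"
      unfolding \<mu>_def by (simp add: emeasure_density)
    also have "\<dots> = ennreal (\<integral>z. g z \<partial>M)"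
      using int_h g0 by (intro nn_integral_eq_integral) (auto simp: g_def[abs_def])
    also have "(\<integral>z. g z \<partial>M) = 1" unfolding g_def using c by (simp add: c_def[symmetric])
    finally show "emeasure \<mu> (space \<mu>) = 1" by simp
  qed
  interpret \<mu>: sphere_measure \<mu> by unfold_locales (simp add: \<mu>_def sets_eq)
  have int_\<mu>: "(\<integral>z. f z \<partial>\<mu>) = (\<integral>z. g z * f z \<partial>M)" if "f \<in> borel_measurable M" for f :: "complex ^ 'd \<Rightarrow> real"
    unfolding \<mu>_def using that g0 by (subst integral_density) auto
  have pot: "\<mu>.potential (\<lambda>_. 1) w = potential g w" if "norm w < 1" for w
    unfolding \<mu>.potential_def potential_def using measurable_kernel[OF that] by (subst int_\<mu>) (auto simp: mult.commute)
  have "\<mu>.weighted_energy (\<lambda>_. 1) r \<le> (1 / c)\<^sup>2 * E" if r: "0 \<le> r" "r < 1" for r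
  proof -
    have r2: "r\<^sup>2 < 1" using r by (simp add: power_less_one_iff)
    have "(\<lambda>z. \<mu>.potential (\<lambda>_. 1) (r\<^sup>2 *\<^sub>R z)) \<in> borel_measurable \<mu>"
      using r2 by (intro \<mu>.measurable_potential_scaled[where B = 1]) auto
    then have meas: "(\<lambda>z. \<mu>.potential (\<lambda>_. 1) (r\<^sup>2 *\<^sub>R z)) \<in> borel_measurable M"
      by (simp add: \<mu>_def)
    have "\<mu>.weighted_energy (\<lambda>_. 1) r = (\<integral>z. g z * \<mu>.potential (\<lambda>_. 1) (r\<^sup>2 *\<^sub>R z) \<partial>M)"
      unfolding \<mu>.weighted_energy_def using int_\<mu>[OF meas] by simp
    also have "\<dots> = weighted_energy g r"
      unfolding weighted_energy_def using r2
      by (intro Bochner_Integration.integral_cong refl) (simp add: pot space_eq)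
    also have "\<dots> = (1 / c)\<^sup>2 * weighted_energy h r"
      unfolding g_def[abs_def] by (rule weighted_energy_scale)
    also have "\<dots> \<le> (1 / c)\<^sup>2 * E" using E[OF r] by (intro mult_left_mono) auto
    finally show ?thesis .
  qed
  then have "energy \<mu> \<le> ereal ((1 / c)\<^sup>2 * E)"
    unfolding \<mu>.energy_eq by (intro SUP_least) auto
  then have "energy \<mu> < \<infinity>" by (rule le_less_trans) simp
  moreover have "null_sets \<mu> = null_sets M"
  proof (intro set_eqI iffI)
    fix A assume "A \<in> null_sets \<mu>"
    then have A: "A \<in> sets M" "AE z in M. z \<in> A \<longrightarrow> ennreal (g z) = 0"
      unfolding \<mu>_def by (auto simp: null_sets_density_iff)
    from eventually_conj[OF A(2) pos] have "AE z in M. z \<notin> A"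
      by (rule eventually_mono) (use c in \<open>auto simp: g_def ennreal_eq_0_iff divide_le_0_iff\<close>)
    then show "A \<in> null_sets M" using A(1) by (simp add: AE_iff_null_sets)
  next
    fix A assume A: "A \<in> null_sets M"
    then have "AE z in M. z \<notin> A" by (rule AE_not_in)
    then show "A \<in> null_sets \<mu>"
      unfolding \<mu>_def using A by (auto simp: null_sets_density_iff elim: eventually_mono)
  qed
  ultimately show ?thesis using \<mu>.prob_space_axioms \<mu>.sets_eq by blast
qed

end

section \<open>Absolute continuity of Henkin measures\<close>

context drury_arveson
begin

theorem ex_finite_energy_if_henkin:
  assumes m: "complex_measure sphere_borel m" and henkin: "henkin H ip m"
  shows "\<exists>\<mu> :: (complex ^ 'd) measure. prob_space \<mu> \<and> sets \<mu> = sets sphere_borel \<and>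
    energy \<mu> < \<infinity> \<and> complex_absolutely_continuous \<mu> m"
proof -
  interpret m: complex_measure_on sphere_borel m by unfold_locales (rule m)
  interpret t: drury_arveson_sphere H ip m.total by unfold_locales simp
  have m_empty: "m {} = 0"
    using m.part.empty[of 0] m.part.empty[of 2] by (simp add: m.part_cases complex_eq_iff)
  have ac_total: "m A = 0" if "A \<in> null_sets m.total" for A
    using m.norm_measure_le[of A] null_setsD1[OF that] null_setsD2[OF that] by (simp add: measure_def)
  obtain h where h: "h \<in> t.finite_energy_densities"
    and max: "\<And>g. g \<in> t.finite_energy_densities \<Longrightarrow> AE z in m.total. 0 < g z \<longrightarrow> 0 < h z"
    using t.maximal_finite_energy_density by blast
  have h_meas: "h \<in> borel_measurable m.total" and h01: "\<And>z. 0 \<le> h z" "\<And>z. h z \<le> 1"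
    using h by (auto simp: t.finite_energy_densities_def)
  define N where "N = {z \<in> space m.total. h z = 0}"
  have N: "N \<in> sets m.total" unfolding N_def using h_meas by measurable
  have K_null: "m K = 0" if K: "compact K" "K \<subseteq> N" for K
  proof (cases "K = {}")
    case False
    have KS: "K \<subseteq> sphere 0 1" using K by (auto simp: N_def space_sphere_borel)
    show ?thesis
    proof (rule henkin_compact_null[OF m henkin K(1) KS False])
      fix R \<delta> :: real assume "0 \<le> R" "0 < \<delta>"
      then show "\<exists>(n :: nat) c w. (\<forall>i<n. 0 \<le> c i \<and> w i \<in> rays K) \<and> (\<Sum>i<n. c i) = 1 \<and>
        measure m.total {z\<in>K. (\<Sum>i<n. c i * Re (da_kernel z (w i))) < R} \<le> \<delta>"
      proof (rule t.large_kernel_combination[OF K(1) KS False])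
        fix g E assume g: "g \<in> borel_measurable m.total" "\<And>z. 0 \<le> g z \<and> g z \<le> 1" "\<And>z. z \<notin> K \<Longrightarrow> g z = 0"
          and E: "\<And>r. 0 \<le> r \<Longrightarrow> r < 1 \<Longrightarrow> t.weighted_energy g r \<le> E"
        have "g \<in> t.finite_energy_densities"
          unfolding t.finite_energy_densities_def using g E by blast
        then have "AE z in m.total. 0 < g z \<longrightarrow> 0 < h z" by (rule max)
        then have "AE z in m.total. g z = 0"
        proof (rule eventually_mono)
          fix z assume *: "0 < g z \<longrightarrow> 0 < h z"
          show "g z = 0"
          proof (cases "z \<in> K")
            case True
            then have "h z = 0" using K by (auto simp: N_def)
            then show ?thesis using * g(2)[of z] by auto
          qed (rule g(3))
        qed
        then show "(\<integral>z. g z \<partial>m.total) = 0" by (rule integral_eq_zero_AE)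
      qed
    qed
  qed (simp add: m_empty)
  \<comment> \<open>Inner approximation by compact sets, on which m vanishes; the rest has small
    measure under \<open>total\<close>, which dominates m. All measurable subsets of N are treated,
    as \<open>total_null\<close> requires.\<close>
  have B_null: "m B = 0" if B: "B \<in> sets sphere_borel" "B \<subseteq> N" for B
  proof -
    have "cmod (m B) \<le> e" if e: "e > 0" for e
    proof -
      obtain K where K: "compact K" "K \<subseteq> B" "measure m.total B - measure m.total K < e"
        using t.compact_inner_approx[of B e] B e by auto
      have KS: "K \<in> sets sphere_borel"
        using K B by (auto simp: sphere_borel_sets_iff borel_compact)
      have "m (B - K) = m B - m K"
        using m.part.Diff[OF B(1) KS K(2), of 0] m.part.Diff[OF B(1) KS K(2), of 2]
        by (simp add: m.part_cases complex_eq_iff)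
      moreover have "m K = 0" using K B by (intro K_null) auto
      moreover have "cmod (m (B - K)) \<le> measure m.total (B - K)"
        using B KS by (intro m.norm_measure_le) auto
      moreover have "measure m.total (B - K) = measure m.total B - measure m.total K"
        using B KS K by (intro m.total.finite_measure_Diff) auto
      ultimately show ?thesis using K(3) by simp
    qed
    then have "cmod (m B) \<le> 0" by (rule field_le_epsilon[of _ 0, simplified])
    then show ?thesis by simp
  qed
  \<comment> \<open>So h is positive almost everywhere for \<open>total\<close>, and the normalized
    density has exactly the null sets of \<open>total\<close>.\<close>
  have "emeasure m.total N = 0"
    by (rule m.total_null) (use N B_null in auto)
  then have "AE z in m.total. h z \<noteq> 0"
    using N by (intro AE_I[of _ _ N]) (auto simp: N_def)
  then have pos: "AE z in m.total. 0 < h z"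
    by (rule eventually_mono) (use h01 in \<open>auto simp: order_le_less\<close>)
  show ?thesis
  proof (cases "measure m.total (space m.total) = 0")
    \<comment> \<open>Here m is the zero measure and h cannot be normalized; any probability measure
      of finite energy will do, which is the purpose of \<open>ex_finite_energy\<close>.\<close>
    case True
    have "m A = 0" if "A \<in> sets sphere_borel" for A
    proof -
      have "measure m.total A \<le> 0"
        using m.total.bounded_measure[of A] True by simp
      then have "cmod (m A) \<le> 0" using m.norm_measure_le[OF that] by linarith
      then show ?thesis by simp
    qed
    moreover obtain \<mu> :: "(complex ^ 'd) measure" where "prob_space \<mu>" "sets \<mu> = sets sphere_borel" "energy \<mu> < \<infinity>"
      using ex_finite_energy by blast
    ultimately show ?thesis
      by (auto simp: complex_absolutely_continuous_def dest: null_setsD2)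
  next
    case False
    then have "0 < measure m.total (space m.total)"
      using measure_nonneg[of m.total "space m.total"] by linarith
    from t.ex_finite_energy_density[OF h pos this] show ?thesis
      using ac_total by (auto simp: complex_absolutely_continuous_def)
  qed
qed

end

theorem theorem1p4:
  fixes H :: "(complex ^ 'd \<Rightarrow> complex) set"
    and ip :: "(complex ^ 'd \<Rightarrow> complex) \<Rightarrow> (complex ^ 'd \<Rightarrow> complex) \<Rightarrow> complex"
    and m :: "(complex ^ 'd) set \<Rightarrow> complex"
  assumes "rkhs (ball 0 1) da_kernel H ip"
    and "complex_measure sphere_borel m"
  shows "henkin H ip m \<longleftrightarrow>
    (\<exists>\<mu> :: (complex ^ 'd) measure. prob_space \<mu> \<and> sets \<mu> = sets sphere_borel \<and>
       energy \<mu> < \<infinity> \<and> complex_absolutely_continuous \<mu> m)"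
proof -
  interpret drury_arveson H ip by (rule drury_arveson.intro[OF assms(1)])
  show ?thesis
    using ex_finite_energy_if_henkin[OF assms(2)] henkin_if_absolutely_continuous[OF assms(2)] by blast
qed

end
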